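(* Let $\{G_n : n\in\mathbb{N}\}$ be a sequence of random graphs with $G_n\sim G(n,\tfrac12)$ and let $M_n=\frac1n M_{\alpha_Z}(G_n)$. Then, with probability $1$, as $n\to\infty$ the probability distributions $D_{M_n}$ (the spectra of the singular values of $M_n$) converge weakly to the probability distribution on $\mathbb{R}$ whose probability density function is $g_{\alpha_Z}$, where, with $a=\frac{3\sqrt3}{2}$, $$g_{\alpha_Z}(x)=\frac{i}{\pi}\left(\sqrt3\,\sin\left(\frac13\arctan\left(\frac{3}{\sqrt{4x^2/3-9}}\right)\right)+\cos\left(\frac13\arctan\left(\frac{3}{\sqrt{4x^2/3-9}}\right)\right)\right)$$ for $x\in(0,a)$, and $g_{\alpha_Z}(x)=0$ for $x<0$ and for $x\ge a$.
   Context: Graph matrix: for a graph $G$ on $[n]=\{1,\dots,n\}$ and a pair $e=\{s,t\}$ of distinct vertices, $e(G)=1$ if $e\in E(G)$ and $e(G)=-1$ otherwise. The Z-shaped graph matrix $M_{\alpha_Z}=M_{\alpha_Z}(G)$ is the $n(n-1)\times n(n-1)$ matrix with rows and columns indexed by ordered pairs of distinct elements of $[n]$. Its entry at $((a_1,a_2),(b_1,b_2))$ is $e_1(G)e_2(G)e_3(G)$ with $e_1=\{a_1,b_1\}$, $e_2=\{a_2,b_1\}$, $e_3=\{a_2,b_2\}$ if $\{a_1,a_2\}\cap\{b_1,b_2\}=\emptyset$, and $0$ otherwise. $G(n,\frac12)$ is the uniformly random graph on $[n]$ (each edge present independently with probability $\frac12$). For an $N\times N$ real matrix $M$, $D_M$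 denotes the uniform distribution on its $N$ singular values, counted with multiplicity and including zero singular values. Weak convergence $D_n\to D$ of distributions on $\mathbb{R}$ means that the cumulative distribution functions satisfy $F_n(x)\to F(x)$ at every $x$ at which $F$ is continuous. Conventions in the formula for $g_{\alpha_Z}$: $\sqrt{-t}=i\sqrt t$ for $t>0$; $\arctan(ix)=\frac i2\ln\left(\frac{1+x}{1-x}\right)$ for real $x$; $\ln(-x)=\pi i+\ln x$ for $x>0$; $\sin x=\frac{e^{ix}-e^{-ix}}{2i}$ and $\cos x=\frac{e^{ix}+e^{-ix}}{2}$ for complex $x$. *)

theory Defs
  imports
    "HOL-Probability.Probability"
    "HOL-Library.Ramsey"
    "Jordan_Normal_Form.Char_Poly"
begin

text \<open>A graph on $\{1,\dots,n\}$ is identified with its edge set, a set of two-element subsets.\<close>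

definition graphs :: "nat \<Rightarrow> nat set set set" where
  "graphs n = Pow (nsets {1..n} 2)"

definition has_law_G_half :: "'w measure \<Rightarrow> nat \<Rightarrow> ('w \<Rightarrow> nat set set) \<Rightarrow> bool" where
  "has_law_G_half P n X \<longleftrightarrow>
     X \<in> measurable P (count_space (graphs n)) \<and>
     distr P (count_space (graphs n)) X = uniform_count_measure (graphs n)"

definition edge_sign :: "nat set set \<Rightarrow> nat set \<Rightarrow> real" where
  "edge_sign E e = (if e \<in> E then 1 else -1)"

definition Z_entry :: "nat set set \<Rightarrow> nat \<times> nat \<Rightarrow> nat \<times> nat \<Rightarrow> real" where
  "Z_entry E = (\<lambda>(a1, a2) (b1, b2).
     if {a1, a2} \<inter> {b1, b2} = {}
     then edge_sign E {a1, b1} * edge_sign E {a2, b1} * edge_sign E {a2, b2}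
     else 0)"

text \<open>Matrices of the library are indexed by initial segments of the naturals, so the ordered
  pairs of distinct vertices are enumerated (lexicographically). Rows and columns use the same
  enumeration; the singular values do not depend on its choice.\<close>

definition distinct_pairs :: "nat \<Rightarrow> (nat \<times> nat) list" where
  "distinct_pairs n = [(a, b). a \<leftarrow> [1..<Suc n], b \<leftarrow> [1..<Suc n], a \<noteq> b]"

definition Z_matrix :: "nat \<Rightarrow> nat set set \<Rightarrow> real Matrix.mat" where
  "Z_matrix n E = Matrix.mat (n * (n - 1)) (n * (n - 1))
     (\<lambda>(i, j). Z_entry E (distinct_pairs n ! i) (distinct_pairs n ! j))"

lemma distinct_distinct_pairs: "distinct (distinct_pairs n)"
proof -
  have "distinct_pairs n = filter (\<lambda>(a, b). a \<noteq> b) (List.product [1..<Suc n] [1..<Suc n])"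
    by (simp add: distinct_pairs_def product_concat_map filter_concat comp_def filter_map
        concat_map_singleton map_concat[symmetric] del: upt_Suc)
       (rule arg_cong[where f = concat], rule map_cong[OF refl], induct_tac rule: list.induct, auto)
  thus ?thesis by (simp add: distinct_product del: upt_Suc)
qed

lemma set_distinct_pairs: "set (distinct_pairs n) = {(a, b). a \<in> {1..n} \<and> b \<in> {1..n} \<and> a \<noteq> b}"
  by (auto simp: distinct_pairs_def simp del: upt_Suc)

lemma length_distinct_pairs: "length (distinct_pairs n) = n * (n - 1)"
proof -
  have "set (distinct_pairs n) = (SIGMA a:{1..n}. {1..n} - {a})"
    by (auto simp: set_distinct_pairs)
  hence "card (set (distinct_pairs n)) = n * (n - 1)"
    by simp
  thus ?thesis
    using distinct_card[OF distinct_distinct_pairs] by metis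
qed

text \<open>Singular values of a square real matrix: the square roots of the eigenvalues of
  $M^T M$, with algebraic multiplicity. As $M^T M$ is symmetric and positive semidefinite, its
  characteristic polynomial splits over the reals, so an $N \times N$ matrix has exactly $N$
  singular values.\<close>

definition singular_values :: "real Matrix.mat \<Rightarrow> real multiset" where
  "singular_values M = image_mset sqrt (proots (char_poly (transpose_mat M * M)))"

text \<open>For a matrix of dimension 0 this is an unspecified distribution.\<close>

definition sv_distribution :: "real Matrix.mat \<Rightarrow> real measure" where
  "sv_distribution M = distr (measure_pmf (pmf_of_multiset (singular_values M))) borel (\<lambda>x. x)"

text \<open>The density is given by a complex formula. The library functions follow these conventions
  for $\sqrt{-t}$, $\ln(-x)$ and $\arctan(ix)$ (for the square root see also
  \<open>csqrt_of_real'\<close>):\<close>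

lemma csqrt_neg: "t > 0 \<Longrightarrow> csqrt (complex_of_real (- t)) = \<i> * sqrt t"
  by (simp add: csqrt_of_real')

lemma Ln_neg: "x > 0 \<Longrightarrow> Ln (complex_of_real (- x)) = pi * \<i> + ln x"
  by (simp add: Ln_minus Ln_of_real)

lemma Arctan_i_times:
  "Arctan (\<i> * complex_of_real x) = \<i> / 2 * Ln (complex_of_real ((1 + x) / (1 - x)))"
proof -
  have "\<i> * (\<i> * complex_of_real x) = - complex_of_real x"
    by (simp flip: mult.assoc)
  thus ?thesis by (simp add: Arctan_def)
qed

definition g_Z :: "real \<Rightarrow> complex" where
  "g_Z x =
     (if 0 < x \<and> x < 3 * sqrt 3 / 2 then
        let \<theta> = 1 / 3 * Arctan (3 / csqrt (complex_of_real (4 * x\<^sup>2 / 3 - 9)))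
        in \<i> / complex_of_real pi * (complex_of_real (sqrt 3) * sin \<theta> + cos \<theta>)
      else 0)"

definition real_nonneg :: "(real \<Rightarrow> complex) \<Rightarrow> bool" where
  "real_nonneg g \<longleftrightarrow> (\<forall>x. g x \<in> \<real> \<and> 0 \<le> Re (g x))"

text \<open>\<open>Re\<close> only changes the type here: the formula for the density is real-valued, and this is
  to be asserted through \<open>real_nonneg\<close>.\<close>

definition Z_limit :: "real measure" where
  "Z_limit = density lborel (\<lambda>x. ennreal (Re (g_Z x)))"

end

theory Submission
  imports Defs
    "Jordan_Normal_Form.Schur_Decomposition"
    "HOL-Real_Asymp.Real_Asymp"
    "HOL-Computational_Algebra.Formal_Power_Series"
begin

text \<open>
The proof is the method of moments, carried out for two walkers on the vertex set.

Write \<open>W\<close> for the sign matrix of the graph, \<open>W(s,t) =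
    \<plusminus>1\<close>. Apart from the requirement that its four indices
be distinct, the matrix \<open>M\<close> maps a pair to a pair by moving the first vertex along an edge,
multiplying by the sign of the edge between the two current vertices, and moving the second
vertex along an edge. The trace of \<open>(M\<^sup>T M)^k\<close> is therefore a sum, over closed walks of a pair
\<open>(i,j)\<close> of walkers, of products of edge signs. Which walker moves when,
    and when the edge between the
walkers is recorded, is prescribed by a word in the letters \<open>First\<close>, \<open>Second\<close> and \<open>Cross\<close>. The
expectation of such a product is 1 if every edge is used an even number of times,
    and 0 otherwise, so the
expected trace counts even closed walks.

Counting births and deaths of vertices along an even walk with \<open>s\<close> moves shows that it has at most
\<open>2 + s/2\<close> vertices: a move cannot at the same time reach a vertex that was never seen and leave a
vertex that is never seen again, since its edge would be used exactly once
(\<open>even_walk_card_le\<close>). The same count for two walks with a common odd edge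
(\<open>two_walks_card_le\<close>) bounds the variance of the normalized trace by a multiple of
\<open>n\<^sup>-\<^sup>2\<close>. This is summable, so the moments converge almost surely as soon as their expectations
do, however the graphs of different sizes are coupled.

Up to relative order \<open>1/n\<close> only the tight walks matter, those with exactly \<open>2 + s/2\<close> vertices. In a
tight walk the two walkers never visit a common vertex (\<open>tight_apart\<close>), and cutting the walk at the
first return of a walker to its start leaves two independent even walks
(\<open>tight_decomposition\<close>). For the words that occur here this gives a recursion for the limits
\<open>T\<^sub>k\<close> of the normalized counts (\<open>walk_limits\<close>):
\<open>T\<^sub>0 = 1\<close> and \<open>T\<^sub>k\<^sub>+\<^sub>1\<close> is the sum of \<open>T\<^sub>a T\<^sub>b T\<^sub>c\<close> over \<open>a + b + c =
    k\<close>. These are the Fuss-Catalan numbers;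
their generating function solves \<open>B = 1 + z B\<^sup>3\<close>, and the linear differential equation of this
algebraic function is the two-term recursion \<open>fuss_catalan_ratio\<close>.

On the analytic side the complex formula for the density equals \<open>2/\<pi> sinh(L/6)\<close> with a real
logarithm \<open>L\<close> (\<open>g_Z_eq\<close>). It satisfies a second-order differential equation which, integrated
against \<open>x^(2k)\<close>, yields the same two-term recursion for its even moments
(\<open>Z_density_moments\<close>). Since the limit law lives on a bounded interval of nonnegative numbers,
convergence of all even moments implies weak convergence (\<open>moments_imp_weak_conv\<close>).
\<close>

section \<open>Walks of a pair of walkers\<close>

text \<open>The letters describe one step of a pair of walkers: the first or the second walker moves
    along an
edge, or both stay and the edge between them is recorded.\<close>

datatype letter = First | Second | Cross

type_synonym 'a state = "'a \<times> 'a"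

fun walk_step :: "letter \<Rightarrow> 'a state \<Rightarrow> 'a state \<Rightarrow> bool" where
  "walk_step First s s' \<longleftrightarrow> fst s' \<noteq> fst s \<and> snd s' = snd s"
| "walk_step Second s s' \<longleftrightarrow> fst s' = fst s \<and> snd s' \<noteq> snd s"
| "walk_step Cross s s' \<longleftrightarrow> s' = s"

fun walk_edge :: "letter \<Rightarrow> 'a state \<Rightarrow> 'a state \<Rightarrow> 'a set" where
  "walk_edge First s s' = {fst s, fst s'}"
| "walk_edge Second s s' = {snd s, snd s'}"
| "walk_edge Cross s s' = {fst s, snd s}"

definition ends :: "'a state \<Rightarrow> 'a set" where
  "ends s = {fst s, snd s}"

definition walk :: "letter list \<Rightarrow> 'a state list \<Rightarrow> bool" where
  "walk w ss \<longleftrightarrow> length ss = Suc (length w) \<and>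
     (\<forall>t<length w. walk_step (w ! t) (ss ! t) (ss ! Suc t)) \<and> (\<forall>s\<in>set ss. fst s \<noteq> snd s)"

definition closed_walk :: "letter list \<Rightarrow> 'a state list \<Rightarrow> bool" where
  "closed_walk w ss \<longleftrightarrow> walk w ss \<and> ss ! length w = ss ! 0"

definition edge_at :: "letter list \<Rightarrow> 'a state list \<Rightarrow> nat \<Rightarrow> 'a set" where
  "edge_at w ss t = walk_edge (w ! t) (ss ! t) (ss ! Suc t)"

text \<open>Only parities of these multiplicities will matter: an edge sign has square 1.\<close>

definition edge_mult :: "letter list \<Rightarrow> 'a state list \<Rightarrow> 'a set \<Rightarrow> nat" where
  "edge_mult w ss e = card {t. t < length w \<and> edge_at w ss t = e}"

definition even_walk :: "letter list \<Rightarrow> 'a state list \<Rightarrow> bool" where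
  "even_walk w ss \<longleftrightarrow> closed_walk w ss \<and> (\<forall>e. even (edge_mult w ss e))"

definition verts :: "'a state list \<Rightarrow> 'a set" where
  "verts ss = (\<Union>s\<in>set ss. ends s)"

definition moves :: "letter list \<Rightarrow> nat" where
  "moves w = length (filter (\<lambda>l. l \<noteq> Cross) w)"

section \<open>The number of vertices of an even walk\<close>

text \<open>The number of vertices of a sequence of states equals the size of the first state plus the
    births,
and also the size of the last state plus the deaths. Adding the two expressions bounds twice the
number of vertices by what happens at the single steps.\<close>

definition born :: "(nat \<Rightarrow> 'a set) \<Rightarrow> nat \<Rightarrow> nat" where
  "born S t = card (S (Suc t) - (\<Union>r\<le>t. S r))"

definition died :: "(nat \<Rightarrow> 'a set) \<Rightarrow> nat \<Rightarrow> nat \<Rightarrow> nat" where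
  "died S L t = card (S t - (\<Union>r\<in>{Suc t..L}. S r))"

lemma card_union_born:
  assumes "\<And>t. finite (S t)"
  shows "card (\<Union>t\<le>L. S t) = card (S 0) + (\<Sum>t<L. born S t)"
proof (induction L)
  case (Suc L)
  have "(\<Union>t\<le>Suc L. S t) = (\<Union>t\<le>L. S t) \<union> (S (Suc L) - (\<Union>t\<le>L. S t))"
    by (auto simp: atMost_Suc)
  hence "card (\<Union>t\<le>Suc L. S t) = card (\<Union>t\<le>L. S t) + card (S (Suc L) - (\<Union>t\<le>L. S t))"
    using assms by (metis Diff_disjoint card_Un_disjoint finite_Diff finite_UN finite_atMost)
  thus ?case using Suc by (simp add: born_def)
qed simp

lemma card_union_died:
  assumes "\<And>t. finite (S t)" and "k \<le> L"
  shows "card (\<Union>t\<in>{k..L}. S t) = card (S L) + (\<Sum>t\<in>{k..<L}. died S L t)"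
  using assms(2)
proof (induction k rule: inc_induct)
  case (step k)
  have "{k..L} = insert k {Suc k..L}" using step by auto
  hence "(\<Union>t\<in>{k..L}. S t) = (\<Union>t\<in>{Suc k..L}. S t) \<union> (S k - (\<Union>t\<in>{Suc k..L}. S t))"
    by auto
  hence "card (\<Union>t\<in>{k..L}. S t) = card (\<Union>t\<in>{Suc k..L}. S t) + died S L k"
    unfolding died_def
    using assms by (metis Diff_disjoint card_Un_disjoint finite_Diff finite_UN finite_atLeastAtMost)
  moreover have "{k..<L} = insert k {Suc k..<L}" using step by auto
  ultimately show ?case using step by simp
qed simp

text \<open>The sum of the two ways of counting, by first and by last appearances.\<close>

lemma births_deaths:
  assumes "\<And>t. finite (S t)"
  shows "2 * card (\<Union>t\<le>L. S t) = card (S 0) + card (S L) + (\<Sum>t<L. born S t + died S L t)"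
proof -
  have "{0..L} = {..L}" "{0..<L} = {..<L}" by auto
  hence "card (\<Union>t\<le>L. S t) = card (S L) + (\<Sum>t<L. died S L t)"
    using card_union_died[where S = S and k = 0 and L = L] assms by simp
  thus ?thesis using card_union_born[where S = S and L = L] assms by (simp add: sum.distrib)
qed

lemma walk_edge_subset:
  assumes "walk_step l s s'"
  shows "walk_edge l s s' \<subseteq> ends s \<union> ends s'"
  using assms by (cases l) (auto simp: ends_def)

lemma finite_ends [simp]: "finite (ends s)"
  by (simp add: ends_def)

lemma card_ends_le: "card (ends s) \<le> 2"
  by (simp add: ends_def card_insert_if)

text \<open>A step that both reaches a new vertex \<open>y\<close> and leaves a vertex \<open>x\<close> for ever would use the edge
\<open>{x, y}\<close> exactly once, because no earlier state contains \<open>y\<close> and no later one contains \<open>x\<close>. The set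
\<open>R\<close> of real steps allows sequences with a jump, which arise from the concatenation of two walks.\<close>

lemma born_died_le:
  fixes st :: "nat \<Rightarrow> 'a state"
  defines "S \<equiv> \<lambda>t. ends (st t)"
  assumes R: "R \<subseteq> {..<L}" "t \<in> R"
    and step: "\<And>r. r \<in> R \<Longrightarrow> walk_step (lt r) (st r) (st (Suc r))"
    and ev: "even (card {r \<in> R. walk_edge (lt r) (st r) (st (Suc r)) =
        walk_edge (lt t) (st t) (st (Suc t))})"
  shows "born S t + died S L t \<le> (if lt t = Cross then 0 else 1)"
proof (cases "lt t = Cross")
  case True
  hence "st (Suc t) = st t" using step[OF R(2)] by simp
  hence e: "S (Suc t) = S t" by (simp add: S_def)
  have "Suc t \<le> L" using R by auto
  hence "S (Suc t) - (\<Union>r\<le>t. S r) = {}" "S t - (\<Union>r\<in>{Suc t..L}. S r) = {}" using e by auto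
  hence "born S t = 0" "died S L t = 0" unfolding born_def died_def by (metis card.empty)+
  thus ?thesis by simp
next
  case False
  define E where "E r = walk_edge (lt r) (st r) (st (Suc r))" for r
  obtain x y j where xy: "S t = {x, j}" "S (Suc t) = {y, j}" "E t = {x, y}"
  proof (cases "lt t")
    case First
    thus ?thesis using step[OF R(2)] that[of "fst (st t)" "snd (st t)" "fst (st (Suc t))"]
      by (auto simp: S_def E_def ends_def)
  next
    case Second
    thus ?thesis using step[OF R(2)] that[of "snd (st t)" "fst (st t)" "snd (st (Suc t))"]
      by (auto simp: S_def E_def ends_def)
  qed (use False in simp)
  have tL: "Suc t \<le> L" using R by auto
  have b: "S (Suc t) - (\<Union>r\<le>t. S r) \<subseteq> {y}" using xy by auto
  have d: "S t - (\<Union>r\<in>{Suc t..L}. S r) \<subseteq> {x}" using xy tL by auto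
  have sub: "E r \<subseteq> S r \<union> S (Suc r)" if "r \<in> R" for r
    using walk_edge_subset[OF step[OF that]] by (auto simp: E_def S_def)
  have one: "S (Suc t) - (\<Union>r\<le>t. S r) = {} \<or> S t - (\<Union>r\<in>{Suc t..L}. S r) = {}"
  proof (rule ccontr)
    assume "\<not> ?thesis"
    hence y: "y \<notin> (\<Union>r\<le>t. S r)" and x: "x \<notin> (\<Union>r\<in>{Suc t..L}. S r)" using b d by auto
    have "{r \<in> R. E r = E t} = {t}"
    proof (rule ccontr)
      assume "{r \<in> R. E r = E t} \<noteq> {t}"
      then obtain r where r: "r \<in> R" "E r = E t" "r \<noteq> t" using R(2) by blast
      have m: "x \<in> S r \<union> S (Suc r)" "y \<in> S r \<union> S (Suc r)" using sub[OF r(1)] r(2) xy(3) by auto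
      show False
      proof (cases "r < t")
        case True
        thus ?thesis using m(2) y by (auto simp: Suc_le_eq)
      next
        case False
        hence "r \<in> {Suc t..L}" "Suc r \<in> {Suc t..L}" using r R by auto
        thus ?thesis using m(1) x by blast
      qed
    qed
    thus False using ev by (simp add: E_def[symmetric])
  qed
  have "born S t = 0 \<or> died S L t = 0" using one unfolding born_def died_def by (metis card.empty)
  moreover have "born S t \<le> 1" "died S L t \<le> 1"
    using card_mono[OF _ b] card_mono[OF _ d] by (auto simp: born_def died_def)
  ultimately show ?thesis using False by auto
qed

lemma moves_eq_sum: "moves w = (\<Sum>t<length w. if w ! t = Cross then 0 else 1)"
proof -
  have "moves w = card {t. t < length w \<and> w ! t \<noteq> Cross}"
    by (simp add: moves_def length_filter_conv_card)
  also have "\<dots> = (\<Sum>t\<in>{..<length w} \<inter> {t. w ! t \<noteq> Cross}. 1)"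
    by (simp add: Int_def lessThan_def)
  also have "\<dots> = (\<Sum>t<length w. if w ! t \<noteq> Cross then 1 else 0)"
    by (subst sum.inter_restrict) auto
  also have "\<dots> = (\<Sum>t<length w. if w ! t = Cross then 0 else 1)"
    by (rule sum.cong) auto
  finally show ?thesis .
qed

lemma verts_walk:
  assumes "walk w ss"
  shows "verts ss = (\<Union>t\<le>length w. ends (ss ! t))"
proof -
  have "set ss = (!) ss ` {..length w}"
    using assms by (auto simp: walk_def set_conv_nth less_Suc_eq_le)
  thus ?thesis by (simp add: verts_def)
qed

definition seen :: "'a state list \<Rightarrow> nat \<Rightarrow> 'a set" where "seen ss t = ends (ss ! t)"

lemma even_walk_born_died:
  assumes "even_walk w ss" "t < length w"
  shows "born (seen ss) t + died (seen ss) (length w) t \<le> (if w ! t = Cross then 0 else 1)"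
proof -
  have "even (edge_mult w ss (edge_at w ss t))" using assms by (simp add: even_walk_def)
  hence "even (card {r \<in> {..<length w}. walk_edge (w ! r) (ss ! r) (ss ! Suc r) =
      walk_edge (w ! t) (ss ! t) (ss ! Suc t)})"
    by (simp add: edge_mult_def edge_at_def)
  moreover have "walk_step (w ! r) (ss ! r) (ss ! Suc r)" if "r \<in> {..<length w}" for r
    using assms that by (auto simp: even_walk_def closed_walk_def walk_def)
  ultimately show ?thesis
    using born_died_le[of "{..<length w}" "length w" t "(!) w" "(!) ss"] assms(2)
    unfolding seen_def[abs_def] by blast
qed

lemma even_walk_twice_card:
  assumes "even_walk w ss"
  shows "2 * card (verts ss) =
    4 + (\<Sum>t<length w. born (seen ss) t + died (seen ss) (length w) t)"
proof -
  have w: "walk w ss" "ss ! length w = ss ! 0" using assms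
      by (auto simp: even_walk_def closed_walk_def)
  hence "fst (ss ! 0) \<noteq> snd (ss ! 0)" by (auto simp: walk_def)
  hence "card (seen ss 0) = 2" "card (seen ss (length w)) = 2" using w(2)
      by (auto simp: seen_def ends_def)
  moreover have "finite (seen ss t)" for t by (simp add: seen_def)
  ultimately show ?thesis using births_deaths[of "seen ss" "length w"] verts_walk[OF w(1)]
    by (simp add: seen_def[abs_def])
qed

text \<open>Each move contributes at most one birth or death, and the first
    and the last state have two vertices
each.\<close>

theorem even_walk_card_le:
  assumes "even_walk w ss"
  shows "2 * card (verts ss) \<le> 4 + moves w"
proof -
  have "(\<Sum>t<length w. born (seen ss) t + died (seen ss) (length w) t) \<le> moves w"
    unfolding moves_eq_sum using even_walk_born_died[OF assms] by (intro sum_mono) simp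
  thus ?thesis using even_walk_twice_card[OF assms] by simp
qed

text \<open>A closed walk may be started at any time; indices are then taken modulo its length.\<close>

lemma closed_walk_step_mod:
  assumes "closed_walk w ss" "t < length w"
  shows "walk_step (w ! t) (ss ! t) (ss ! (Suc t mod length w))"
    and "edge_at w ss t = walk_edge (w ! t) (ss ! t) (ss ! (Suc t mod length w))"
proof -
  have "ss ! (Suc t mod length w) = ss ! Suc t"
    using assms by (cases "Suc t = length w") (auto simp: closed_walk_def)
  thus "walk_step (w ! t) (ss ! t) (ss ! (Suc t mod length w))"
    "edge_at w ss t = walk_edge (w ! t) (ss ! t) (ss ! (Suc t mod length w))"
    using assms by (auto simp: closed_walk_def walk_def edge_at_def)
qed

lemma bij_betw_shift_mod:
  fixes m a :: nat
  assumes "0 < m"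
  shows "bij_betw (\<lambda>t. (a + t) mod m) {..<m} {..<m}"
proof -
  have "inj_on (\<lambda>t. (a + t) mod m) {..<m}"
  proof (rule inj_onI)
    fix x y assume "x \<in> {..<m}" "y \<in> {..<m}" "(a + x) mod m = (a + y) mod m"
    thus "x = y"
    proof (induction x y rule: linorder_wlog)
      case (le x y)
      hence "m dvd (a + y) - (a + x)" by (metis add_le_cancel_left mod_eq_dvd_iff_nat)
      hence "m dvd y - x" by simp
      moreover have "y - x < m" using le by auto
      ultimately have "y - x = 0" using nat_dvd_not_less by blast
      thus ?case using le by simp
    qed simp
  qed
  moreover have "(\<lambda>t. (a + t) mod m) ` {..<m} \<subseteq> {..<m}" using assms by auto
  ultimately show ?thesis
    by (simp add: bij_betw_def endo_inj_surj)
qed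

lemma edge_mult_shift:
  assumes "0 < length w"
  shows "edge_mult w ss e = card {t. t < length w \<and> edge_at w ss ((a + t) mod length w) = e}"
proof -
  let ?f = "\<lambda>t. (a + t) mod length w"
  have "{t. t < length w \<and> edge_at w ss t = e} = ?f ` {t. t < length w \<and> edge_at w ss (?f t) = e}"
  proof (intro equalityI subsetI)
    fix x assume x: "x \<in> {t. t < length w \<and> edge_at w ss t = e}"
    hence "x \<in> ?f ` {..<length w}" using bij_betw_shift_mod[OF assms, of a]
        by (simp add: bij_betw_def)
    thus "x \<in> ?f ` {t. t < length w \<and> edge_at w ss (?f t) = e}" using x by auto
  qed (use assms in auto)
  moreover have "inj_on ?f {t. t < length w \<and> edge_at w ss (?f t) = e}"
    using bij_betw_shift_mod[OF assms, of a] by (auto simp: bij_betw_def inj_on_def)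
  ultimately show ?thesis by (simp only: edge_mult_def card_image)
qed

lemma moves_shift:
  assumes "0 < length w"
  shows "moves w = (\<Sum>t<length w. if w ! ((a + t) mod length w) = Cross then 0 else 1)"
  unfolding moves_eq_sum by (rule sum.reindex_bij_betw[OF bij_betw_shift_mod[OF assms], symmetric])

lemma verts_shift:
  assumes "closed_walk w ss" "0 < length w"
  shows "verts ss = (\<Union>t<length w. ends (ss ! ((a + t) mod length w)))"
proof -
  have "verts ss = (\<Union>t\<le>length w. ends (ss ! t))" using assms verts_walk
      by (auto simp: closed_walk_def)
  also have "\<dots> = (\<Union>t<length w. ends (ss ! t))"
  proof -
    have "{..length w} = insert (length w) {..<length w}" by auto
    moreover have "ends (ss ! length w) = ends (ss ! 0)" using assms by (simp add: closed_walk_def)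
    ultimately show ?thesis using assms(2) by auto
  qed
  also have "\<dots> = (\<Union>t\<in>(\<lambda>t. (a + t) mod length w) ` {..<length w}. ends (ss ! t))"
    using bij_betw_shift_mod[OF assms(2), of a] by (simp add: bij_betw_def)
  finally show ?thesis by simp
qed

lemma edge_at_subset_verts:
  assumes "closed_walk w ss" "t < length w"
  shows "edge_at w ss t \<subseteq> verts ss"
proof -
  have "edge_at w ss t \<subseteq> ends (ss ! t) \<union> ends (ss ! Suc t)"
    unfolding edge_at_def using assms by (intro walk_edge_subset) (auto simp: closed_walk_def
        walk_def)
  also have "\<dots> \<subseteq> verts ss"
    using assms verts_walk[of w ss] by (force simp: closed_walk_def Suc_le_eq)
  finally show ?thesis .
qed

lemma move_cases:
  assumes "walk_step l s s'" "l \<noteq> Cross"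
  obtains x y j where "ends s = {x, j}" "ends s' = {y, j}" "walk_edge l s s' = {x, y}"
proof (cases l)
  case First
  thus ?thesis using assms that[of "fst s" "snd s" "fst s'"] by (auto simp: ends_def)
next
  case Second
  thus ?thesis using assms that[of "snd s" "fst s" "snd s'"] by (auto simp: ends_def)
qed (use assms in simp)

lemma born_eq_0: "S (Suc t) \<subseteq> (\<Union>r\<le>t. S r) \<Longrightarrow> born S t = 0"
  unfolding born_def by (subst Diff_eq_empty_iff[THEN iffD2]) simp_all

lemma died_eq_0: "S t \<subseteq> (\<Union>r\<in>{Suc t..L}. S r) \<Longrightarrow> died S L t = 0"
  unfolding died_def by (subst Diff_eq_empty_iff[THEN iffD2]) simp_all

lemma card_diff_le_1:
  assumes "A \<subseteq> insert x B"
  shows "card (A - B) \<le> 1"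
proof -
  have "A - B \<subseteq> {x}" using assms by blast
  hence "card (A - B) \<le> card {x}" by (intro card_mono) simp_all
  thus ?thesis by simp
qed

text \<open>This bound controls the variance. For two even walks \<open>even_walk_card_le\<close> gives \<open>8\<close> instead
    of \<open>4\<close>. The gain comes
from the choice of the starting times: the first walk is made to end with a common odd edge \<open>e\<close>
    and the second one to start with it. At
the jump between the walks, births and deaths are then compensated
    by the two adjacent steps, which neither
create nor destroy an end of \<open>e\<close>.\<close>

theorem two_walks_card_le:
  fixes ss ss' :: "'a state list"
  assumes w: "closed_walk w ss" and w': "closed_walk w' ss'"
    and even: "\<And>e. even (edge_mult w ss e + edge_mult w' ss' e)"
    and odd: "odd (edge_mult w ss e)"
  shows "2 * card (verts ss \<union> verts ss') \<le> 4 + moves w + moves w'"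
proof -
  define m where "m = length w"
  define m' where "m' = length w'"
  have odd': "odd (edge_mult w' ss' e)" using even[of e] odd by simp
  have "{t. t < m \<and> edge_at w ss t = e} \<noteq> {}" "{t. t < m' \<and> edge_at w' ss' t = e} \<noteq> {}"
    using odd odd' unfolding edge_mult_def m_def m'_def by (metis card.empty even_zero)+
  then obtain t0 t1 where t0: "t0 < m" "edge_at w ss t0 = e"
      and t1: "t1 < m'" "edge_at w' ss' t1 = e"
    by blast
  have pos: "0 < m" "0 < m'" using t0 t1 by auto
  (* The first walk starts right after a use of e at time t0, so that this use becomes its last
      step;
     the second walk starts at a use of e. Index m is the jump from one walk to the other. *)
  define p where "p t = (Suc t0 + t) mod m" for t
  define p' where "p' t = (t1 + t) mod m'" for t
  define st where "st t = (if t \<le> m then ss ! p t else ss' ! p' (t - Suc m))" for t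
  define lt where "lt t = (if t < m then w ! p t else w' ! p' (t - Suc m))" for t
  define L where "L = m + 1 + m'"
  define R where "R = {..<L} - {m}"
  define S where "S t = ends (st t)" for t
  define E where "E r = walk_edge (lt r) (st r) (st (Suc r))" for r
  have p_Suc: "p (Suc t) = Suc (p t) mod m" and p'_Suc: "p' (Suc t) = Suc (p' t) mod m'" for t
    by (simp_all add: p_def p'_def mod_Suc_eq)
  have p_lt: "p t < m" and p'_lt: "p' t < m'" for t using pos by (simp_all add: p_def p'_def)
  have E1: "E t = edge_at w ss (p t)" and step1: "walk_step (lt t) (st t) (st (Suc t))" if "t < m"
      for t
    using closed_walk_step_mod[OF w, of "p t"] p_lt[of t] that
    by (auto simp: E_def lt_def st_def p_Suc m_def)
  have E2: "E t = edge_at w' ss' (p' (t - Suc m))" and step2: "walk_step (lt t) (st t) (st (Suc t))"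
    if "m < t" for t
    using closed_walk_step_mod[OF w', of "p' (t - Suc m)"] p'_lt[of "t - Suc m"] that
      Suc_diff_Suc[of m t] p'_Suc[of "t - Suc m"]
    by (auto simp: E_def lt_def st_def m'_def Suc_diff_le)
  have V1: "verts ss = (\<Union>t<m. S t)"
    using verts_shift[OF w, of "Suc t0"] pos by (simp add: S_def st_def p_def m_def)
  have V2: "verts ss' = (\<Union>t<m'. S (Suc m + t))"
    using verts_shift[OF w', of t1] pos by (simp add: S_def st_def p'_def m'_def)
  have "p m = p 0" using mod_add_self2[of "Suc t0" m] by (simp only: p_def add_0_right)
  hence Sm: "S m = S 0" by (simp add: S_def st_def)
  have "p' m' = p' 0" by (simp add: p'_def)
  hence SL: "S L = S (Suc m)" using pos by (simp add: S_def st_def L_def)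
  have V: "verts ss \<union> verts ss' = (\<Union>t\<le>L. S t)"
  proof (intro equalityI subsetI)
    fix v assume "v \<in> verts ss \<union> verts ss'"
    then obtain t where t: "v \<in> S t" "t < m \<or> (\<exists>r<m'. t = Suc m + r)" unfolding V1 V2 by blast
    hence "t \<le> L" by (auto simp: L_def)
    with t(1) show "v \<in> (\<Union>t\<le>L. S t)" by blast
  next
    fix v assume "v \<in> (\<Union>t\<le>L. S t)"
    then obtain t where t: "v \<in> S t" "t \<le> L" by blast
    consider "t < m" | "t = m" | "m < t" "t < L" | "t = L" using t(2) by linarith
    thus "v \<in> verts ss \<union> verts ss'"
    proof cases
      case 3
      define r where "r = t - Suc m"
      have r: "t = Suc m + r" "r < m'" using 3 by (auto simp: L_def r_def)
      show ?thesis using t(1) r(2) unfolding V2 r(1) by blast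
    next
      case 4
      hence "v \<in> S (Suc m + 0)" using t(1) SL by simp
      thus ?thesis using pos unfolding V2 by blast
    next
      case 1
      thus ?thesis using t(1) unfolding V1 by blast
    next
      case 2
      hence "v \<in> S 0" using t(1) Sm by simp
      thus ?thesis using pos unfolding V1 by blast
    qed
  qed
  have mE: "card {r \<in> R. E r = f} = edge_mult w ss f + edge_mult w' ss' f" for f
  proof -
    have "{r \<in> R. E r = f} = {t. t < m \<and> edge_at w ss (p t) = f} \<union>
        (\<lambda>t. Suc m + t) ` {t. t < m' \<and> edge_at w' ss' (p' t) = f}"
    proof (intro equalityI subsetI)
      fix r assume "r \<in> {r \<in> R. E r = f}"
      hence r: "r < L" "r \<noteq> m" "E r = f" by (auto simp: R_def)
      show "r \<in> {t. t < m \<and> edge_at w ss (p t) = f} \<union>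
        (\<lambda>t. Suc m + t) ` {t. t < m' \<and> edge_at w' ss' (p' t) = f}"
      proof (cases "r < m")
        case False
        define q where "q = r - Suc m"
        have q: "r = Suc m + q" "q < m'" using r False by (auto simp: L_def q_def)
        show ?thesis using r(3) q(2) E2[of r] unfolding q(1) by auto
      qed (use r E1 in auto)
    next
      fix r assume "r \<in> {t. t < m \<and> edge_at w ss (p t) = f} \<union>
        (\<lambda>t. Suc m + t) ` {t. t < m' \<and> edge_at w' ss' (p' t) = f}"
      thus "r \<in> {r \<in> R. E r = f}"
      proof
        assume "r \<in> (\<lambda>t. Suc m + t) ` {t. t < m' \<and> edge_at w' ss' (p' t) = f}"
        then obtain t where t: "r = Suc m + t" "t < m'" "edge_at w' ss' (p' t) = f" by blast
        thus ?thesis using E2[of r] by (simp add: R_def L_def)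
      qed (use E1 in \<open>auto simp: R_def L_def\<close>)
    qed
    moreover have "card ((\<lambda>t. Suc m + t) ` {t. t < m' \<and> edge_at w' ss' (p' t) = f}) =
        card {t. t < m' \<and> edge_at w' ss' (p' t) = f}"
      by (rule card_image) (auto simp: inj_on_def)
    moreover have "card {t. t < m \<and> edge_at w ss (p t) = f} = edge_mult w ss f"
      using edge_mult_shift[of w ss f "Suc t0"] pos by (simp add: p_def m_def)
    moreover have "card {t. t < m' \<and> edge_at w' ss' (p' t) = f} = edge_mult w' ss' f"
      using edge_mult_shift[of w' ss' f t1] pos by (simp add: p'_def m'_def)
    moreover have "{t. t < m \<and> edge_at w ss (p t) = f} \<inter>
        (\<lambda>t. Suc m + t) ` {t. t < m' \<and> edge_at w' ss' (p' t) = f} = {}" by auto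
    ultimately show ?thesis by (simp add: card_Un_disjoint)
  qed
  have bd: "born S t + died S L t \<le> (if lt t = Cross then 0 else 1)" if "t \<in> R" for t
    unfolding S_def
  proof (rule born_died_le[OF _ that])
    show "R \<subseteq> {..<L}" by (simp add: R_def)
    show "walk_step (lt r) (st r) (st (Suc r))" if "r \<in> R" for r
      using that step1 step2 by (cases "r < m") (auto simp: R_def)
    show "even (card {r \<in> R. walk_edge (lt r) (st r) (st (Suc r)) =
        walk_edge (lt t) (st t) (st (Suc t))})"
      using mE even by (simp add: E_def)
  qed
  define k where "k t = (if lt t = Cross then 0 else 1 :: nat)" for t
  define c where "c t = born S t + died S L t" for t
  obtain m0 m1 where m0: "m = Suc m0" and m1: "m' = Suc m1" using pos by (metis gr0_implies_Suc)
  have late: "verts ss' \<subseteq> (\<Union>r\<in>{Suc m..L}. S r)" unfolding V2 by (fastforce simp: L_def)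
  have early: "verts ss \<subseteq> (\<Union>r\<le>m. S r)" unfolding V1 by fastforce
  have eV: "e \<subseteq> verts ss" "e \<subseteq> verts ss'"
    using edge_at_subset_verts[OF w, of t0] edge_at_subset_verts[OF w', of t1] t0 t1
    by (auto simp: m_def m'_def)
  (* Of the two vertices left at the jump only the one that is not an end of e can die. *)
  have A: "c m0 + died S L m \<le> k m0"
  proof -
    have "m0 \<in> R" using m0 by (simp add: R_def L_def)
    have "p m0 = (t0 + m) mod m" using m0 by (simp add: p_def)
    hence "p m0 = t0" using t0(1) by simp
    hence Ee: "E m0 = e" using E1[of m0] m0 t0(2) by simp
    have sm: "Suc m0 = m" using m0 by simp
    have stp: "walk_step (lt m0) (st m0) (st m)" using step1[of m0] m0 by simp
    have inL: "m \<in> {Suc m0..L}" "{Suc m..L} \<subseteq> {Suc m0..L}" using m0 by (auto simp: L_def)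
    show ?thesis
    proof (cases "lt m0 = Cross")
      case True
      hence "S m = e" using stp Ee by (simp add: S_def E_def sm ends_def)
      hence "died S L m = 0" using eV(2) late by (intro died_eq_0) blast
      thus ?thesis using bd[OF \<open>m0 \<in> R\<close>] by (simp add: c_def k_def)
    next
      case False
      obtain x y j where "ends (st m0) = {x, j}" "ends (st m) = {y, j}"
        "walk_edge (lt m0) (st m0) (st m) = {x, y}" by (rule move_cases[OF stp False])
      hence xy: "S m0 = {x, j}" "S m = {y, j}" "e = {x, y}"
        using Ee by (simp_all add: S_def E_def sm)
      have "died S L m \<le> 1"
        unfolding died_def by (rule card_diff_le_1[of _ j]) (use xy(2,3) eV(2) late in blast)
      moreover have "S (Suc m0) \<subseteq> (\<Union>r\<le>m0. S r)" unfolding sm Sm by blast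
      hence "born S m0 = 0" by (rule born_eq_0)
      moreover have "died S L m0 = 0"
      proof (rule died_eq_0)
        have "j \<in> (\<Union>r\<in>{Suc m0..L}. S r)" using xy(2) inL by blast
        moreover have "x \<in> (\<Union>r\<in>{Suc m0..L}. S r)" using xy(3) eV(2) late inL by blast
        ultimately show "S m0 \<subseteq> (\<Union>r\<in>{Suc m0..L}. S r)" unfolding xy(1) by blast
      qed
      ultimately show ?thesis using False by (simp add: c_def k_def)
    qed
  qed
  (* Likewise only the vertex that is not an end of e can be new after the jump. *)
  have B: "born S m + c (Suc m) \<le> k (Suc m)"
  proof -
    have "Suc m \<in> R" using m1 by (simp add: R_def L_def)
    have "p' 0 = t1" using t1(1) by (simp add: p'_def)
    hence Ee: "E (Suc m) = e" using E2[of "Suc m"] t1(2) by simp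
    have stp: "walk_step (lt (Suc m)) (st (Suc m)) (st (Suc (Suc m)))" using step2[of "Suc m"]
        by simp
    have sub: "(\<Union>r\<le>m. S r) \<subseteq> (\<Union>r\<le>Suc m. S r)" by (intro UN_mono) auto
    show ?thesis
    proof (cases "lt (Suc m) = Cross")
      case True
      hence "S (Suc m) = e" using stp Ee by (simp add: S_def E_def ends_def)
      hence "born S m = 0" using eV(1) early by (intro born_eq_0) blast
      thus ?thesis using True bd[OF \<open>Suc m \<in> R\<close>] by (simp add: c_def k_def)
    next
      case False
      obtain x y j where "ends (st (Suc m)) = {x, j}" "ends (st (Suc (Suc m))) = {y, j}"
        "walk_edge (lt (Suc m)) (st (Suc m)) (st (Suc (Suc m))) = {x, y}"
            by (rule move_cases[OF stp False])
      hence xy: "S (Suc m) = {x, j}" "S (Suc (Suc m)) = {y, j}" "e = {x, y}"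
        using Ee by (simp_all add: S_def E_def)
      have "born S m \<le> 1"
        unfolding born_def by (rule card_diff_le_1[of _ j]) (use xy(1,3) eV(1) early in blast)
      moreover have "born S (Suc m) = 0"
      proof (rule born_eq_0)
        have "j \<in> (\<Union>r\<le>Suc m. S r)" using xy(1) by blast
        moreover have "y \<in> (\<Union>r\<le>Suc m. S r)" using xy(3) eV(1) early sub by blast
        ultimately show "S (Suc (Suc m)) \<subseteq> (\<Union>r\<le>Suc m. S r)" unfolding xy(2) by blast
      qed
      moreover have "died S L (Suc m) = 0"
      proof (rule died_eq_0)
        have "L \<in> {Suc (Suc m)..L}" using m1 by (simp add: L_def)
        thus "S (Suc m) \<subseteq> (\<Union>r\<in>{Suc (Suc m)..L}. S r)" using SL by blast
      qed
      ultimately show ?thesis using False by (simp add: c_def k_def)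
    qed
  qed
  have split: "(\<Sum>t<L. f t) = (\<Sum>t<m. f t) + f m + (\<Sum>t<m'. f (Suc m + t))" for f :: "nat \<Rightarrow> nat"
    unfolding L_def by (induction m') simp_all
  have "(\<Sum>t<m. c t) + died S L m \<le> (\<Sum>t<m. k t)"
  proof -
    have "(\<Sum>t<m0. c t) \<le> (\<Sum>t<m0. k t)"
      using bd m0 by (intro sum_mono) (auto simp: c_def k_def R_def L_def)
    thus ?thesis using A m0 by simp
  qed
  moreover have "born S m + (\<Sum>t<m'. c (Suc m + t)) \<le> (\<Sum>t<m'. k (Suc m + t))"
  proof -
    have "(\<Sum>t<m1. c (Suc m + Suc t)) \<le> (\<Sum>t<m1. k (Suc m + Suc t))"
      using m1 by (intro sum_mono, unfold c_def k_def, intro bd) (auto simp: R_def L_def)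
    thus ?thesis using B unfolding m1 sum.lessThan_Suc_shift by simp
  qed
  moreover have "(\<Sum>t<m. k t) = moves w"
    using moves_shift[of w "Suc t0"] pos by (simp add: k_def lt_def p_def m_def)
  moreover have "(\<Sum>t<m'. k (Suc m + t)) = moves w'"
    using moves_shift[of w' t1] pos by (simp add: k_def lt_def p'_def m'_def)
  ultimately have "(\<Sum>t<L. c t) \<le> moves w + moves w'"
    unfolding split by (simp add: c_def)
  moreover have "card (S t) \<le> 2" for t by (simp add: S_def card_ends_le)
  from this[of 0] this[of L] have "card (S 0) + card (S L) \<le> 4" by simp
  moreover have "2 * card (\<Union>t\<le>L. S t) = card (S 0) + card (S L) + (\<Sum>t<L. c t)"
    unfolding c_def by (rule births_deaths) (simp add: S_def)
  ultimately show ?thesis unfolding V by linarith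
qed

section \<open>Tight walks\<close>

text \<open>The extremal case of \<open>even_walk_card_le\<close>.\<close>

definition tight_walk :: "letter list \<Rightarrow> 'a state list \<Rightarrow> bool" where
  "tight_walk w ss \<longleftrightarrow> even_walk w ss \<and> 2 * card (verts ss) = 4 + moves w"

text \<open>Exchanging the walkers: facts are proved for moves of the first walker and transferred.\<close>

fun swap_letter :: "letter \<Rightarrow> letter" where
  "swap_letter First = Second"
| "swap_letter Second = First"
| "swap_letter Cross = Cross"

lemma swap_letter_swap [simp]: "swap_letter (swap_letter l) = l"
  by (cases l) simp_all

lemma swap_letter_eq_First [simp]: "swap_letter l = First \<longleftrightarrow> l = Second"
  by (cases l) simp_all

lemma swap_letter_eq_Cross [simp]: "swap_letter l = Cross \<longleftrightarrow> l = Cross"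
  by (cases l) simp_all

lemma walk_step_swap: "walk_step (swap_letter l) (prod.swap s) (prod.swap s') = walk_step l s s'"
  by (cases l) (auto simp: prod_eq_iff)

lemma walk_edge_swap: "walk_edge (swap_letter l) (prod.swap s) (prod.swap s') = walk_edge l s s'"
  by (cases l) auto

lemma walk_swap: "walk (map swap_letter w) (map prod.swap ss) = walk w ss"
  by (auto simp: walk_def walk_step_swap walk_edge_swap)

lemma edge_mult_swap:
  assumes "walk w ss"
  shows "edge_mult (map swap_letter w) (map prod.swap ss) e = edge_mult w ss e"
proof -
  have "edge_at (map swap_letter w) (map prod.swap ss) t = edge_at w ss t" if "t < length w" for t
    using that assms by (simp add: edge_at_def walk_step_swap walk_edge_swap walk_def)
  hence "{t. t < length w \<and> edge_at (map swap_letter w) (map prod.swap ss) t = e} =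
      {t. t < length w \<and> edge_at w ss t = e}" by blast
  thus ?thesis by (simp add: edge_mult_def)
qed

lemma closed_walk_swap: "closed_walk (map swap_letter w) (map prod.swap ss) = closed_walk w ss"
  unfolding closed_walk_def walk_swap
  by (auto simp: walk_def intro: prod.expand) (metis prod.swap_def swap_swap)

lemma even_walk_swap: "even_walk (map swap_letter w) (map prod.swap ss) = even_walk w ss"
proof (cases "walk w ss")
  case True
  thus ?thesis by (simp add: even_walk_def closed_walk_swap edge_mult_swap)
next
  case False
  hence "\<not> closed_walk w ss" by (simp add: closed_walk_def)
  thus ?thesis by (simp add: even_walk_def closed_walk_swap)
qed

lemma verts_swap: "verts (map prod.swap ss) = verts ss"
  by (auto simp: verts_def ends_def)

lemma moves_swap: "moves (map swap_letter w) = moves w"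
  by (simp add: moves_def filter_map comp_def)

lemma tight_swap: "tight_walk (map swap_letter w) (map prod.swap ss) = tight_walk w ss"
  by (simp add: tight_walk_def even_walk_swap verts_swap moves_swap)

text \<open>In a tight walk every move accounts for exactly one birth or death, so a move to a vertex
    that was seen
before must leave its source for ever.\<close>

lemma tight_source_dead:
  assumes tight: "tight_walk w ss" and t: "t < length w" "w ! t = First"
    and old: "fst (ss ! Suc t) \<in> (\<Union>r\<le>t. ends (ss ! r))" and r: "Suc t \<le> r" "r \<le> length w"
  shows "fst (ss ! t) \<notin> ends (ss ! r)"
proof
  assume dead: "fst (ss ! t) \<in> ends (ss ! r)"
  let ?L = "length w"
  have ev: "even_walk w ss" using tight by (simp add: tight_walk_def)
  define c where "c t = born (seen ss) t + died (seen ss) ?L t" for t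
  define k where "k t = (if w ! t = Cross then 0 else 1 :: nat)" for t
  have le: "c t \<le> k t" if "t < ?L" for t
    using even_walk_born_died[OF ev that] by (simp add: c_def k_def)
  have "(\<Sum>t<?L. c t) = (\<Sum>t<?L. k t)"
    using even_walk_twice_card[OF ev] tight moves_eq_sum[of w]
        by (simp add: c_def k_def tight_walk_def)
  hence "c t = k t" using le t(1) sum_strict_mono_ex1[of "{..<?L}" c k]
    by (metis finite_lessThan lessThan_iff less_irrefl order_le_imp_less_or_eq)
  hence one: "c t = 1" using t(2) by (simp add: k_def)
  have step: "walk_step First (ss ! t) (ss ! Suc t)"
    using ev t by (force simp: even_walk_def closed_walk_def walk_def)
  have "born (seen ss) t = 0"
  proof (rule born_eq_0)
    have "snd (ss ! Suc t) \<in> (\<Union>r\<le>t. ends (ss ! r))" using step by (auto simp: ends_def)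
    thus "seen ss (Suc t) \<subseteq> (\<Union>r\<le>t. seen ss r)" using old unfolding seen_def by (auto simp: ends_def)
  qed
  moreover have "died (seen ss) ?L t = 0"
  proof (rule died_eq_0)
    have "snd (ss ! t) \<in> ends (ss ! Suc t)" using step by (simp add: ends_def)
    hence "snd (ss ! t) \<in> (\<Union>r\<in>{Suc t..?L}. ends (ss ! r))" using t(1)
        by (intro UN_I[of "Suc t"]) auto
    moreover have "fst (ss ! t) \<in> (\<Union>r\<in>{Suc t..?L}. ends (ss ! r))" using dead r
        by (intro UN_I[of r]) auto
    ultimately show "seen ss t \<subseteq> (\<Union>r\<in>{Suc t..?L}. seen ss r)"
        by (simp add: seen_def ends_def[of "ss ! t"])
  qed
  ultimately show False using one by (simp add: c_def)
qed

lemma odd_crossings: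
  fixes z :: "nat \<Rightarrow> 'a"
  assumes "a \<le> b"
  shows "odd (card {r \<in> {a..<b}. (z r = y) \<noteq> (z (Suc r) = y)}) \<longleftrightarrow> (z a = y) \<noteq> (z b = y)"
  using assms
proof (induction b rule: dec_induct)
  case (step n)
  have "{r \<in> {a..<Suc n}. (z r = y) \<noteq> (z (Suc r) = y)} = (if (z n = y) \<noteq> (z (Suc n) = y)
      then insert n {r \<in> {a..<n}. (z r = y) \<noteq> (z (Suc r) = y)}
      else {r \<in> {a..<n}. (z r = y) \<noteq> (z (Suc r) = y)})"
    using step(1) by (auto simp: less_Suc_eq)
  thus ?case using step(3) by auto
qed simp

text \<open>A path from another vertex to its end point crosses into or out of the end point an odd
    number of times, so
one of the edges there is traversed an odd number of times.\<close>

lemma ex_odd_edge: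
  fixes z :: "nat \<Rightarrow> 'a"
  assumes "a \<le> b" "z a \<noteq> z b"
  obtains y' where "y' \<in> z ` {a..b}" "y' \<noteq> z b" "odd (card {r \<in> {a..<b}. {z r, z (Suc r)} =
      {z b, y'}})"
proof -
  define F where "F y' = {r \<in> {a..<b}. {z r, z (Suc r)} = {z b, y'}}" for y'
  let ?Y = "z ` {a..b} - {z b}"
  have "{r \<in> {a..<b}. (z r = z b) \<noteq> (z (Suc r) = z b)} = (\<Union>y'\<in>?Y. F y')"
  proof (intro equalityI subsetI)
    fix r assume r: "r \<in> {r \<in> {a..<b}. (z r = z b) \<noteq> (z (Suc r) = z b)}"
    show "r \<in> (\<Union>y'\<in>?Y. F y')"
    proof (cases "z r = z b")
      case True
      thus ?thesis using r by (intro UN_I[of "z (Suc r)"]) (auto simp: F_def)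
    next
      case False
      thus ?thesis using r by (intro UN_I[of "z r"]) (auto simp: F_def)
    qed
  qed (auto simp: F_def doubleton_eq_iff)
  moreover have "card (\<Union>y'\<in>?Y. F y') = (\<Sum>y'\<in>?Y. card (F y'))"
    by (rule card_UN_disjoint) (auto simp: F_def doubleton_eq_iff)
  ultimately have "odd (\<Sum>y'\<in>?Y. card (F y'))"
    using odd_crossings[OF assms(1), of z "z b"] assms(2) by simp
  hence "\<exists>y'\<in>?Y. odd (card (F y'))" using dvd_sum[of ?Y 2 "\<lambda>y'. card (F y')"] by blast
  thus ?thesis using that unfolding F_def by blast
qed

text \<open>The key obstruction. Let the first walker reach a vertex \<open>y\<close> at time \<open>b\<close>, having started
    elsewhere at time
\<open>a\<close>, and let \<open>y\<close> not occur in any state before \<open>a\<close> or after \<open>b\<close>. Some edge at \<open>y\<close> is traversed an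
    odd number
of times between \<open>a\<close> and \<open>b\<close>. Under the disjointness assumptions no other step of the walk can use
    this edge,
which contradicts evenness.\<close>

lemma even_walk_no_dead_end:
  assumes ev: "even_walk w ss" and ab: "a \<le> b" "b < length w" "w ! b = First"
    and neq: "fst (ss ! a) \<noteq> fst (ss ! b)"
    and before: "\<And>r. r < a \<Longrightarrow> fst (ss ! b) \<notin> ends (ss ! r)"
    and after: "\<And>r. Suc b \<le> r \<Longrightarrow> r \<le> length w \<Longrightarrow> fst (ss ! b) \<notin> ends (ss ! r)"
    and apart: "\<And>r r'. a \<le> r \<Longrightarrow> r \<le> b \<Longrightarrow> a \<le> r' \<Longrightarrow> r' \<le> b \<Longrightarrow> snd (ss ! r) \<noteq> fst (ss ! r')"
    and fresh: "\<And>r. a \<le> r \<Longrightarrow> r \<le> b \<Longrightarrow> fst (ss ! Suc b) \<noteq> fst (ss ! r)"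
  shows False
proof -
  define z where "z r = fst (ss ! r)" for r
  obtain y' where y': "y' \<in> z ` {a..b}" "y' \<noteq> z b" "odd (card {r \<in> {a..<b}. {z r, z (Suc r)} =
      {z b, y'}})"
    using ex_odd_edge[of a b z] ab neq by (auto simp: z_def)
  have step: "walk_step (w ! t) (ss ! t) (ss ! Suc t)" if "t < length w" for t
    using ev that by (simp add: even_walk_def closed_walk_def walk_def)
  have "{t. t < length w \<and> edge_at w ss t = {z b, y'}} = {r \<in> {a..<b}. {z r, z (Suc r)} =
      {z b, y'}}"
  proof (intro equalityI subsetI)
    fix t assume "t \<in> {t. t < length w \<and> edge_at w ss t = {z b, y'}}"
    hence t: "t < length w" "edge_at w ss t = {z b, y'}" by auto
    have inS: "z b \<in> ends (ss ! t) \<union> ends (ss ! Suc t)"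
      using walk_edge_subset[OF step[OF t(1)]] t(2) by (auto simp: edge_at_def)
    have snd: "snd (ss ! r) \<noteq> z r'" if "a \<le> r" "r \<le> b" "a \<le> r'" "r' \<le> b" for r r'
      using apart that by (simp add: z_def)
    obtain q where q: "y' = z q" "a \<le> q" "q \<le> b" using y'(1) by auto
    have "\<not> t < a"
    proof
      assume "t < a"
      hence "z b \<in> ends (ss ! a)" using inS before[of t] before[of "Suc t"]
        by (cases "Suc t = a") (auto simp: z_def)
      thus False using neq snd[of a b] ab by (auto simp: ends_def z_def)
    qed
    moreover have "\<not> b < t" using inS after[of t] after[of "Suc t"] t(1) by (auto simp: z_def)
    moreover have "t \<noteq> b"
    proof
      assume "t = b"
      hence "{z b, z (Suc b)} = {z b, y'}" using t(2) ab by (simp add: edge_at_def z_def)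
      hence "y' = z (Suc b)" using y'(2) by (auto simp: doubleton_eq_iff)
      thus False using fresh[of q] q by (simp add: z_def)
    qed
    ultimately have tab: "a \<le> t" "t < b" by auto
    have "w ! t = First"
    proof (cases "w ! t")
      case Second
      hence "z b = snd (ss ! t) \<or> z b = snd (ss ! Suc t)" using t(2)
          by (auto simp: edge_at_def doubleton_eq_iff)
      thus ?thesis using snd[of t b] snd[of "Suc t" b] tab by auto
    next
      case Cross
      hence "snd (ss ! t) = z b \<or> snd (ss ! t) = z q" using t(2) q
          by (auto simp: edge_at_def doubleton_eq_iff)
      thus ?thesis using snd[of t b] snd[of t q] tab q by auto
    qed
    thus "t \<in> {r \<in> {a..<b}. {z r, z (Suc r)} = {z b, y'}}" using tab t(2)
        by (simp add: edge_at_def z_def)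
  next
    fix r assume "r \<in> {r \<in> {a..<b}. {z r, z (Suc r)} = {z b, y'}}"
    hence r: "a \<le> r" "r < b" "{z r, z (Suc r)} = {z b, y'}" by auto
    hence "z r \<noteq> z (Suc r)" using y'(2) by auto
    hence "w ! r = First" using step[of r] r ab by (cases "w ! r") (auto simp: z_def)
    thus "r \<in> {t. t < length w \<and> edge_at w ss t = {z b, y'}}" using r ab
        by (simp add: edge_at_def z_def)
  qed
  hence "odd (edge_mult w ss {z b, y'})" using y'(3) by (simp add: edge_mult_def)
  thus False using ev by (simp add: even_walk_def)
qed

text \<open>Suppose that the first walker is the first to step on a vertex of the other one. This vertex
    is not new, so
the source of the step dies, and the path of the first walker from its start to the source is a
    dead end. The source
is not the start, since the start is visited again at the end of the closed walk.\<close>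

lemma tight_apart_step:
  assumes tight: "tight_walk w ss" and T: "T < length w" "w ! T = First"
    and IH: "\<And>r r'. r \<le> T \<Longrightarrow> r' \<le> T \<Longrightarrow> fst (ss ! r) \<noteq> snd (ss ! r')"
    and r: "r \<le> T"
  shows "fst (ss ! Suc T) \<noteq> snd (ss ! r)"
proof
  assume eq: "fst (ss ! Suc T) = snd (ss ! r)"
  have ev: "even_walk w ss" using tight by (simp add: tight_walk_def)
  have dead: "fst (ss ! T) \<notin> ends (ss ! q)" if "Suc T \<le> q" "q \<le> length w" for q
    using tight_source_dead[OF tight T _ that] eq r by (auto simp: ends_def)
  show False
  proof (rule even_walk_no_dead_end[OF ev, of 0 T])
    have "ss ! length w = ss ! 0" using ev by (simp add: even_walk_def closed_walk_def)
    thus "fst (ss ! 0) \<noteq> fst (ss ! T)" using dead[of "length w"] T by (auto simp: ends_def)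
    show "snd (ss ! q) \<noteq> fst (ss ! q')" if "q \<le> T" "q' \<le> T" for q q' using IH that by metis
    show "fst (ss ! Suc T) \<noteq> fst (ss ! q)" if "q \<le> T" for q using IH[OF that r] eq by metis
  qed (use T dead in auto)
qed

theorem tight_apart:
  assumes tight: "tight_walk w ss" and "r \<le> length w" "r' \<le> length w"
  shows "fst (ss ! r) \<noteq> snd (ss ! r')"
proof -
  have wk: "walk w ss" using tight by (simp add: tight_walk_def even_walk_def closed_walk_def)
  have "\<forall>r\<le>T. \<forall>r'\<le>T. fst (ss ! r) \<noteq> snd (ss ! r')" if "T \<le> length w" for T
    using that
  proof (induction T)
    case 0
    thus ?case using wk by (simp add: walk_def)
  next
    case (Suc T)
    hence IH: "\<And>r r'. r \<le> T \<Longrightarrow> r' \<le> T \<Longrightarrow> fst (ss ! r) \<noteq> snd (ss ! r')" by simp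
    have T: "T < length w" using Suc by simp
    have st: "fst (ss ! Suc T) \<noteq> snd (ss ! Suc T)" "walk_step (w ! T) (ss ! T) (ss ! Suc T)"
      using wk T by (auto simp: walk_def)
    have "fst (ss ! Suc T) \<noteq> snd (ss ! r) \<and> fst (ss ! r) \<noteq> snd (ss ! Suc T)" if "r \<le> T" for r
    proof (cases "w ! T")
      case First
      thus ?thesis using tight_apart_step[OF tight T First IH that] st IH[OF that, of T] by simp
    next
      case Second
      let ?w = "map swap_letter w" and ?ss = "map prod.swap ss"
      have nth: "?ss ! q = prod.swap (ss ! q)" if "q \<le> Suc T" for q
        using that T wk by (simp add: walk_def)
      have "fst (?ss ! Suc T) \<noteq> snd (?ss ! r)"
      proof (rule tight_apart_step)
        show "tight_walk ?w ?ss" using tight by (simp add: tight_swap)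
        show "T < length ?w" "?w ! T = First" using T Second by simp_all
        show "fst (?ss ! q) \<noteq> snd (?ss ! q')" if "q \<le> T" "q' \<le> T" for q q'
          using nth[of q] nth[of q'] that IH[of q' q] by simp
      qed (use that in simp)
      thus ?thesis using nth[of r] nth[of "Suc T"] that st Second IH[OF _ that, of T] by auto
    next
      case Cross
      hence "ss ! Suc T = ss ! T" using st(2) by simp
      thus ?thesis using IH[OF that, of T] IH[OF _ that, of T] by simp
    qed
    thus ?case using IH st(1) by (auto simp: le_Suc_eq)
  qed
  thus ?thesis using assms by blast
qed

text \<open>After a return to its start, a walker does not revisit any other vertex that it visited
    before the return:
the first such step would again leave a dead end.\<close>

lemma tight_return_split:
  assumes tight: "tight_walk w ss" and T: "T \<le> length w" "fst (ss ! T) = fst (ss ! 0)"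
    and r: "r < T" "T \<le> r'" "r' \<le> length w" and eq: "fst (ss ! r) = fst (ss ! r')"
  shows "fst (ss ! r) = fst (ss ! 0)"
proof (rule ccontr)
  assume "fst (ss ! r) \<noteq> fst (ss ! 0)"
  define P where "P q \<longleftrightarrow> T \<le> q \<and> q \<le> length w \<and> fst (ss ! q) \<noteq> fst (ss ! 0) \<and> (\<exists>r<T. fst (ss ! q) =
      fst (ss ! r))" for q
  have "P r'" using r eq \<open>fst (ss ! r) \<noteq> fst (ss ! 0)\<close> by (auto simp: P_def)
  define R where "R = (LEAST q. P q)"
  have PR: "P R" unfolding R_def by (rule LeastI[of P, OF \<open>P r'\<close>])
  have min: "\<not> P q" if "q < R" for q using not_less_Least[of q P] that by (simp add: R_def)
  have ev: "even_walk w ss" using tight by (simp add: tight_walk_def)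
  have closed: "ss ! length w = ss ! 0" using ev by (simp add: even_walk_def closed_walk_def)
  have "R \<noteq> T" using PR T by (auto simp: P_def)
  then obtain b where b: "R = Suc b" "T \<le> b" "b < length w"
    using PR by (cases R) (auto simp: P_def)
  have step: "walk_step (w ! b) (ss ! b) (ss ! Suc b)"
    using ev b by (simp add: even_walk_def closed_walk_def walk_def)
  have nP: "\<not> P b" using min b by simp
  have First: "w ! b = First"
    using step nP PR b by (cases "w ! b") (auto simp: P_def)
  obtain q where q: "q < T" "fst (ss ! R) = fst (ss ! q)" "fst (ss ! R) \<noteq> fst (ss ! 0)" using PR
      by (auto simp: P_def)
  have dead: "fst (ss ! b) \<notin> ends (ss ! q)" if "Suc b \<le> q" "q \<le> length w" for q
    using tight_source_dead[OF tight b(3) First _ that] q b by (force simp: ends_def)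
  have neq0: "fst (ss ! b) \<noteq> fst (ss ! 0)"
    using dead[of "length w"] b closed by (auto simp: ends_def)
  show False
  proof (rule even_walk_no_dead_end[OF ev b(2,3) First])
    show "fst (ss ! T) \<noteq> fst (ss ! b)" using neq0 T by simp
    show "fst (ss ! b) \<notin> ends (ss ! r)" if "r < T" for r
    proof -
      have "fst (ss ! b) \<noteq> fst (ss ! r)" using nP neq0 b that unfolding P_def by (metis less_imp_le)
      moreover have "fst (ss ! b) \<noteq> snd (ss ! r)" using tight_apart[OF tight, of b r] that b T
          by simp
      ultimately show ?thesis by (simp add: ends_def)
    qed
    show "snd (ss ! r) \<noteq> fst (ss ! r')" if "r \<le> b" "r' \<le> b" for r r'
      using tight_apart[OF tight, of r' r] that b by auto
    show "fst (ss ! Suc b) \<noteq> fst (ss ! r)" if "T \<le> r" "r \<le> b" for r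
      using min[of r] that b q by (auto simp: P_def)
  qed (use dead in auto)
qed

text \<open>The first return to the start uses the same edge as the first step, as otherwise the vertex
    from which the
walker returns would be a dead end.\<close>

lemma tight_first_return:
  assumes tight: "tight_walk w ss" and w: "w \<noteq> []" "w ! 0 = First"
  obtains T where "2 \<le> T" "T \<le> length w" "w ! (T - 1) = First" "fst (ss ! (T - 1)) = fst (ss ! 1)"
    "fst (ss ! T) = fst (ss ! 0)" "\<And>r. 0 < r \<Longrightarrow> r < T \<Longrightarrow> fst (ss ! r) \<noteq> fst (ss ! 0)"
proof -
  have ev: "even_walk w ss" using tight by (simp add: tight_walk_def)
  have closed: "ss ! length w = ss ! 0" using ev by (simp add: even_walk_def closed_walk_def)
  have step: "walk_step (w ! t) (ss ! t) (ss ! Suc t)" if "t < length w" for t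
    using ev that by (simp add: even_walk_def closed_walk_def walk_def)
  define P where "P q \<longleftrightarrow> 0 < q \<and> q \<le> length w \<and> fst (ss ! q) = fst (ss ! 0)" for q
  have Pl: "P (length w)" using w closed by (simp add: P_def)
  define T where "T = (LEAST q. P q)"
  have PT: "P T" unfolding T_def by (rule LeastI[of P, OF Pl])
  have min: "\<not> P q" if "q < T" for q using not_less_Least[of q P] that by (simp add: T_def)
  have "fst (ss ! 1) \<noteq> fst (ss ! 0)" using step[of 0] w by simp
  hence "T \<noteq> 1" using PT by (auto simp: P_def)
  then obtain b where b: "T = Suc b" "0 < b" "b < length w" using PT by (cases T) (auto simp: P_def)
  have ret: "fst (ss ! r) \<noteq> fst (ss ! 0)" if "0 < r" "r < T" for r using min[OF that(2)] that PT
      by (auto simp: P_def)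
  have First: "w ! b = First"
    using step[OF b(3)] ret[of b] b PT by (cases "w ! b") (auto simp: P_def)
  have dead: "fst (ss ! b) \<notin> ends (ss ! q)" if "Suc b \<le> q" "q \<le> length w" for q
    using tight_source_dead[OF tight b(3) First _ that] PT b by (force simp: ends_def P_def)
  have "fst (ss ! b) = fst (ss ! 1)"
  proof (rule ccontr)
    assume neq: "fst (ss ! b) \<noteq> fst (ss ! 1)"
    show False
    proof (rule even_walk_no_dead_end[OF ev _ b(3) First, of 1])
      show "fst (ss ! b) \<notin> ends (ss ! r)" if "r < 1" for r
      proof -
        have "fst (ss ! b) \<noteq> fst (ss ! 0)" using ret[of b] b by simp
        moreover have "fst (ss ! b) \<noteq> snd (ss ! 0)" using tight_apart[OF tight, of b 0] b by simp
        ultimately show ?thesis using that by (simp add: ends_def)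
      qed
      show "snd (ss ! r) \<noteq> fst (ss ! r')" if "r \<le> b" "r' \<le> b" for r r'
        using tight_apart[OF tight, of r' r] that b by auto
      show "fst (ss ! Suc b) \<noteq> fst (ss ! r)" if "1 \<le> r" "r \<le> b" for r
        using ret[of r] that b PT by (auto simp: P_def)
    qed (use dead neq b in auto)
  qed
  thus ?thesis using that[of T] b First PT ret by (auto simp: P_def)
qed

section \<open>Cutting a tight walk at the first return\<close>

lemma walk_Nil: "walk [] ss \<longleftrightarrow> (\<exists>s. ss = [s] \<and> fst s \<noteq> snd s)"
  by (cases ss) (auto simp: walk_def)

lemma walk_length: "walk w ss \<Longrightarrow> length ss = Suc (length w)"
  by (simp add: walk_def)

lemma walk_nonempty: "walk w ss \<Longrightarrow> ss \<noteq> []"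
  by (auto simp: walk_def)

lemma walk_Cons:
  assumes "ss \<noteq> []"
  shows "walk (l # w) (s # ss) \<longleftrightarrow> fst s \<noteq> snd s \<and> walk_step l s (hd ss) \<and> walk w ss"
  using assms by (auto simp: walk_def All_less_Suc2 hd_conv_nth)

lemma edge_mult_Cons:
  assumes "ss \<noteq> []"
  shows "edge_mult (l # w) (s # ss) e = (if walk_edge l s (hd ss) = e then 1 else 0) +
      edge_mult w ss e"
proof -
  have "{t. t < Suc (length w) \<and> edge_at (l # w) (s # ss) t = e} =
      {t. t = 0 \<and> walk_edge l s (hd ss) = e} \<union> Suc ` {t. t < length w \<and> edge_at w ss t = e}"
    (is "?A = ?B \<union> ?C")
  proof (intro equalityI subsetI)
    fix t assume "t \<in> ?A"
    thus "t \<in> ?B \<union> ?C" using assms by (cases t) (auto simp: edge_at_def hd_conv_nth)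
  qed (use assms in \<open>auto simp: edge_at_def hd_conv_nth\<close>)
  moreover have "card ?B = (if walk_edge l s (hd ss) = e then 1 else 0)" by auto
  moreover have "card ?C = edge_mult w ss e" by (simp add: card_image edge_mult_def)
  moreover have "card (?B \<union> ?C) = card ?B + card ?C" by (rule card_Un_disjoint) auto
  ultimately show ?thesis by (simp add: edge_mult_def)
qed

lemma walk_append:
  assumes "length us = Suc (length U)" "vs \<noteq> []"
  shows "walk (U @ l # V) (us @ vs) \<longleftrightarrow> walk U us \<and> walk_step l (last us) (hd vs) \<and> walk V vs"
  using assms(1)
proof (induction U arbitrary: us)
  case Nil
  then obtain s where "us = [s]" by (cases us) auto
  thus ?case using assms(2) by (auto simp: walk_Cons walk_Nil)
next
  case (Cons a U)
  then obtain s us' where us: "us = s # us'" "length us' = Suc (length U)" by (cases us) auto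
  hence "us' \<noteq> []" by auto
  thus ?case using us Cons.IH[OF us(2)] by (auto simp: walk_Cons)
qed

lemma edge_mult_append:
  assumes "length us = Suc (length U)" "vs \<noteq> []"
  shows "edge_mult (U @ l # V) (us @ vs) e =
    edge_mult U us e + (if walk_edge l (last us) (hd vs) = e then 1 else 0) + edge_mult V vs e"
  using assms(1)
proof (induction U arbitrary: us)
  case Nil
  then obtain s where "us = [s]" by (cases us) auto
  thus ?case using assms(2) by (simp add: edge_mult_Cons) (simp add: edge_mult_def)
next
  case (Cons a U)
  then obtain s us' where us: "us = s # us'" "length us' = Suc (length U)" by (cases us) auto
  hence "us' \<noteq> []" by auto
  thus ?case using us Cons.IH[OF us(2)] by (simp add: edge_mult_Cons)
qed

lemma closed_walk_altdef: "closed_walk w ss \<longleftrightarrow> walk w ss \<and> last ss = hd ss"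
proof (cases "walk w ss")
  case True
  hence "ss \<noteq> []" "length ss - 1 = length w" by (auto simp: walk_def)
  thus ?thesis by (simp add: closed_walk_def last_conv_nth hd_conv_nth)
qed (simp add: closed_walk_def)

lemma edge_at_cases:
  assumes "walk w ss" "t < length w"
  shows "(w ! t = First \<and> edge_at w ss t = {fst (ss ! t), fst (ss ! Suc t)}) \<or>
    (w ! t = Second \<and> edge_at w ss t = {snd (ss ! t), snd (ss ! Suc t)} \<and>
        snd (ss ! t) \<noteq> snd (ss ! Suc t)) \<or>
    (w ! t = Cross \<and> edge_at w ss t = {fst (ss ! t), snd (ss ! t)})"
proof -
  have "walk_step (w ! t) (ss ! t) (ss ! Suc t)" using assms by (simp add: walk_def)
  thus ?thesis by (cases "w ! t") (auto simp: edge_at_def)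
qed

lemma walk_nth_mem:
  assumes "walk w ss" "t < length w"
  shows "ss ! t \<in> set ss" "ss ! Suc t \<in> set ss"
  using assms by (auto simp: walk_def)

lemma edge_mult_cases:
  assumes "walk w ss" "edge_mult w ss e \<noteq> 0"
  shows "(e \<noteq> {} \<and> e \<subseteq> fst ` set ss) \<or> (card e = 2 \<and> e \<subseteq> snd ` set ss) \<or>
    (\<exists>a\<in>fst ` set ss. \<exists>b\<in>snd ` set ss. e = {a, b})"
proof -
  have "{t. t < length w \<and> edge_at w ss t = e} \<noteq> {}"
    using assms(2) unfolding edge_mult_def by (metis card.empty)
  then obtain t where "t < length w" "edge_at w ss t = e" by blast
  thus ?thesis using edge_at_cases[OF assms(1), of t] walk_nth_mem[OF assms(1), of t] by auto
qed

text \<open>If the edges among the vertices of the first walker have even multiplicities, then counting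
    the moves of this walker
by their edges gives an even number.\<close>

lemma even_first_moves:
  assumes w: "walk w ss" and apart: "fst ` set ss \<inter> snd ` set ss = {}"
    and ev: "\<And>e. e \<subseteq> fst ` set ss \<Longrightarrow> even (edge_mult w ss e)"
  shows "even (length (filter (\<lambda>l. l = First) w))"
proof -
  let ?A = "fst ` set ss"
  have "{t. t < length w \<and> w ! t = First} = (\<Union>e\<in>Pow ?A. {t. t < length w \<and> edge_at w ss t = e})"
  proof (intro equalityI subsetI)
    fix t assume t: "t \<in> {t. t < length w \<and> w ! t = First}"
    hence "edge_at w ss t \<subseteq> ?A" using edge_at_cases[OF w, of t] walk_nth_mem[OF w, of t] by auto
    thus "t \<in> (\<Union>e\<in>Pow ?A. {t. t < length w \<and> edge_at w ss t = e})" using t by blast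
  next
    fix t assume "t \<in> (\<Union>e\<in>Pow ?A. {t. t < length w \<and> edge_at w ss t = e})"
    hence t: "t < length w" "edge_at w ss t \<subseteq> ?A" by auto
    have "snd (ss ! t) \<notin> ?A" using walk_nth_mem[OF w t(1)] apart by auto
    hence "w ! t = First" using edge_at_cases[OF w t(1)] t(2) by auto
    thus "t \<in> {t. t < length w \<and> w ! t = First}" using t by simp
  qed
  moreover have "card (\<Union>e\<in>Pow ?A. {t. t < length w \<and> edge_at w ss t = e}) =
      (\<Sum>e\<in>Pow ?A. edge_mult w ss e)"
    unfolding edge_mult_def by (rule card_UN_disjoint) auto
  moreover have "even (\<Sum>e\<in>Pow ?A. edge_mult w ss e)" using ev by (intro dvd_sum) auto
  ultimately show ?thesis by (simp add: length_filter_conv_card)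
qed

text \<open>The parity of this number, for all \<open>y\<close>, reveals whether the second walker is back at its
    start.\<close>

definition cross_count :: "letter list \<Rightarrow> 'a state list \<Rightarrow> 'a \<Rightarrow> nat" where
  "cross_count w ss y = card {t. t < length w \<and> w ! t = Cross \<and> snd (ss ! t) = y}"

lemma even_cross_count:
  assumes w: "walk w ss" and apart: "fst ` set ss \<inter> snd ` set ss = {}"
    and ev: "\<And>a. a \<in> fst ` set ss \<Longrightarrow> even (edge_mult w ss {a, y})"
  shows "even (cross_count w ss y)"
proof (cases "y \<in> snd ` set ss")
  case True
  let ?A = "fst ` set ss"
  have yA: "y \<notin> ?A" using True apart by auto
  have "{t. t < length w \<and> w ! t = Cross \<and> snd (ss ! t) = y} = (\<Union>a\<in>?A. {t. t < length w \<and>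
      edge_at w ss t = {a, y}})"
  proof (intro equalityI subsetI)
    fix t assume t: "t \<in> {t. t < length w \<and> w ! t = Cross \<and> snd (ss ! t) = y}"
    hence "edge_at w ss t = {fst (ss ! t), y}" "fst (ss ! t) \<in> ?A"
      using edge_at_cases[OF w, of t] walk_nth_mem[OF w, of t] by auto
    thus "t \<in> (\<Union>a\<in>?A. {t. t < length w \<and> edge_at w ss t = {a, y}})" using t by blast
  next
    fix t assume "t \<in> (\<Union>a\<in>?A. {t. t < length w \<and> edge_at w ss t = {a, y}})"
    then obtain a where t: "t < length w" "edge_at w ss t = {a, y}" "a \<in> ?A" by auto
    have m: "fst (ss ! t) \<in> ?A" "fst (ss ! Suc t) \<in> ?A" "snd (ss ! t) \<in> snd ` set ss"
        "snd (ss ! Suc t) \<in> snd ` set ss"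
      using walk_nth_mem[OF w t(1)] by auto
    have "a \<notin> snd ` set ss" using t(3) apart by blast
    hence "a \<noteq> snd (ss ! t)" "a \<noteq> snd (ss ! Suc t)" using m by auto
    moreover have "y \<noteq> fst (ss ! t)" "y \<noteq> fst (ss ! Suc t)" using yA m by auto
    ultimately have "w ! t = Cross \<and> snd (ss ! t) = y" using edge_at_cases[OF w t(1)] t(2)
      by (auto simp: doubleton_eq_iff)
    thus "t \<in> {t. t < length w \<and> w ! t = Cross \<and> snd (ss ! t) = y}" using t by simp
  qed
  moreover have "card (\<Union>a\<in>?A. {t. t < length w \<and> edge_at w ss t = {a, y}}) =
      (\<Sum>a\<in>?A. edge_mult w ss {a, y})"
    unfolding edge_mult_def by (rule card_UN_disjoint) (auto simp: doubleton_eq_iff)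
  moreover have "even (\<Sum>a\<in>?A. edge_mult w ss {a, y})" using ev by (intro dvd_sum) auto
  ultimately show ?thesis by (simp add: cross_count_def)
next
  case False
  have "{t. t < length w \<and> w ! t = Cross \<and> snd (ss ! t) = y} = {}"
    using False walk_nth_mem(1)[OF w] by auto
  thus ?thesis unfolding cross_count_def by (simp only: card.empty even_zero)
qed

text \<open>In these words the second walker moves only within blocks in which its position is recorded
    once before and once
after the two moves. The recorded positions telescope modulo 2, leaving the first and the last one.\<close>

inductive telescoping :: "letter list \<Rightarrow> bool" where
  Nil: "telescoping []"
| First: "telescoping w \<Longrightarrow> telescoping (First # w)"
| Block: "telescoping w \<Longrightarrow> telescoping (Cross # Second # Second # Cross # w)"

lemma cross_count_Cons:
  "cross_count (l # w) (s # ss) y = (if l = Cross \<and> snd s = y then 1 else 0) + cross_count w ss y"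
proof -
  have "{t. t < Suc (length w) \<and> (l # w) ! t = Cross \<and> snd ((s # ss) ! t) = y} =
      {t. t = 0 \<and> l = Cross \<and> snd s = y} \<union> Suc ` {t. t < length w \<and> w ! t = Cross \<and> snd (ss ! t) =
          y}"
    (is "?A = ?B \<union> ?C")
  proof (intro equalityI subsetI)
    fix t assume "t \<in> ?A"
    thus "t \<in> ?B \<union> ?C" by (cases t) auto
  qed auto
  moreover have "card ?B = (if l = Cross \<and> snd s = y then 1 else 0)" by auto
  moreover have "card ?C = cross_count w ss y" by (simp add: card_image cross_count_def)
  moreover have "card (?B \<union> ?C) = card ?B + card ?C" by (rule card_Un_disjoint) auto
  ultimately show ?thesis by (simp add: cross_count_def)
qed

lemma telescoping_cross_count:
  assumes "telescoping w" "walk w ss"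
  shows "even (cross_count w ss y) \<longleftrightarrow> (snd (hd ss) = y \<longleftrightarrow> snd (last ss) = y)"
  using assms
proof (induction w arbitrary: ss rule: telescoping.induct)
  case Nil
  thus ?case by (auto simp: walk_Nil cross_count_def)
next
  case (First w)
  from walk_length[OF First.prems] obtain s ss' where ss: "ss = s # ss'" "ss' \<noteq> []"
    by (auto simp: length_Suc_conv)
  thus ?case using First.IH[of ss'] First.prems by (simp add: walk_Cons cross_count_Cons)
next
  case (Block w)
  from walk_length[OF Block.prems] obtain s0 s1 s2 s3 ss'
      where ss: "ss = s0 # s1 # s2 # s3 # ss'" "ss' \<noteq> []"
    by (auto simp: length_Suc_conv)
  thus ?case using Block.IH[of ss'] Block.prems by (auto simp: walk_Cons cross_count_Cons)
qed

lemma tight_return_split_snd: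
  assumes tight: "tight_walk w ss" and T: "T \<le> length w" "snd (ss ! T) = snd (ss ! 0)"
    and r: "r < T" "T \<le> r'" "r' \<le> length w" and eq: "snd (ss ! r) = snd (ss ! r')"
  shows "snd (ss ! r) = snd (ss ! 0)"
proof -
  have "length ss = Suc (length w)"
    using tight by (simp add: tight_walk_def even_walk_def closed_walk_def walk_def)
  thus ?thesis
    using tight_return_split[of "map swap_letter w" "map prod.swap ss" T r r'] assms
    by (simp add: tight_swap)
qed

text \<open>The walk is cut at the first return of the first walker. The two parts use disjoint sets of
vertices of the first walker, hence disjoint sets of first-walker and crossing edges,
    and their multiplicities are even
separately. For a telescoping word the evenness of the crossing edges forces the second walker to
    be back at its
start as well; by \<open>tight_return_split\<close> its two parts share no edge either.\<close>

theorem tight_decomposition: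
  assumes tight: "tight_walk (First # w) (s # ss)"
  obtains U V us vs where "w = U @ First # V" "ss = us @ vs" "length us = Suc (length U)" "vs \<noteq> []"
    "even (length (filter (\<lambda>l. l = First) U))"
    "telescoping U \<Longrightarrow> even_walk U us \<and> even_walk V vs \<and> snd (hd us) = snd s \<and> hd vs = s"
proof -
  let ?W = "First # w" and ?S = "s # ss"
  have ev: "even_walk ?W ?S" using tight by (simp add: tight_walk_def)
  hence wk: "walk ?W ?S" and closed: "last ?S = s" by (auto simp: even_walk_def closed_walk_altdef)
  have len: "length ss = Suc (length w)" using walk_length[OF wk] by simp
  obtain T where T: "2 \<le> T" "T \<le> length ?W" "?W ! (T - 1) = First" "fst (?S ! (T - 1)) =
      fst (?S ! 1)"
    "fst (?S ! T) = fst (?S ! 0)" "\<And>r. 0 < r \<Longrightarrow> r < T \<Longrightarrow> fst (?S ! r) \<noteq> fst (?S ! 0)"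
    using tight_first_return[OF tight] by auto
  define n where "n = T - 2"
  have n: "T = Suc (Suc n)" "n < length w" using T by (auto simp: n_def)
  define U where "U = take n w"
  define V where "V = drop (Suc n) w"
  define us where "us = take (Suc n) ss"
  define vs where "vs = drop (Suc n) ss"
  have wn: "w ! n = First" using T(3) n by simp
  have w: "w = U @ First # V" using id_take_nth_drop[OF n(2)] wn by (simp add: U_def V_def)
  have ss: "ss = us @ vs" by (simp add: us_def vs_def)
  have lu: "length us = Suc (length U)" using n len by (simp add: us_def U_def)
  have vs: "vs \<noteq> []" using n len by (simp add: vs_def)
  have us: "us \<noteq> []" using lu by auto
  have hdu: "hd us = ?S ! 1" using us len by (simp add: us_def hd_conv_nth)
  have lastu: "last us = ?S ! (T - 1)" using us lu n by (simp add: us_def U_def last_conv_nth)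
  have hdv: "hd vs = ?S ! T" using vs n len by (simp add: vs_def hd_conv_nth)
  have set_us: "\<exists>r. 0 < r \<and> r < T \<and> x = ?S ! r" if x: "x \<in> set us" for x
  proof -
    obtain i where "i < length us" "x = us ! i" using x by (auto simp: in_set_conv_nth)
    thus ?thesis using n by (intro exI[of _ "Suc i"]) (auto simp: us_def)
  qed
  have set_vs: "\<exists>r. T \<le> r \<and> r \<le> length ?W \<and> x = ?S ! r" if x: "x \<in> set vs" for x
  proof -
    obtain i where "i < length vs" "x = vs ! i" using x by (auto simp: in_set_conv_nth)
    thus ?thesis using n len by (intro exI[of _ "Suc (Suc n) + i"]) (auto simp: vs_def)
  qed
  have AA: "fst x \<noteq> fst y" if "x \<in> set us" "y \<in> set vs" for x y
    using set_us[OF that(1)] set_vs[OF that(2)] tight_return_split[OF tight T(2,5)] T(6) by metis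
  have AB: "fst x \<noteq> snd y" if "x \<in> set us \<union> set vs" "y \<in> set us \<union> set vs" for x y
  proof -
    have "\<exists>r\<le>length ?W. z = ?S ! r" if "z \<in> set us \<union> set vs" for z
      using that set_us[of z] set_vs[of z] T(2) by (metis Un_iff less_imp_le order_trans)
    thus ?thesis using tight_apart[OF tight] that by metis
  qed
  have AAs: "fst ` set us \<inter> fst ` set vs = {}"
  proof (rule ccontr)
    assume "\<not> ?thesis"
    then obtain p q where "p \<in> set us" "q \<in> set vs" "fst p = fst q" by blast
    thus False using AA by metis
  qed
  have ABs: "(fst ` set us \<union> fst ` set vs) \<inter> (snd ` set us \<union> snd ` set vs) = {}"
  proof (rule ccontr)
    assume "\<not> ?thesis"
    then obtain p q where "p \<in> set us \<union> set vs" "q \<in> set us \<union> set vs" "fst p = snd q" by blast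
    thus False using AB by metis
  qed
  have step0: "walk_step First s (hd us)" and wss: "walk w ss"
    using wk ss us walk_Cons[of ss First w s] by auto
  have wU: "walk U us" and wV: "walk V vs" and stepT: "walk_step First (last us) (hd vs)"
    using wss walk_append[OF lu vs, of First V] w ss by auto
  have sndu: "snd (hd us) = snd s" using step0 by simp
  (* The edge of the first step is also the edge of the return; removing both uses keeps parities.
      *)
  have total: "even (edge_mult U us e + edge_mult V vs e)" for e
  proof -
    define d where "d = (if {fst s, fst (hd us)} = e then 1 else 0 :: nat)"
    have "hd ss = hd us" using us ss by simp
    hence "edge_mult ?W ?S e = d + edge_mult w ss e"
      using edge_mult_Cons[of ss First w s e] ss us by (simp add: d_def)
    also have "walk_edge First (last us) (hd vs) = {fst s, fst (hd us)}"
      using T(4,5) hdu lastu hdv by auto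
    hence "edge_mult w ss e = edge_mult U us e + d + edge_mult V vs e"
      using edge_mult_append[OF lu vs, of First V e] unfolding ss w d_def by presburger
    finally have "edge_mult ?W ?S e = 2 * d + (edge_mult U us e + edge_mult V vs e)" by simp
    moreover have "even (edge_mult ?W ?S e)" using ev by (simp add: even_walk_def)
    ultimately show ?thesis by simp
  qed
  have V0: "edge_mult V vs e = 0" if "a \<in> e" "a \<in> fst ` set us" for a e
  proof (rule ccontr)
    assume nz: "edge_mult V vs e \<noteq> 0"
    have "a \<notin> fst ` set vs" "a \<notin> snd ` set vs" using that(2) AAs ABs by blast+
    thus False using edge_mult_cases[OF wV nz] that(1) by blast
  qed
  have evU: "even (edge_mult U us e)" if "a \<in> e" "a \<in> fst ` set us" for a e
    using total[of e] V0[OF that] by simp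
  have apU: "fst ` set us \<inter> snd ` set us = {}" using ABs by blast
  have "even (length (filter (\<lambda>l. l = First) U))"
  proof (rule even_first_moves[OF wU apU])
    fix e assume e: "e \<subseteq> fst ` set us"
    show "even (edge_mult U us e)"
    proof (cases "e = {}")
      case True
      hence "edge_mult U us e = 0" using edge_mult_cases[OF wU, of e] by auto
      thus ?thesis by simp
    next
      case False
      then obtain a where a: "a \<in> e" by blast
      hence "a \<in> fst ` set us" using e by (rule set_mp[rotated])
      thus ?thesis by (rule evU[OF a])
    qed
  qed
  moreover have "even_walk U us \<and> even_walk V vs \<and> snd (hd us) = snd s \<and> hd vs = s"
      if tele: "telescoping U"
  proof -
    have "even (cross_count U us y)" for y
      by (rule even_cross_count[OF wU apU]) (rule evU, simp_all)
    hence snd_eq: "snd (last us) = snd (hd us)"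
      using telescoping_cross_count[OF tele wU, of "snd (hd us)"] by simp
    have "last us = hd us" using snd_eq T(4) hdu lastu by (simp add: prod_eq_iff)
    have sv: "hd vs = s" using stepT snd_eq sndu T(5) hdv by (auto simp: prod_eq_iff)
    have "last vs = s" using closed vs by (simp add: ss)
    have BB: "snd x = snd s" if "x \<in> set us" "y \<in> set vs" "snd x = snd y" for x y
    proof -
      have "snd (?S ! T) = snd (?S ! 0)" using sv hdv by simp
      from tight_return_split_snd[OF tight T(2) this] show ?thesis
        using set_us[OF that(1)] set_vs[OF that(2)] that(3) by (metis nth_Cons_0)
    qed
    have either: "edge_mult U us e = 0 \<or> edge_mult V vs e = 0" for e
    proof (rule ccontr)
      assume "\<not> ?thesis"
      hence nz: "edge_mult U us e \<noteq> 0" "edge_mult V vs e \<noteq> 0" by auto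
      have noA: "a \<notin> fst ` set us" if "a \<in> e" for a using V0[OF that] nz by blast
      hence "\<not> (e \<noteq> {} \<and> e \<subseteq> fst ` set us)" "\<not> (\<exists>a\<in>fst ` set us. \<exists>b\<in>snd ` set us. e = {a, b})"
        by blast+
      hence U2: "card e = 2" "e \<subseteq> snd ` set us" using edge_mult_cases[OF wU nz(1)] by blast+
      have "e \<inter> fst ` set vs = {}" using U2(2) ABs by blast
      moreover have "e \<noteq> {}" using U2(1) by auto
      ultimately have "e \<subseteq> snd ` set vs" using edge_mult_cases[OF wV nz(2)] by blast
      hence "e \<subseteq> {snd s}" using U2(2) BB by (smt (verit) imageE insertI1 subset_iff)
      hence "card e \<le> 1" using card_mono[of "{snd s}" e] by simp
      thus False using U2(1) by simp
    qed
    have "even (edge_mult U us e) \<and> even (edge_mult V vs e)" for e using either[of e] total[of e]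
        by (elim disjE) simp_all
    thus ?thesis using wU wV \<open>last us = hd us\<close> sv \<open>last vs = s\<close> sndu
      by (simp add: even_walk_def closed_walk_altdef)
  qed
  ultimately show ?thesis using that w ss lu vs by blast
qed

section \<open>Counting even walks with labels from an initial segment\<close>

lemma even_walk_altdef:
  "even_walk w ss \<longleftrightarrow> walk w ss \<and> last ss = hd ss \<and> (\<forall>e. even (edge_mult w ss e))"
  by (simp add: even_walk_def closed_walk_altdef)

lemma verts_append [simp]: "verts (us @ vs) = verts us \<union> verts vs"
  and verts_Cons [simp]: "verts (s # ss) = ends s \<union> verts ss"
  and finite_verts [simp]: "finite (verts ss)"
  by (simp_all add: verts_def)

lemma ends_hd_subset: "ss \<noteq> [] \<Longrightarrow> ends (hd ss) \<subseteq> verts ss"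
  by (cases ss) simp_all

definition even_walks :: "nat \<Rightarrow> letter list \<Rightarrow> nat \<Rightarrow> nat \<Rightarrow> nat state list set" where
  "even_walks n w u v = {ss. even_walk w ss \<and> hd ss = (u, v) \<and> verts ss \<subseteq> {1..n}}"

lemma finite_bounded_walks: "finite {ss :: nat state list. length ss = L \<and> verts ss \<subseteq> {1..n}}"
proof (rule finite_subset)
  show "{ss :: nat state list. length ss = L \<and> verts ss \<subseteq> {1..n}} \<subseteq>
      {ss. set ss \<subseteq> {1..n} \<times> {1..n} \<and> length ss = L}"
    by (auto simp: verts_def ends_def)
  show "finite {ss :: nat state list. set ss \<subseteq> {1..n} \<times> {1..n} \<and> length ss = L}"
    by (rule finite_lists_length_eq) simp
qed

lemma finite_even_walks [simp]: "finite (even_walks n w u v)"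
  by (rule finite_subset[OF _ finite_bounded_walks[of "Suc (length w)" n]])
     (auto simp: even_walks_def even_walk_altdef walk_length)

text \<open>A list of states with fewer than \<open>h\<close> vertices outside \<open>ks\<close> is determined
    by these vertices (padded to a list
of length \<open>h - 1\<close>) and by a word of positions whose number of values does not depend on \<open>n\<close>. The
    factor
\<open>n\<close> on the left makes the statement uniform in \<open>h\<close>, including \<open>h = 0\<close>.\<close>

lemma card_few_vertices:
  assumes "length ks \<le> 3"
  shows "card {ss :: nat state list. length ss = L \<and> verts ss \<subseteq> {1..n} \<and>
      card (verts ss - set ks) < h} * n
    \<le> (h + 3) ^ (2 * L) * n ^ h" (is "card ?X * n \<le> _")
proof (cases "h = 0 \<or> n = 0")
  case True
  thus ?thesis by auto
next
  case False
  then obtain h' where h: "h = Suc h'" and n: "1 \<le> n" by (cases h) auto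
  let ?N = "h' + length ks"
  define A where "A = {ys. set ys \<subseteq> {1..n} \<and> length ys = h'}"
  define B where "B = {is. set is \<subseteq> {..<?N} \<times> {..<?N} \<and> length is = L}"
  define F where "F = (\<lambda>(ys, is). map (\<lambda>(a, b). ((ys @ ks) ! a, (ys @ ks) ! b)) is)"
  have finAB: "finite A" "finite B" unfolding A_def B_def by (intro finite_lists_length_eq; simp)+
  have "?X \<subseteq> F ` (A \<times> B)"
  proof
    fix ss assume "ss \<in> ?X"
    hence ss: "length ss = L" "verts ss \<subseteq> {1..n}" "card (verts ss - set ks) \<le> h'" using h by auto
    obtain ys0 where ys0: "set ys0 = verts ss - set ks" "distinct ys0"
      using finite_distinct_list[of "verts ss - set ks"] by auto
    (* Any label serves as padding; 1 is available because n is positive. *)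
    define ys where "ys = ys0 @ replicate (h' - length ys0) 1"
    have "length ys0 \<le> h'" using ys0 ss(3) distinct_card[of ys0] by simp
    hence ys: "ys \<in> A" using ys0 ss(2) n by (auto simp: A_def ys_def)
    have "verts ss \<subseteq> set (ys @ ks)" using ys0 by (auto simp: ys_def)
    moreover have "length (ys @ ks) = ?N" using ys by (simp add: A_def)
    ultimately have "\<forall>v\<in>verts ss. \<exists>a. a < ?N \<and> (ys @ ks) ! a = v"
      by (metis in_set_conv_nth subset_iff)
    then obtain f where f: "\<And>v. v \<in> verts ss \<Longrightarrow> f v < ?N \<and> (ys @ ks) ! f v = v"
      by (auto dest!: bchoice)
    have fv: "fst s \<in> verts ss" "snd s \<in> verts ss" if "s \<in> set ss" for s
      using that by (auto simp: verts_def ends_def)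
    define is' where "is' = map (\<lambda>s. (f (fst s), f (snd s))) ss"
    have "is' \<in> B" using ss(1) f fv by (auto simp: B_def is'_def)
    moreover have "F (ys, is') = ss"
      unfolding F_def is'_def by (simp add: comp_def) (rule map_idI, use f fv in auto)
    ultimately show "ss \<in> F ` (A \<times> B)" using ys by (metis SigmaI imageI)
  qed
  hence "card ?X \<le> card (A \<times> B)" using finAB by (meson card_image_le card_mono finite_SigmaI
      finite_imageI le_trans)
  also have "\<dots> = n ^ h' * (?N * ?N) ^ L"
    by (simp add: A_def B_def card_cartesian_product card_lists_length_eq)
  also have "\<dots> \<le> n ^ h' * ((h + 3) * (h + 3)) ^ L"
    using assms h by (intro mult_left_mono power_mono mult_mono) auto
  also have "\<dots> = n ^ h' * (h + 3) ^ (2 * L)" by (simp add: power_mult power2_eq_square)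
  finally have "card ?X * n \<le> n ^ h' * (h + 3) ^ (2 * L) * n" by (rule mult_right_mono) simp
  thus ?thesis using h by (simp add: algebra_simps)
qed

lemma even_walk_relabel:
  fixes p :: "'a \<Rightarrow> 'b"
  assumes "bij p"
  shows "even_walk w (map (map_prod p p) ss) \<longleftrightarrow> even_walk w ss"
proof -
  have inj: "inj p" using assms by (simp add: bij_is_inj)
  have st: "walk_step l (map_prod p p s) (map_prod p p s') = walk_step l s s'" for l s s'
    using inj by (cases l) (auto simp: inj_eq prod_eq_iff)
  have ed: "walk_edge l (map_prod p p s) (map_prod p p s') = p ` walk_edge l s s'" for l s s'
    by (cases l) auto
  have wk: "walk w (map (map_prod p p) ss) \<longleftrightarrow> walk w ss"
    by (auto simp: walk_def st inj_eq[OF inj])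
  show ?thesis
  proof (cases "walk w ss")
    case True
    have nonempty: "ss \<noteq> []" and len: "length ss = Suc (length w)" using True
        by (auto simp: walk_def)
    have hl: "last (map (map_prod p p) ss) = hd (map (map_prod p p) ss) \<longleftrightarrow> last ss = hd ss"
      using nonempty by (auto simp: last_map hd_map prod_eq_iff inj_eq[OF inj])
    have mm: "edge_mult w (map (map_prod p p) ss) (p ` e) = edge_mult w ss e" for e
    proof -
      have "{t. t < length w \<and> edge_at w (map (map_prod p p) ss) t = p ` e} = {t. t < length w \<and>
          edge_at w ss t = e}"
        using len by (auto simp: edge_at_def ed inj_image_eq_iff[OF inj])
      thus ?thesis by (simp add: edge_mult_def)
    qed
    have "(\<forall>e. even (edge_mult w (map (map_prod p p) ss) e)) \<longleftrightarrow> (\<forall>e. even (edge_mult w ss e))"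
    proof (intro iffI allI)
      fix e assume "\<forall>e. even (edge_mult w ss e)"
      moreover have "e = p ` (inv_into UNIV p ` e)" using assms
          by (simp add: image_f_inv_f bij_is_surj)
      ultimately show "even (edge_mult w (map (map_prod p p) ss) e)" using mm by metis
    qed (use mm in metis)
    thus ?thesis using wk hl by (simp add: even_walk_altdef)
  qed (simp add: even_walk_altdef wk)
qed

lemma verts_relabel: "verts (map (map_prod p p) ss) = p ` verts ss"
  by (auto simp: verts_def ends_def image_iff)

text \<open>Relabelling the vertices shows that the count does not depend on the starting pair.\<close>

lemma card_even_walks_start:
  assumes "u \<in> {1..n}" "v \<in> {1..n}" "u \<noteq> v"
  shows "card (even_walks n w u v) = card (even_walks n w 1 2)"
proof -
  have n: "2 \<le> n" using assms by auto
  define v' where "v' = Transposition.transpose u 1 v"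
  define p where "p = Transposition.transpose v' 2 \<circ> Transposition.transpose u 1"
  have v': "v' \<in> {1..n}" "v' \<noteq> 1" using assms n by (auto simp: v'_def Transposition.transpose_def)
  have p: "p permutes {1..n}" unfolding p_def
    by (intro permutes_compose permutes_swap_id) (use assms v' n in auto)
  have "p u = 1" "p v = 2" using v' by (auto simp: p_def v'_def Transposition.transpose_def)
  have bij: "bij p" using p by (rule permutes_bij)
  let ?f = "map (map_prod p p)"
  have "?f ` even_walks n w u v = even_walks n w 1 2"
  proof (intro equalityI subsetI)
    fix ss assume "ss \<in> ?f ` even_walks n w u v"
    then obtain ss' where s: "ss = ?f ss'" "ss' \<in> even_walks n w u v" by auto
    hence "ss' \<noteq> []" by (auto simp: even_walks_def even_walk_altdef walk_def)
    moreover have "p ` verts ss' \<subseteq> {1..n}" using s permutes_image[OF p]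
        by (auto simp: even_walks_def)
    ultimately show "ss \<in> even_walks n w 1 2" using s \<open>p u = 1\<close> \<open>p v = 2\<close>
      by (auto simp: even_walks_def even_walk_relabel[OF bij] verts_relabel hd_map)
  next
    fix ss assume ss: "ss \<in> even_walks n w 1 2"
    define q where "q = inv_into UNIV p"
    let ?g = "map (map_prod q q)"
    have "ss = ?f (?g ss)" using permutes_inverses(1)[OF p]
        by (simp add: q_def comp_def map_prod_def case_prod_unfold)
    moreover have "?g ss \<in> even_walks n w u v"
    proof -
      have bi: "bij q" unfolding q_def using bij by (rule bij_imp_bij_inv)
      have "q 1 = u" "q 2 = v" using \<open>p u = 1\<close> \<open>p v = 2\<close> permutes_inverses(2)[OF p]
          unfolding q_def by metis+
      moreover have "ss \<noteq> []" using ss by (auto simp: even_walks_def even_walk_altdef walk_def)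
      moreover have "q ` verts ss \<subseteq> {1..n}"
        using ss permutes_image[OF permutes_inv[OF p]] unfolding q_def
            by (auto simp: even_walks_def)
      ultimately show ?thesis using ss
        by (auto simp: even_walks_def even_walk_relabel[OF bi] verts_relabel hd_map)
    qed
    ultimately show "ss \<in> ?f ` even_walks n w u v" by blast
  qed
  moreover have "inj_on ?f (even_walks n w u v)"
    using bij_is_inj[OF bij] by (intro inj_on_subset[OF inj_mapI[OF prod.inj_map]]) auto
  ultimately show ?thesis using card_image[of ?f "even_walks n w u v"] by simp
qed

lemma moves_append [simp]: "moves (u @ v) = moves u + moves v"
  and moves_Cons [simp]: "moves (l # v) = (if l = Cross then 0 else 1) + moves v"
  and moves_Nil [simp]: "moves [] = 0"
  by (simp_all add: moves_def)

lemma card_verts_diff_start: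
  assumes "even_walk w ss" "hd ss = (u, v)"
  shows "card (verts ss) = 2 + card (verts ss - {u, v})"
proof -
  have wk: "walk w ss" using assms(1) by (simp add: even_walk_altdef)
  have "ss \<noteq> []" by (rule walk_nonempty[OF wk])
  hence "(u, v) \<in> set ss" using assms(2) hd_in_set by metis
  hence "u \<noteq> v" using wk by (auto simp: walk_def)
  have "{u, v} \<subseteq> verts ss" using ends_hd_subset[OF \<open>ss \<noteq> []\<close>] assms by (simp add: ends_def)
  thus ?thesis using \<open>u \<noteq> v\<close> card_Diff_subset[of "{u, v}" "verts ss"] card_mono[of "verts ss"
      "{u, v}"] by simp
qed

text \<open>Walks that are not tight have fewer vertices and are therefore negligible.\<close>

lemma card_not_tight:
  assumes "even (moves w)"
  shows "card {ss \<in> even_walks n w u v. \<not> tight_walk w ss} * n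
    \<le> (moves w div 2 + 3) ^ (2 * Suc (length w)) * n ^ (moves w div 2)"
proof -
  have "{ss \<in> even_walks n w u v. \<not> tight_walk w ss} \<subseteq> {ss. length ss = Suc (length w) \<and>
      verts ss \<subseteq> {1..n} \<and> card (verts ss - set [u, v]) < moves w div 2}"
  proof
    fix ss assume "ss \<in> {ss \<in> even_walks n w u v. \<not> tight_walk w ss}"
    hence ss: "even_walk w ss" "hd ss = (u, v)" "verts ss \<subseteq> {1..n}" "2 * card (verts ss) \<noteq> 4 +
        moves w"
      by (auto simp: even_walks_def tight_walk_def)
    have "2 * card (verts ss) < 4 + moves w" using even_walk_card_le[OF ss(1)] ss(4) by simp
    moreover obtain m where "moves w = 2 * m" using assms by (rule evenE)
    ultimately have "card (verts ss - {u, v}) < moves w div 2"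
      using card_verts_diff_start[OF ss(1,2)] by simp
    thus "ss \<in> {ss. length ss = Suc (length w) \<and>
      verts ss \<subseteq> {1..n} \<and> card (verts ss - set [u, v]) < moves w div 2}"
      using ss by (simp add: even_walk_altdef walk_length)
  qed
  hence "card {ss \<in> even_walks n w u v. \<not> tight_walk w ss} \<le> card {ss. length ss = Suc (length w) \<and>
      verts ss \<subseteq> {1..n} \<and> card (verts ss - set [u, v]) < moves w div 2}"
    by (intro card_mono finite_subset[OF _ finite_bounded_walks[of "Suc (length w)" n]]) auto
  thus ?thesis by (rule le_trans[OF mult_le_mono1 card_few_vertices]) simp
qed

text \<open>Prescribing one further vertex costs a factor of order \<open>n\<close>.\<close>

lemma card_through_vertex:
  assumes "even (moves w)" "z \<noteq> u" "z \<noteq> v"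
  shows "card {ss \<in> even_walks n w u v. z \<in> verts ss} * n
    \<le> (moves w div 2 + 3) ^ (2 * Suc (length w)) * n ^ (moves w div 2)"
proof -
  have "{ss \<in> even_walks n w u v. z \<in> verts ss} \<subseteq> {ss. length ss = Suc (length w) \<and>
      verts ss \<subseteq> {1..n} \<and> card (verts ss - set [u, v, z]) < moves w div 2}"
  proof
    fix ss assume "ss \<in> {ss \<in> even_walks n w u v. z \<in> verts ss}"
    hence ss: "even_walk w ss" "hd ss = (u, v)" "verts ss \<subseteq> {1..n}" "z \<in> verts ss"
      by (auto simp: even_walks_def)
    have "verts ss - {u, v} = insert z (verts ss - {u, v, z})" using ss(4) assms by auto
    hence "card (verts ss - {u, v}) = Suc (card (verts ss - {u, v, z}))" by simp
    moreover obtain m where "moves w = 2 * m" using assms(1) by (rule evenE)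
    ultimately have "card (verts ss - {u, v, z}) < moves w div 2"
      using card_verts_diff_start[OF ss(1,2)] even_walk_card_le[OF ss(1)] by simp
    thus "ss \<in> {ss. length ss = Suc (length w) \<and>
      verts ss \<subseteq> {1..n} \<and> card (verts ss - set [u, v, z]) < moves w div 2}"
      using ss by (simp add: even_walk_altdef walk_length)
  qed
  hence "card {ss \<in> even_walks n w u v. z \<in> verts ss} \<le> card {ss. length ss = Suc (length w) \<and>
      verts ss \<subseteq> {1..n} \<and> card (verts ss - set [u, v, z]) < moves w div 2}"
    by (intro card_mono finite_subset[OF _ finite_bounded_walks[of "Suc (length w)" n]]) auto
  thus ?thesis by (rule le_trans[OF mult_le_mono1 card_few_vertices]) simp
qed

text \<open>The converse of \<open>tight_decomposition\<close>: the edge from \<open>u\<close> to \<open>x\<close> is used once in each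
    direction, so evenness of
the parts is enough.\<close>

lemma glue_even_walk:
  assumes U: "even_walk U us" "hd us = (x, v)" and V: "even_walk V vs" "hd vs = (u, v)"
    and "x \<noteq> u" "u \<noteq> v"
  shows "even_walk (First # U @ First # V) ((u, v) # us @ vs)"
proof -
  have ne: "us \<noteq> []" "vs \<noteq> []" "length us = Suc (length U)" and wk: "walk U us" "walk V vs"
    using U V by (auto simp: even_walk_altdef walk_def)
  have ends: "last us = (x, v)" "last vs = (u, v)" using U V by (auto simp: even_walk_altdef)
  have hd: "hd (us @ vs) = (x, v)" using ne U by simp
  have "walk (First # U @ First # V) ((u, v) # us @ vs)"
    using walk_Cons[of "us @ vs" First "U @ First # V"
        "(u, v)"] walk_append[OF ne(3,2), of First V] ne wk hd ends V(2) assms(5,6)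
    by auto
  moreover have "even (edge_mult (First # U @ First # V) ((u, v) # us @ vs) e)" for e
  proof -
    have "edge_mult (First # U @ First # V) ((u, v) # us @ vs) e =
      (if {u, x} = e then 1 else 0) + (edge_mult U us e + (if {x, u} = e then 1 else 0) +
          edge_mult V vs e)"
      using edge_mult_Cons[of "us @ vs" First "U @ First # V" "(u, v)"
          e] edge_mult_append[OF ne(3,2), of First V e] ne hd ends V(2)
      by simp
    moreover have "even (edge_mult U us e)" "even (edge_mult V vs e)" using U V
        by (auto simp: even_walk_altdef)
    ultimately show ?thesis by (simp add: insert_commute)
  qed
  ultimately show ?thesis using ne ends by (simp add: even_walk_altdef)
qed

text \<open>The normalization is the number of choices
    for the vertices outside the starting pair of a tight walk.\<close>

definition walk_limit :: "letter list \<Rightarrow> real \<Rightarrow> bool" where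
  "walk_limit w c \<longleftrightarrow>
     (\<lambda>n. real (card (even_walks n w 1 2)) / real n ^ (moves w div 2)) \<longlonglongrightarrow> c"

lemma tight_even_walks_subset:
  assumes splits: "{(U, V). w = U @ First # V \<and> even (length (filter (\<lambda>l. l = First) U))} =
      (\<lambda>i. (U i, V i)) ` I"
    and tele: "\<And>i. i \<in> I \<Longrightarrow> telescoping (U i)"
  shows "{ss \<in> even_walks n (First # w) 1 2. tight_walk (First # w) ss} \<subseteq>
    (\<Union>i\<in>I. \<Union>x\<in>{1..n} - {1, 2}. (\<lambda>(us, vs). (1, 2) # us @ vs) ` (even_walks n (U i) x 2 \<times>
        even_walks n (V i) 1 2))"
proof
  fix ss assume "ss \<in> {ss \<in> even_walks n (First # w) 1 2. tight_walk (First # w) ss}"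
  hence ss: "even_walk (First # w) ss" "hd ss = (1, 2)" "verts ss \<subseteq> {1..n}"
      "tight_walk (First # w) ss"
    by (auto simp: even_walks_def)
  have wk: "walk (First # w) ss" using ss(1) by (simp add: even_walk_altdef)
  obtain ss' where ss': "ss = (1, 2) # ss'" "length ss' = Suc (length w)"
    using walk_length[OF wk] ss(2) by (cases ss) auto
  from tight_decomposition[OF ss(4)[unfolded ss'(1)]] obtain U' V' us vs where
    D: "w = U' @ First # V'" "ss' = us @ vs" "length us = Suc (length U')" "vs \<noteq> []"
    "even (length (filter (\<lambda>l. l = First) U'))"
    "telescoping U' \<Longrightarrow> even_walk U' us \<and> even_walk V' vs \<and> snd (hd us) = snd (1::nat, 2::nat) \<and>
        hd vs = (1, 2)"
    by metis
  have "(U', V') \<in> (\<lambda>i. (U i, V i)) ` I" using D splits by blast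
  then obtain i where i: "i \<in> I" "U' = U i" "V' = V i" by auto
  have E: "even_walk (U i) us" "even_walk (V i) vs" "snd (hd us) = 2" "hd vs = (1, 2)"
    using D(6) tele[OF i(1)] i by auto
  have us: "us \<noteq> []" using D(3) by auto
  have "walk_step First (1, 2) (hd us)" and wk': "walk w ss'"
    using wk walk_Cons[of ss' First w "(1, 2)"] us D(2) by (auto simp: ss')
  moreover have "fst (hd us) \<noteq> snd (hd us)" using E(1) us by (auto simp: even_walk_altdef walk_def)
  moreover have "fst (hd us) \<in> verts us" using ends_hd_subset[OF us] by (auto simp: ends_def)
  ultimately have x: "fst (hd us) \<in> {1..n} - {1, 2}" using ss(3) E(3) by (auto simp: ss' D(2))
  have "(us, vs) \<in> even_walks n (U i) (fst (hd us)) 2 \<times> even_walks n (V i) 1 2"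
    using E ss(3) by (auto simp: even_walks_def ss' D(2) prod_eq_iff)
  moreover have "ss = (\<lambda>(us, vs). (1, 2) # us @ vs) (us, vs)" by (simp add: ss' D(2))
  ultimately show "ss \<in> (\<Union>i\<in>I. \<Union>x\<in>{1..n} - {1, 2}.
      (\<lambda>(us, vs). (1, 2) # us @ vs) ` (even_walks n (U i) x 2 \<times> even_walks n (V i) 1 2))"
    using i(1) x by blast
qed

lemma card_even_walks_le:
  assumes splits: "{(U, V). w = U @ First # V \<and> even (length (filter (\<lambda>l. l = First) U))} =
      (\<lambda>i. (U i, V i)) ` I"
    and fin: "finite I" and tele: "\<And>i. i \<in> I \<Longrightarrow> telescoping (U i)" and n: "2 \<le> n"
  shows "card (even_walks n (First # w) 1 2) \<le>
    card {ss \<in> even_walks n (First # w) 1 2. \<not> tight_walk (First # w) ss} +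
    (\<Sum>i\<in>I. (n - 2) * (card (even_walks n (U i) 1 2) * card (even_walks n (V i) 1 2)))"
proof -
  let ?E = "even_walks n (First # w) 1 2"
  let ?X = "{1..n} - {1, 2}"
  let ?G = "\<lambda>(us, vs). (1::nat, 2::nat) # us @ vs"
  have cX: "card ?X = n - 2" using n by (subst card_Diff_subset) auto
  have "card {ss \<in> ?E. tight_walk (First # w) ss} \<le>
      card (\<Union>i\<in>I. \<Union>x\<in>?X. ?G ` (even_walks n (U i) x 2 \<times> even_walks n (V i) 1 2))"
    using fin tight_even_walks_subset[OF splits tele] by (intro card_mono) auto
  also have "\<dots> \<le> (\<Sum>i\<in>I. card (\<Union>x\<in>?X. ?G ` (even_walks n (U i) x 2 \<times> even_walks n (V i) 1 2)))"
    by (rule card_UN_le[OF fin])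
  also have "\<dots> \<le> (\<Sum>i\<in>I. \<Sum>x\<in>?X. card (?G ` (even_walks n (U i) x 2 \<times> even_walks n (V i) 1 2)))"
    by (intro sum_mono card_UN_le) simp
  also have "\<dots> \<le> (\<Sum>i\<in>I. \<Sum>x\<in>?X. card (even_walks n (U i) x 2) * card (even_walks n (V i) 1 2))"
    by (intro sum_mono order_trans[OF card_image_le])
        (simp_all only: card_cartesian_product finite_cartesian_product finite_even_walks
        order_refl)
  also have "\<dots> = (\<Sum>i\<in>I. \<Sum>x\<in>?X. card (even_walks n (U i) 1 2) * card (even_walks n (V i) 1 2))"
  proof (intro sum.cong refl)
    fix i x assume "i \<in> I" "x \<in> ?X"
    thus "card (even_walks n (U i) x 2) * card (even_walks n (V i) 1 2) =
        card (even_walks n (U i) 1 2) * card (even_walks n (V i) 1 2)"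
      using card_even_walks_start[of x n 2 "U i"] n by simp
  qed
  also have "\<dots> = (\<Sum>i\<in>I. (n - 2) * (card (even_walks n (U i) 1 2) * card (even_walks n (V i) 1 2)))"
    by (simp only: sum_constant cX of_nat_id)
  finally have "card {ss \<in> ?E. tight_walk (First # w) ss} \<le> \<dots>" .
  moreover have "?E = {ss \<in> ?E. \<not> tight_walk (First # w) ss} \<union>
      {ss \<in> ?E. tight_walk (First # w) ss}" by blast
  hence "card ?E \<le> card {ss \<in> ?E. \<not> tight_walk (First # w) ss} +
      card {ss \<in> ?E. tight_walk (First # w) ss}"
    using card_Un_le[of "{ss \<in> ?E. \<not> tight_walk (First # w) ss}"
        "{ss \<in> ?E. tight_walk (First # w) ss}"] by argo
  ultimately show ?thesis by linarith
qed

text \<open>Gluing is injective if the part \<open>us\<close> avoids the starting vertex 1 of the first walker,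
    because the cut is then
the first return to this vertex.\<close>

lemma card_even_walks_ge:
  assumes splits: "{(U, V). w = U @ First # V \<and> even (length (filter (\<lambda>l. l = First) U))} =
      (\<lambda>i. (U i, V i)) ` I"
    and inj: "inj_on (\<lambda>i. (U i, V i)) I"
    and fin: "finite I" and n: "2 \<le> n"
  shows "(\<Sum>i\<in>I. \<Sum>x\<in>{1..n} - {1, 2}. card {us \<in> even_walks n (U i) x 2. 1 \<notin> verts us} * card
      (even_walks n (V i) 1 2))
    \<le> card (even_walks n (First # w) 1 2)"
proof -
  let ?X = "{1..n} - {1::nat, 2}"
  define good where "good i x = {us \<in> even_walks n (U i) x 2. 1 \<notin> verts us}" for i x
  define D where "D = (SIGMA i:I. SIGMA x:?X. good i x \<times> even_walks n (V i) 1 2)"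
  define \<Phi> where "\<Phi> = (\<lambda>(i::'a, x::nat, us, vs). (1::nat, 2::nat) # us @ vs)"
  have finG: "finite (good i x)" for i x by (simp add: good_def)
  have w: "w = U i @ First # V i" if "i \<in> I" for i using splits that by blast
  have cD: "card D = (\<Sum>i\<in>I. \<Sum>x\<in>?X. card (good i x) * card (even_walks n (V i) 1 2))"
    unfolding D_def using fin finG by (simp add: card_SigmaI card_cartesian_product finite_SigmaI)
  have "\<Phi> ` D \<subseteq> even_walks n (First # w) 1 2"
  proof
    fix ss assume "ss \<in> \<Phi> ` D"
    then obtain q where q: "q \<in> D" "ss = \<Phi> q" by blast
    obtain i x us vs where "q = (i, x, us, vs)" by (cases q) auto
    with q have d: "i \<in> I" "x \<in> ?X" "us \<in> even_walks n (U i) x 2" "vs \<in> even_walks n (V i) 1 2"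
      "ss = (1, 2) # us @ vs" by (simp_all add: D_def \<Phi>_def good_def)
    have "even_walk (First # w) ss" unfolding w[OF d(1)] d(5)
      by (rule glue_even_walk[of _ _ x]) (use d in \<open>auto simp: even_walks_def\<close>)
    thus "ss \<in> even_walks n (First # w) 1 2" using d n by (auto simp: even_walks_def ends_def)
  qed
  moreover have "inj_on \<Phi> D"
  proof (rule inj_onI)
    fix a b assume ab: "a \<in> D" "b \<in> D" "\<Phi> a = \<Phi> b"
    obtain i x us vs where a: "a = (i, x, us, vs)" by (cases a) auto
    obtain j y us' vs' where b: "b = (j, y, us', vs')" by (cases b) auto
    have A: "i \<in> I" "us \<in> good i x" "vs \<in> even_walks n (V i) 1 2"
      and B: "j \<in> I" "us' \<in> good j y" "vs' \<in> even_walks n (V j) 1 2" using ab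
          by (auto simp: a b D_def)
    have eq: "us @ vs = us' @ vs'" using ab(3) by (simp add: a b \<Phi>_def)
    (* The cut is recovered as the first time after the start at which the first walker is at 1. *)
    have tw: "takeWhile (\<lambda>s. fst s \<noteq> 1) (us @ vs) = us"
        if "us \<in> good i x" "vs \<in> even_walks n (V i) 1 2" for i x us vs
    proof -
      have "\<forall>s\<in>set us. fst s \<noteq> 1" using that(1) by (auto simp: good_def verts_def ends_def)
      moreover have "vs \<noteq> []" "hd vs = (1, 2)" using that(2)
          by (auto simp: even_walks_def even_walk_altdef walk_def)
      ultimately show ?thesis by (cases vs) (auto simp: takeWhile_append2)
    qed
    have us: "us = us'" using tw[OF A(2,3)] tw[OF B(2,3)] eq by simp
    hence vs: "vs = vs'" using eq by simp
    have "length us = Suc (length (U i))" "length us' = Suc (length (U j))"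
        and h: "hd us = (x, 2)" "hd us' = (y, 2)"
      using A(2) B(2) by (auto simp: good_def even_walks_def even_walk_altdef walk_length)
    hence "length (U i) = length (U j)" using us by simp
    hence "U i = U j \<and> V i = V j" using w[OF A(1)] w[OF B(1)]
        by (metis append_eq_append_conv list.inject)
    hence "i = j" using inj A(1) B(1) by (auto simp: inj_on_def)
    thus "a = b" using us vs h by (simp add: a b)
  qed
  ultimately have "card D \<le> card (even_walks n (First # w) 1 2)" by (intro card_inj_on_le) auto
  thus ?thesis by (simp add: cD good_def)
qed

lemma real_le_div_of_mult_le:
  assumes "a * n \<le> K * n ^ h" "0 < n"
  shows "real a / real n ^ h \<le> real K / real n"
proof -
  have "real (a * n) \<le> real (K * n ^ h)" using assms(1) by (simp only: of_nat_le_iff)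
  thus ?thesis using assms(2) by (simp add: field_simps)
qed

text \<open>The recursion for the limits: the upper bound decomposes the tight walks, the lower bound
    glues. The vertex
reached by the first step can be chosen in \<open>n - 2\<close> ways, which accounts for the two moves removed
    by the cut.\<close>

theorem walk_limit_First:
  assumes splits: "{(U, V). w = U @ First # V \<and> even (length (filter (\<lambda>l. l = First) U))} =
      (\<lambda>i. (U i, V i)) ` I"
    and inj: "inj_on (\<lambda>i. (U i, V i)) I" and fin: "finite I"
    and tele: "\<And>i. i \<in> I \<Longrightarrow> telescoping (U i)"
    and ev: "\<And>i. i \<in> I \<Longrightarrow> even (moves (U i))" "\<And>i. i \<in> I \<Longrightarrow> even (moves (V i))"
        "even (moves (First # w))"
    and lim: "\<And>i. i \<in> I \<Longrightarrow> walk_limit (U i) (c i)" "\<And>i. i \<in> I \<Longrightarrow> walk_limit (V i) (d i)"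
  shows "walk_limit (First # w) (\<Sum>i\<in>I. c i * d i)"
proof -
  define h where "h = moves (First # w) div 2"
  define hU where "hU i = moves (U i) div 2" for i
  define hV where "hV i = moves (V i) div 2" for i
  define u where "u i n = real (card (even_walks n (U i) 1 2)) / real n ^ hU i" for i n
  define v where "v i n = real (card (even_walks n (V i) 1 2)) / real n ^ hV i" for i n
  define K where "K = (h + 3) ^ (2 * Suc (length (First # w)))"
  define C where "C i = (hU i + 3) ^ (2 * Suc (length (U i)))" for i
  have hsum: "h = Suc (hU i + hV i)" if "i \<in> I" for i
  proof -
    have "w = U i @ First # V i" using splits that by blast
    hence "moves (First # w) = 2 + moves (U i) + moves (V i)" by simp
    thus ?thesis using ev that by (auto simp: h_def hU_def hV_def elim!: evenE)
  qed
  let ?a = "\<lambda>n. real (card (even_walks n (First # w) 1 2)) / real n ^ h"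
  have r1: "(\<lambda>n. real (n - 2) / real n) \<longlonglongrightarrow> 1"
  proof (rule Lim_transform_eventually)
    show "(\<lambda>n. 1 - 2 / real n) \<longlonglongrightarrow> 1" by real_asymp
    show "\<forall>\<^sub>F n in sequentially. 1 - 2 / real n = real (n - 2) / real n"
      using eventually_ge_at_top[of 2] by eventually_elim (simp add: field_simps of_nat_diff)
  qed
  have ul: "u i \<longlonglongrightarrow> c i" and vl: "v i \<longlonglongrightarrow> d i" if "i \<in> I" for i
    using lim that unfolding walk_limit_def u_def[abs_def] v_def[abs_def] hU_def hV_def by auto
  have K0: "(\<lambda>n. real K / real n) \<longlonglongrightarrow> 0" for K by real_asymp
  have upper: "(\<lambda>n. real K / real n + (\<Sum>i\<in>I. real (n - 2) / real n * (u i n * v i n))) \<longlonglongrightarrow> 0 +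
      (\<Sum>i\<in>I. 1 * (c i * d i))"
    by (intro tendsto_intros K0 r1 ul vl)
  have lower: "(\<lambda>n. \<Sum>i\<in>I. real (n - 2) / real n * ((u i n - real (C i) / real n) * v i n)) \<longlonglongrightarrow>
      (\<Sum>i\<in>I. 1 * ((c i - 0) * d i))"
    by (intro tendsto_intros K0 r1 ul vl)
  have le: "?a n \<le> real K / real n + (\<Sum>i\<in>I. real (n - 2) / real n * (u i n * v i n))"
      if n: "2 \<le> n" for n
  proof -
    let ?N = "card {ss \<in> even_walks n (First # w) 1 2. \<not> tight_walk (First # w) ss}"
    have "real (card (even_walks n (First # w) 1 2)) \<le> real (?N +
       (\<Sum>i\<in>I. (n - 2) * (card (even_walks n (U i) 1 2) * card (even_walks n (V i) 1 2))))"
      using card_even_walks_le[OF splits fin tele n] by (simp only: of_nat_le_iff)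
    hence "?a n \<le> real ?N / real n ^ h +
       (\<Sum>i\<in>I. real (n - 2) * (real (card (even_walks n (U i) 1 2)) * real (card (even_walks n (V
           i) 1 2))) / real n ^ h)"
      using n by (simp add: divide_right_mono add_divide_distrib[symmetric]
          sum_divide_distrib[symmetric])
    also have "real ?N / real n ^ h \<le> real K / real n"
      using card_not_tight[OF ev(3), of n 1 2] n unfolding K_def h_def
          by (intro real_le_div_of_mult_le) auto
    also have "(\<Sum>i\<in>I. real (n - 2) * (real (card (even_walks n (U i) 1 2)) * real (card
        (even_walks n (V i) 1 2))) / real n ^ h)
       = (\<Sum>i\<in>I. real (n - 2) / real n * (u i n * v i n))"
      by (intro sum.cong refl) (simp add: hsum u_def v_def power_add)
    finally show ?thesis by simp
  qed
  have ge: "(\<Sum>i\<in>I. real (n - 2) / real n * ((u i n - real (C i) / real n) * v i n)) \<le> ?a n"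
      if n: "2 \<le> n" for n
  proof -
    let ?X = "{1..n} - {1::nat, 2}"
    define g where "g i x = card {us \<in> even_walks n (U i) x 2. 1 \<notin> verts us}" for i x
    have cX: "card ?X = n - 2" using n by (subst card_Diff_subset) auto
    have gle: "u i n - real (C i) / real n \<le> real (g i x) / real n ^ hU i" if "i \<in> I" "x \<in> ?X"
        for i x
    proof -
      let ?B = "{us \<in> even_walks n (U i) x 2. 1 \<in> verts us}"
      have "even_walks n (U i) x 2 = {us \<in> even_walks n (U i) x 2. 1 \<notin> verts us} \<union> ?B" by blast
      hence "card (even_walks n (U i) x 2) = g i x + card ?B"
        unfolding g_def by (metis (no_types, lifting) card_Un_disjoint disjoint_iff finite_Un
            finite_even_walks mem_Collect_eq)
      moreover have "card (even_walks n (U i) x 2) = card (even_walks n (U i) 1 2)"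
        using that n by (intro card_even_walks_start) auto
      moreover have "real (card ?B) / real n ^ hU i \<le> real (C i) / real n"
        using card_through_vertex[OF ev(1)[OF that(1)], of 1 x 2 n] that n
        unfolding C_def hU_def by (intro real_le_div_of_mult_le) auto
      ultimately show ?thesis by (simp add: u_def add_divide_distrib)
    qed
    have "(\<Sum>i\<in>I. real (n - 2) / real n * ((u i n - real (C i) / real n) * v i n)) =
        (\<Sum>i\<in>I. \<Sum>x\<in>?X. (u i n - real (C i) / real n) * v i n / real n)"
      unfolding sum_constant cX by simp
    also have "\<dots> \<le> (\<Sum>i\<in>I. \<Sum>x\<in>?X. real (g i x) / real n ^ hU i * v i n / real n)"
      using gle by (intro sum_mono divide_right_mono mult_right_mono) (auto simp: v_def)
    also have "\<dots> = (\<Sum>i\<in>I. \<Sum>x\<in>?X. real (g i x * card (even_walks n (V i) 1 2)) / real n ^ h)"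
      by (intro sum.cong refl) (simp add: hsum v_def power_add)
    also have "\<dots> = real (\<Sum>i\<in>I. \<Sum>x\<in>?X. g i x * card (even_walks n (V i) 1 2)) / real n ^ h"
      by (simp only: of_nat_sum sum_divide_distrib)
    also have "\<dots> \<le> ?a n"
    proof (rule divide_right_mono)
      show "real (\<Sum>i\<in>I. \<Sum>x\<in>?X. g i x * card (even_walks n (V i) 1 2)) \<le>
          real (card (even_walks n (First # w) 1 2))"
        unfolding g_def of_nat_le_iff by (rule card_even_walks_ge[OF splits inj fin n])
    qed simp
    finally show ?thesis .
  qed
  have "?a \<longlonglongrightarrow> (\<Sum>i\<in>I. c i * d i)"
  proof (rule real_tendsto_sandwich)
    show "\<forall>\<^sub>F n in sequentially. (\<Sum>i\<in>I. real (n - 2) / real n * ((u i n - real (C i) / real n) * v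
        i n)) \<le> ?a n"
      using eventually_ge_at_top[of 2] by eventually_elim (rule ge)
    show "\<forall>\<^sub>F n in sequentially. ?a n \<le> real K / real n +
        (\<Sum>i\<in>I. real (n - 2) / real n * (u i n * v i n))"
      using eventually_ge_at_top[of 2] by eventually_elim (rule le)
  qed (use upper lower in simp_all)
  thus ?thesis by (simp add: walk_limit_def h_def)
qed

section \<open>The words of the powers of the Gram matrix\<close>

lemma verts_Nil [simp]: "verts [] = {}"
  by (simp add: verts_def)

lemma walk_limit_swap:
  assumes "walk_limit w c"
  shows "walk_limit (map swap_letter w) c"
proof -
  have eq: "card (even_walks n (map swap_letter w) 1 2) = card (even_walks n w 1 2)" if n: "2 \<le> n"
      for n
  proof -
    have "map prod.swap ` even_walks n w 2 1 = even_walks n (map swap_letter w) 1 2"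
    proof (intro equalityI subsetI)
      fix ss assume "ss \<in> map prod.swap ` even_walks n w 2 1"
      then obtain ss' where s: "ss = map prod.swap ss'" "ss' \<in> even_walks n w 2 1" by blast
      hence "ss' \<noteq> []" by (auto simp: even_walks_def even_walk_altdef walk_def)
      thus "ss \<in> even_walks n (map swap_letter w) 1 2"
        using s by (simp add: even_walks_def even_walk_swap verts_swap hd_map)
    next
      fix ss assume s: "ss \<in> even_walks n (map swap_letter w) 1 2"
      have eq: "ss = map prod.swap (map prod.swap ss)" by (simp add: comp_def)
      have "ss \<noteq> []" using s by (auto simp: even_walks_def even_walk_altdef walk_def)
      moreover have "even_walk w (map prod.swap ss)"
        using s even_walk_swap[of w "map prod.swap ss"] eq by (simp add: even_walks_def)
      ultimately have "map prod.swap ss \<in> even_walks n w 2 1"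
        using s by (simp add: even_walks_def verts_swap hd_map)
      thus "ss \<in> map prod.swap ` even_walks n w 2 1" using eq by (rule image_eqI[rotated])
    qed
    moreover have "inj_on (map prod.swap) (even_walks n w 2 1)"
      by (rule inj_on_subset[OF inj_mapI]) auto
    ultimately have "card (even_walks n (map swap_letter w) 1 2) = card (even_walks n w 2 1)"
      using card_image[of "map prod.swap" "even_walks n w 2 1"] by simp
    thus ?thesis using card_even_walks_start[of 2 n 1 w] n by simp
  qed
  have "\<forall>\<^sub>F n in sequentially. real (card (even_walks n w 1 2)) / real n ^ (moves w div 2) =
      real (card (even_walks n (map swap_letter w) 1 2)) / real n ^ (moves (map swap_letter w) div
          2)"
    using eventually_ge_at_top[of 2] by eventually_elim (simp only: eq moves_swap)
  thus ?thesis using assms unfolding walk_limit_def by (rule Lim_transform_eventually[rotated])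
qed

lemma even_walk_Cross_Cons:
  assumes "ss \<noteq> []"
  shows "even_walk (Cross # w) (s # ss) \<longleftrightarrow> fst s \<noteq> snd s \<and> hd ss = s \<and> last ss = s \<and> walk w ss \<and>
    (\<forall>e. even ((if ends s = e then 1 else 0) + edge_mult w ss e))"
  using assms by (auto simp: even_walk_altdef walk_Cons edge_mult_Cons ends_def)

lemma even_walk_Cross_snoc:
  assumes "ss \<noteq> []"
  shows "even_walk (w @ [Cross]) (ss @ [s]) \<longleftrightarrow> fst s \<noteq> snd s \<and> hd ss = s \<and> last ss = s \<and> walk w ss \<and>
    (\<forall>e. even ((if ends s = e then 1 else 0) + edge_mult w ss e))"
proof (cases "walk w ss")
  case True
  have len: "length ss = Suc (length w)" by (rule walk_length[OF True])
  have "edge_mult [] [s] e = 0" for e by (simp add: edge_mult_def)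
  thus ?thesis
    using True walk_append[OF len, of "[s]" Cross "[]"] edge_mult_append[OF len, of "[s]"
        Cross "[]"] assms
    by (auto simp: even_walk_altdef walk_Nil ends_def add.commute)
next
  case False
  have "\<not> walk (w @ [Cross]) (ss @ [s])"
  proof
    assume W: "walk (w @ [Cross]) (ss @ [s])"
    hence "length ss = Suc (length w)" using walk_length[OF W] by simp
    thus False using walk_append[of ss w "[s]" Cross "[]"] W False by simp
  qed
  thus ?thesis using False by (simp add: even_walk_altdef)
qed

lemma even_walk_Cross_rotate:
  "ss \<noteq> [] \<Longrightarrow> even_walk (w @ [Cross]) (ss @ [s]) \<longleftrightarrow> even_walk (Cross # w) (s # ss)"
  using even_walk_Cross_Cons[of ss w s] even_walk_Cross_snoc[of ss w s] by blast

lemma even_walk_Cross_hd: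
  assumes "even_walk (Cross # w) (s # ss)" "ss \<noteq> []"
  shows "hd ss = s"
  using even_walk_Cross_Cons[OF assms(2), of w s] assms(1) by blast

text \<open>Recording the edge between the walkers does not move them, so in a closed walk this step may
    be done at the end
instead of the beginning.\<close>

lemma card_even_walks_Cross_rotate:
  "card (even_walks n (Cross # w) u v) = card (even_walks n (w @ [Cross]) u v)"
proof -
  have "rotate1 ` even_walks n (Cross # w) u v = even_walks n (w @ [Cross]) u v"
  proof (intro equalityI subsetI)
    fix ss assume "ss \<in> rotate1 ` even_walks n (Cross # w) u v"
    then obtain ss' where s: "ss = rotate1 ss'" "ss' \<in> even_walks n (Cross # w) u v" by blast
    hence "length ss' = Suc (Suc (length w))"
        by (auto simp: even_walks_def even_walk_altdef walk_length)
    then obtain x xs where x: "ss' = x # xs" "xs \<noteq> []" by (auto simp: length_Suc_conv)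
    thus "ss \<in> even_walks n (w @ [Cross]) u v"
      using s x(2) even_walk_Cross_hd[of w x xs]
      by (auto simp: even_walks_def even_walk_Cross_rotate x(1))
  next
    fix ss assume s: "ss \<in> even_walks n (w @ [Cross]) u v"
    hence len: "length ss = Suc (Suc (length w))"
        by (auto simp: even_walks_def even_walk_altdef walk_length)
    obtain ys y where ys: "ss = ys @ [y]" using len by (cases ss rule: rev_cases) auto
    hence "length ys = Suc (length w)" using len by simp
    hence "ys \<noteq> []" by auto
    note ss = ys this
    have "y # ys \<in> even_walks n (Cross # w) u v"
      using s ss(2) even_walk_Cross_hd[of w y ys]
      by (auto simp: even_walks_def even_walk_Cross_rotate ss(1))
    thus "ss \<in> rotate1 ` even_walks n (Cross # w) u v" using ss
        by (intro image_eqI[of _ _ "y # ys"]) simp_all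
  qed
  moreover have "inj_on rotate1 (even_walks n (Cross # w) u v)"
      by (rule inj_on_subset[OF inj_rotate1]) simp
  ultimately show ?thesis using card_image[of rotate1 "even_walks n (Cross # w) u v"] by simp
qed

text \<open>Two consecutive recordings of the same edge cancel modulo 2.\<close>

lemma card_even_walks_Cross_Cross:
  "card (even_walks n (Cross # Cross # w) u v) = card (even_walks n w u v)"
proof -
  let ?f = "\<lambda>ss. hd ss # hd ss # ss"
  have ev: "even_walk (Cross # Cross # w) (s # s' # ss) \<longleftrightarrow> s = hd ss \<and> s' = hd ss \<and> even_walk w ss"
      if "ss \<noteq> []" for s s' :: "nat state" and ss
  proof (cases "walk w ss \<and> s = hd ss \<and> s' = hd ss")
    case True
    hence "fst s \<noteq> snd s" using that by (auto simp: walk_def)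
    thus ?thesis using True that by (simp add: even_walk_altdef walk_Cons edge_mult_Cons)
  next
    case False
    thus ?thesis using that by (auto simp: even_walk_altdef walk_Cons)
  qed
  have "?f ` even_walks n w u v = even_walks n (Cross # Cross # w) u v"
  proof (intro equalityI subsetI)
    fix ss assume "ss \<in> ?f ` even_walks n w u v"
    then obtain ss' where s: "ss = ?f ss'" "ss' \<in> even_walks n w u v" by blast
    hence ne: "ss' \<noteq> []" by (auto simp: even_walks_def even_walk_altdef walk_def)
    show "ss \<in> even_walks n (Cross # Cross # w) u v"
      using s ne ev[OF ne] ends_hd_subset[OF ne] by (auto simp: even_walks_def)
  next
    fix ss assume s: "ss \<in> even_walks n (Cross # Cross # w) u v"
    hence "length ss = Suc (Suc (Suc (length w)))"
        by (auto simp: even_walks_def even_walk_altdef walk_length)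
    then obtain a b ss' where ss: "ss = a # b # ss'" "ss' \<noteq> []" by (auto simp: length_Suc_conv)
    thus "ss \<in> ?f ` even_walks n w u v" using s ev[OF ss(2)]
        by (auto simp: even_walks_def image_iff)
  qed
  moreover have "inj_on ?f (even_walks n w u v)" by (rule inj_onI) simp
  ultimately show ?thesis using card_image[of ?f "even_walks n w u v"] by simp
qed

lemma walk_limit_Cross_both:
  assumes "walk_limit w c"
  shows "walk_limit (Cross # w @ [Cross]) c"
proof -
  have eq: "card (even_walks n (Cross # w @ [Cross]) 1 2) = card (even_walks n w 1 2)" for n
    using card_even_walks_Cross_rotate[of n "Cross # w"
        1 2] card_even_walks_Cross_Cross[of n w 1 2] by simp
  show ?thesis using assms unfolding walk_limit_def eq by simp
qed

lemma walk_limit_Cross_rotate: "walk_limit (Cross # w) c \<longleftrightarrow> walk_limit (w @ [Cross]) c"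
  by (simp add: walk_limit_def card_even_walks_Cross_rotate)

lemma walk_limit_Nil: "walk_limit [] 1"
proof -
  have eq: "even_walks n [] 1 2 = {[(1, 2)]}" if "2 \<le> n" for n
    using that by (auto simp: even_walks_def even_walk_altdef walk_Nil edge_mult_def ends_def
        verts_def)
  have "\<forall>\<^sub>F n in sequentially. 1 = real (card (even_walks n [] 1 2)) / real n ^ (moves [] div 2)"
    using eventually_ge_at_top[of 2] by eventually_elim (simp only: eq, simp)
  thus ?thesis unfolding walk_limit_def by (rule Lim_transform_eventually[OF tendsto_const])
qed

text \<open>The possible cuts of \<open>First # w\<close>; in a tight walk an even number of moves of the first
    walker lies between the first step and the
matching return.\<close>

definition splits :: "bool \<Rightarrow> letter list \<Rightarrow> (letter list \<times> letter list) set" where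
  "splits b w = {(U, V). w = U @ First # V \<and> (even (length (filter (\<lambda>l. l = First) U)) \<longleftrightarrow> b)}"

lemma splits_Nil [simp]: "splits b [] = {}"
  by (simp add: splits_def)

lemma splits_First [simp]:
  "splits b (First # w) = (if b then {([], w)} else {}) \<union>
      (\<lambda>(U, V). (First # U, V)) ` splits (\<not> b) w"
  by (auto simp: splits_def Cons_eq_append_conv image_iff)

lemma splits_other [simp]:
  "l \<noteq> First \<Longrightarrow> splits b (l # w) = (\<lambda>(U, V). (l # U, V)) ` splits b w"
  by (auto simp: splits_def Cons_eq_append_conv image_iff)

abbreviation power_word :: "letter list \<Rightarrow> nat \<Rightarrow> letter list" where
  "power_word w k \<equiv> concat (replicate k w)"

text \<open>The powers of the Gram matrix lead to \<open>P_word\<close> (with the walkers exchanged). Cutting its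
    walks produces the
other words. Up to moving or cancelling letters \<open>Cross\<close>
    and exchanging the walkers, the family is closed under
cutting: \<open>Q_word\<close> corresponds to \<open>R_word\<close>, and \<open>X_word\<close> to \<open>S_word\<close>.\<close>

definition P_word :: "nat \<Rightarrow> letter list" where
  "P_word k = power_word [First, Cross, Second, Second, Cross, First] k"

definition S_word :: "nat \<Rightarrow> letter list" where
  "S_word k = power_word [First, First, Cross, Second, Second, Cross] k"

definition X_word :: "nat \<Rightarrow> letter list" where
  "X_word k = power_word [Cross, Second, Second, Cross, First, First] k"

definition Q_word :: "nat \<Rightarrow> letter list" where
  "Q_word k = X_word k @ [Cross, Second, Second, Cross]"

definition R_word :: "nat \<Rightarrow> letter list" where
  "R_word k = First # First # X_word k"

lemma power_word_shift: "power_word (a @ b) k @ a = a @ power_word (b @ a) k"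
  by (induction k) simp_all

lemma splits_P: "splits True ([Cross, Second, Second, Cross, First] @ P_word k) =
    (\<lambda>m. (Q_word m, P_word (k - m))) ` {..k}"
proof (induction k)
  case 0
  show ?case by (simp add: P_word_def Q_word_def X_word_def)
next
  case (Suc k)
  have "splits True ([Cross, Second, Second, Cross, First] @ P_word (Suc k)) =
    insert ([Cross, Second, Second, Cross], P_word (Suc k))
     ((\<lambda>(U, V). ([Cross, Second, Second, Cross, First, First] @ U, V)) ` splits True ([Cross,
         Second, Second, Cross, First] @ P_word k))"
    by (simp add: P_word_def image_image case_prod_unfold insert_commute)
  also have "\<dots> = (\<lambda>m. (Q_word m, P_word (Suc k - m))) ` insert 0 (Suc ` {..k})"
    unfolding Suc.IH by (simp add: Q_word_def X_word_def image_image)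
  finally show ?case by (simp add: atMost_Suc_eq_insert_0)
qed

lemma splits_S: "splits True ([First, Cross, Second, Second, Cross] @ S_word k) =
    (\<lambda>m. (P_word m, Q_word (k - m))) ` {..k}"
proof -
  have Q: "[Cross, Second, Second, Cross] @ S_word j = Q_word j" for j
    using power_word_shift[of j "[Cross, Second, Second, Cross]" "[First, First]"]
    by (simp add: S_word_def Q_word_def X_word_def)
  show ?thesis
  proof (induction k)
    case 0
    show ?case by (simp add: P_word_def Q_word_def X_word_def S_word_def)
  next
    case (Suc k)
    have "splits True ([First, Cross, Second, Second, Cross] @ S_word (Suc k)) =
      insert ([], Q_word (Suc k))
       ((\<lambda>(U, V). ([First, Cross, Second, Second, Cross, First] @ U, V)) ` splits True ([First,
           Cross, Second, Second, Cross] @ S_word k))"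
      unfolding Q[symmetric] by (simp add: S_word_def image_image case_prod_unfold insert_commute)
    also have "\<dots> = (\<lambda>m. (P_word m, Q_word (Suc k - m))) ` insert 0 (Suc ` {..k})"
      unfolding Suc.IH by (simp add: P_word_def image_image)
    finally show ?case by (simp add: atMost_Suc_eq_insert_0)
  qed
qed

lemma splits_R: "splits True (First # X_word k) = (\<lambda>m. (P_word m, X_word (k - m))) ` {..k}"
proof (induction k)
  case 0
  show ?case by (simp add: P_word_def X_word_def)
next
  case (Suc k)
  have "splits True (First # X_word (Suc k)) =
    insert ([], X_word (Suc k))
     ((\<lambda>(U, V). ([First, Cross, Second, Second, Cross, First] @ U, V)) ` splits True (First #
         X_word k))"
    by (simp add: X_word_def image_image case_prod_unfold insert_commute)
  also have "\<dots> = (\<lambda>m. (P_word m, X_word (Suc k - m))) ` insert 0 (Suc ` {..k})"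
    unfolding Suc.IH by (simp add: P_word_def image_image)
  finally show ?case by (simp add: atMost_Suc_eq_insert_0)
qed

lemma telescoping_P: "telescoping (P_word k)"
  by (induction k) (simp_all add: P_word_def telescoping.intros)

lemma telescoping_X: "telescoping w \<Longrightarrow> telescoping (X_word k @ w)"
  by (induction k) (simp_all add: X_word_def telescoping.intros)

lemma telescoping_Q: "telescoping (Q_word k)"
  unfolding Q_word_def by (intro telescoping_X telescoping.intros)

lemma moves_words:
  "moves (P_word k) = 4 * k" "moves (S_word k) = 4 * k" "moves (X_word k) = 4 * k"
  "moves (Q_word k) = 4 * k + 2" "moves (R_word k) = 4 * k + 2"
  by (induction k) (simp_all add: P_word_def S_word_def X_word_def Q_word_def R_word_def)

lemma length_P_word: "length (P_word k) = 6 * k"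
  and length_X_word: "length (X_word k) = 6 * k"
  by (induction k) (simp_all add: P_word_def X_word_def)

fun fuss_catalan :: "nat \<Rightarrow> nat" where
  "fuss_catalan 0 = 1"
| "fuss_catalan (Suc k) =
    (\<Sum>m\<le>k. (\<Sum>j\<le>m. fuss_catalan j * fuss_catalan (m - j)) * fuss_catalan (k - m))"

definition fc_square :: "nat \<Rightarrow> nat" where
  "fc_square m = (\<Sum>j\<le>m. fuss_catalan j * fuss_catalan (m - j))"

text \<open>The first \<open>Cross\<close> is moved to the end, which turns the word into \<open>S_word\<close> with the walkers
    exchanged.\<close>

lemma walk_limit_X:
  assumes "walk_limit (S_word k) c"
  shows "walk_limit (X_word k) c"
proof (cases k)
  case 0
  thus ?thesis using assms by (simp add: X_word_def S_word_def)
next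
  case (Suc j)
  define Z where "Z = [Second, Second, Cross, First, First] @ X_word j"
  have X: "X_word k = Cross # Z" by (simp add: X_word_def Z_def Suc)
  have "Z @ [Cross] = [Second, Second, Cross, First, First] @ (X_word j @ [Cross])"
      by (simp add: Z_def)
  also have "X_word j @ [Cross] = Cross # power_word [Second, Second, Cross, First, First, Cross] j"
    using power_word_shift[of j "[Cross]" "[Second, Second, Cross, First, First]"]
        by (simp add: X_word_def)
  also have "[Second, Second, Cross, First, First] @ \<dots> = map swap_letter (S_word k)"
    by (simp add: S_word_def Suc map_concat)
  finally have "walk_limit (Z @ [Cross]) c" using walk_limit_swap[OF assms] by simp
  thus ?thesis unfolding X walk_limit_Cross_rotate .
qed

text \<open>Without its outer two letters \<open>Cross\<close> the word is \<open>R_word\<close> with the walkers exchanged.\<close>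

lemma walk_limit_Q:
  assumes "walk_limit (R_word k) c"
  shows "walk_limit (Q_word k) c"
proof -
  have "Q_word k = Cross # ([Second, Second] @ power_word [Cross, First, First, Cross, Second,
      Second] k) @ [Cross]"
    using power_word_shift[of k "[Cross, Second, Second]" "[Cross, First, First]"]
    by (simp add: Q_word_def X_word_def)
  also have "[Second, Second] @ power_word [Cross, First, First, Cross, Second, Second] k =
      map swap_letter (R_word k)"
    by (simp add: R_word_def X_word_def map_concat)
  finally show ?thesis using walk_limit_Cross_both[OF walk_limit_swap[OF assms]] by simp
qed

text \<open>Cutting \<open>P_word\<close> and \<open>S_word\<close> gives a convolution of \<open>fuss_catalan\<close> with \<open>fc_square\<close>,
    cutting \<open>R_word\<close> the
convolution square of \<open>fuss_catalan\<close>. Only the simultaneous induction shows that \<open>P_word\<close>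
    and \<open>S_word\<close> have the
same limits.\<close>

lemma walk_limits:
  "walk_limit (P_word k) (fuss_catalan k) \<and> walk_limit (S_word k) (fuss_catalan k) \<and>
   walk_limit (R_word k) (fc_square k)"
proof (induction k rule: less_induct)
  case (less k)
  have PS: "walk_limit (P_word k) (fuss_catalan k) \<and> walk_limit (S_word k) (fuss_catalan k)"
  proof (cases k)
    case 0
    thus ?thesis using walk_limit_Nil by (simp add: P_word_def S_word_def)
  next
    case (Suc j)
    have IH: "walk_limit (P_word m) (fuss_catalan m)" "walk_limit (Q_word m) (fc_square m)"
        if "m \<le> j" for m
      using less.IH[of m] that Suc walk_limit_Q by auto
    have "walk_limit (First # ([Cross, Second, Second, Cross, First] @ P_word j))
        (\<Sum>m\<in>{..j}. real (fc_square m) * real (fuss_catalan (j - m)))"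
    proof (rule walk_limit_First)
      show "{(U, V). [Cross, Second, Second, Cross, First] @ P_word j = U @ First # V \<and>
          even (length (filter (\<lambda>l. l = First) U))} = (\<lambda>m. (Q_word m, P_word (j - m))) ` {..j}"
        using splits_P[of j] by (simp add: splits_def)
      show "inj_on (\<lambda>m. (Q_word m, P_word (j - m))) {..j}"
        by (rule inj_onI) (auto dest!: arg_cong[of "X_word _"
            _ length] simp: Q_word_def length_X_word)
    qed (use IH telescoping_Q in \<open>auto simp: moves_words\<close>)
    moreover have "First # ([Cross, Second, Second, Cross, First] @ P_word j) = P_word k"
      by (simp add: P_word_def Suc)
    moreover have "walk_limit (First # ([First, Cross, Second, Second, Cross] @ S_word j))
        (\<Sum>m\<in>{..j}. real (fuss_catalan m) * real (fc_square (j - m)))"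
    proof (rule walk_limit_First)
      show "{(U, V). [First, Cross, Second, Second, Cross] @ S_word j = U @ First # V \<and>
          even (length (filter (\<lambda>l. l = First) U))} = (\<lambda>m. (P_word m, Q_word (j - m))) ` {..j}"
        using splits_S[of j] by (simp add: splits_def)
      show "inj_on (\<lambda>m. (P_word m, Q_word (j - m))) {..j}"
        by (rule inj_onI) (auto dest!: arg_cong[of "P_word _" _ length] simp: length_P_word)
    qed (use IH telescoping_P in \<open>auto simp: moves_words\<close>)
    moreover have "First # ([First, Cross, Second, Second, Cross] @ S_word j) = S_word k"
      by (simp add: S_word_def Suc)
    moreover have "(\<Sum>m\<in>{..j}. real (fc_square m) * real (fuss_catalan (j - m))) =
        real (fuss_catalan k)"
      by (simp add: Suc fc_square_def)
    moreover have "(\<Sum>m\<in>{..j}. real (fuss_catalan m) * real (fc_square (j - m))) =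
        (\<Sum>m\<in>{..j}. real (fc_square m) * real (fuss_catalan (j - m)))"
      by (rule sum.reindex_bij_witness[of _ "\<lambda>m. j - m" "\<lambda>m. j - m"]) auto
    ultimately show ?thesis by simp
  qed
  have IH0: "walk_limit (P_word m) (fuss_catalan m) \<and> walk_limit (S_word m) (fuss_catalan m)"
      if "m \<le> k" for m
    using less.IH[of m] that PS by (cases "m = k") auto
  hence IH: "walk_limit (P_word m) (fuss_catalan m)" "walk_limit (X_word m) (fuss_catalan m)"
      if "m \<le> k" for m
    using that walk_limit_X by blast+
  have "walk_limit (First # (First # X_word k)) (\<Sum>m\<in>{..k}. real (fuss_catalan m) * real
      (fuss_catalan (k - m)))"
  proof (rule walk_limit_First)
    show "{(U, V). First # X_word k = U @ First # V \<and>
        even (length (filter (\<lambda>l. l = First) U))} = (\<lambda>m. (P_word m, X_word (k - m))) ` {..k}"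
      using splits_R[of k] by (simp add: splits_def)
    show "inj_on (\<lambda>m. (P_word m, X_word (k - m))) {..k}"
      by (rule inj_onI) (auto dest!: arg_cong[of "P_word _" _ length] simp: length_P_word)
  qed (use IH telescoping_P in \<open>auto simp: moves_words\<close>)
  thus ?case using PS by (simp add: R_word_def fc_square_def)
qed

section \<open>The two-term recursion of the Fuss-Catalan numbers\<close>

lemma fps_fuss_catalan_eq:
  defines "B \<equiv> Abs_fps (\<lambda>n. real (fuss_catalan n))"
  shows "B = 1 + fps_X * B ^ 3"
proof (rule fps_ext)
  fix n
  have sq: "fps_nth (B * B) m = real (fc_square m)" for m
    by (simp add: fps_mult_nth B_def fc_square_def atMost_atLeast0)
  have cube: "fps_nth (B ^ 3) k = real (fuss_catalan (Suc k))" for k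
    unfolding power3_eq_cube fps_mult_nth[of "B * B"] sq
        by (simp add: B_def fc_square_def atMost_atLeast0)
  show "fps_nth B n = fps_nth (1 + fps_X * B ^ 3) n"
    by (cases n) (simp_all add: cube, simp_all add: B_def)
qed

text \<open>With \<open>U = z B'\<close> the cubic equation gives \<open>(3 - 2 B) U =
    B\<^sup>2 - B\<close>; one more derivation expresses \<open>W = z U'\<close> rationally
in \<open>B\<close>. Substituting both into the differential equation \<open>4 W + 2 U = z (27 W + 27 U +
    6 B)\<close>, whose coefficients
are the claim, reduces it to a polynomial identity in \<open>B\<close>.\<close>

theorem fuss_catalan_ratio:
  "real ((2 * k + 2) * (2 * k + 3)) * real (fuss_catalan (Suc k)) =
   real (3 * (3 * k + 1) * (3 * k + 2)) * real (fuss_catalan k)"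
proof -
  define B where "B = Abs_fps (\<lambda>n. real (fuss_catalan n))"
  have B: "B = 1 + fps_X * B ^ 3" unfolding B_def by (rule fps_fuss_catalan_eq)
  define U where "U = fps_X * fps_deriv B"
  define W where "W = fps_X * fps_deriv U"
  define c where "c = 3 - 2 * B"
  have XB: "fps_X * B ^ 3 = B - 1" using B by (simp add: algebra_simps)
  have "fps_deriv B = B ^ 3 + fps_X * (3 * B ^ 2 * fps_deriv B)"
    by (subst B) (simp add: fps_deriv_power algebra_simps numeral_fps_const)
  hence "U = fps_X * B ^ 3 + 3 * fps_X * B ^ 2 * U"
    unfolding U_def by (metis (no_types, lifting) mult.assoc mult.left_commute distrib_left)
  hence "B * U = B * (fps_X * B ^ 3) + 3 * (fps_X * B ^ 3) * U"
    by (metis (no_types, opaque_lifting) distrib_left mult.assoc mult.left_commute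
        power2_eq_square power3_eq_cube)
  hence cU: "c * U = B * B - B" unfolding XB c_def by (simp add: algebra_simps)
  have "fps_deriv (c * U) = fps_deriv (B * B - B)" using cU by simp
  hence "c * fps_deriv U - 2 * fps_deriv B * U = 2 * B * fps_deriv B - fps_deriv B"
    by (simp add: c_def algebra_simps)
  hence "fps_X * (c * fps_deriv U - 2 * fps_deriv B * U) =
      fps_X * (2 * B * fps_deriv B - fps_deriv B)"
    by (simp only:)
  hence cW: "c * W - 2 * U * U = 2 * B * U - U"
    unfolding W_def U_def by (simp add: algebra_simps)
  define E where "E = 4 * W + 2 * U - fps_X * (27 * W + 27 * U + 6 * B)"
  have c3W: "c ^ 3 * W = c * (2 * B - 1) * (c * U) + 2 * (c * U) ^ 2"
  proof -
    have cW': "c * W = (2 * B - 1) * U + 2 * U * U" using cW by (simp add: algebra_simps)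
    have "c ^ 3 * W = c ^ 2 * (c * W)" by (simp add: power2_eq_square power3_eq_cube mult.assoc)
    also have "\<dots> = c * (2 * B - 1) * (c * U) + 2 * (c * U) ^ 2"
      unfolding cW' by (simp add: power2_eq_square algebra_simps)
    finally show ?thesis .
  qed
  have "c ^ 3 * B ^ 3 * E = (4 * (c ^ 3 * W) + 2 * c ^ 2 * (c * U)) * B ^ 3
      - (fps_X * B ^ 3) * (27 * (c ^ 3 * W) + 27 * c ^ 2 * (c * U) + 6 * B * c ^ 3)"
    unfolding E_def by (simp add: power2_eq_square power3_eq_cube algebra_simps)
  also have "\<dots> = 0"
    unfolding c3W cU XB unfolding c_def by (simp add: power2_eq_square power3_eq_cube algebra_simps)
  finally have "c ^ 3 * B ^ 3 * E = 0" .
  moreover have "fps_nth B 0 = 1" by (simp add: B_def)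
  hence "B \<noteq> 0" "c \<noteq> 0" by (auto simp: c_def fps_eq_iff numeral_fps_const intro!: exI[of _ 0])
  ultimately have "E = 0" by simp
  hence "fps_nth E (Suc k) = 0" by simp
  moreover have "fps_nth E (Suc k) = 4 * (real (Suc k))\<^sup>2 * real (fuss_catalan (Suc k)) +
      2 * real (Suc k) * real (fuss_catalan (Suc k))
      - (27 * (real k)\<^sup>2 + 27 * real k + 6) * real (fuss_catalan k)"
    unfolding E_def W_def U_def B_def
    by (cases k) (simp_all add: numeral_fps_const power2_eq_square algebra_simps)
  ultimately show ?thesis by (simp add: algebra_simps power2_eq_square)
qed

section \<open>Mean and variance of sums of edge signs over walks\<close>

lemma edge_sign_cases: "edge_sign E e = 1 \<or> edge_sign E e = -1"
  by (simp add: edge_sign_def)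

definition walk_sign :: "nat set set \<Rightarrow> letter list \<Rightarrow> nat state list \<Rightarrow> real" where
  "walk_sign E w ss = (\<Prod>t<length w. edge_sign E (edge_at w ss t))"

definition odd_edges :: "letter list \<Rightarrow> 'a state list \<Rightarrow> 'a set set" where
  "odd_edges w ss = {e. odd (edge_mult w ss e)}"

lemma odd_edges_subset: "odd_edges w ss \<subseteq> edge_at w ss ` {..<length w}"
proof
  fix e assume e: "e \<in> odd_edges w ss"
  show "e \<in> edge_at w ss ` {..<length w}"
  proof (rule ccontr)
    assume "e \<notin> edge_at w ss ` {..<length w}"
    hence "{t. t < length w \<and> edge_at w ss t = e} = {}" by auto
    hence "edge_mult w ss e = 0" unfolding edge_mult_def by (simp only: card.empty)
    thus False using e by (simp add: odd_edges_def)
  qed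
qed

lemma walk_sign_eq: "walk_sign E w ss = (\<Prod>e\<in>odd_edges w ss. edge_sign E e)"
proof -
  let ?T = "{..<length w}"
  let ?F = "edge_at w ss ` ?T"
  have "walk_sign E w ss = (\<Prod>e\<in>?F. \<Prod>t\<in>{t \<in> ?T. edge_at w ss t = e}. edge_sign E (edge_at w ss t))"
    unfolding walk_sign_def by (rule prod.group[symmetric]) auto
  also have "\<dots> = (\<Prod>e\<in>?F. edge_sign E e ^ edge_mult w ss e)"
    by (intro prod.cong refl) (simp add: edge_mult_def)
  also have "\<dots> = (\<Prod>e\<in>?F. if odd (edge_mult w ss e) then edge_sign E e else 1)"
  proof (intro prod.cong refl)
    fix e
    show "edge_sign E e ^ edge_mult w ss e = (if odd (edge_mult w ss e) then edge_sign E e else 1)"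
      using edge_sign_cases[of E e] by auto
  qed
  also have "\<dots> = (\<Prod>e\<in>{e \<in> ?F. odd (edge_mult w ss e)}. edge_sign E e)"
    by (rule prod.inter_filter[symmetric]) simp
  also have "{e \<in> ?F. odd (edge_mult w ss e)} = odd_edges w ss"
    using odd_edges_subset[of w ss] unfolding odd_edges_def by blast
  finally show ?thesis .
qed

definition mean :: "nat \<Rightarrow> (nat set set \<Rightarrow> real) \<Rightarrow> real" where
  "mean n f = (\<Sum>E\<in>graphs n. f E) / card (graphs n)"

lemma finite_nsets_2: "finite (nsets {1..n::nat} 2)"
  by (rule finite_imp_finite_nsets) simp

lemma finite_graphs [simp]: "finite (graphs n)"
  using finite_nsets_2 by (simp add: graphs_def)

lemma graphs_nonempty [simp]: "graphs n \<noteq> {}"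
  by (auto simp: graphs_def)

text \<open>Flipping one of the edges changes the sign of the product.\<close>

lemma mean_edge_signs:
  assumes R: "R \<subseteq> nsets {1..n} 2"
  shows "mean n (\<lambda>E. \<Prod>e\<in>R. edge_sign E e) = (if R = {} then 1 else 0)"
proof (cases "R = {}")
  case True
  thus ?thesis by (simp add: mean_def)
next
  case False
  then obtain e0 where e0: "e0 \<in> R" by blast
  have finR: "finite R" using R finite_nsets_2 by (rule finite_subset)
  define flip where "flip E = (if e0 \<in> E then E - {e0} else insert e0 E)" for E
  have "(\<Sum>E\<in>graphs n. \<Prod>e\<in>R. edge_sign E e) = (\<Sum>E\<in>graphs n. \<Prod>e\<in>R. edge_sign (flip E) e)"
    by (rule sum.reindex_bij_witness[of _ flip flip])
        (use e0 R in \<open>auto simp: flip_def graphs_def insert_absorb\<close>)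
  moreover have "(\<Prod>e\<in>R. edge_sign (flip E) e) = - (\<Prod>e\<in>R. edge_sign E e)" for E
  proof -
    have "(\<Prod>e\<in>R. edge_sign (flip E) e) = edge_sign (flip E) e0 * (\<Prod>e\<in>R - {e0}. edge_sign (flip E)
        e)"
      using finR e0 by (rule prod.remove)
    also have "edge_sign (flip E) e0 = - edge_sign E e0" by (auto simp: flip_def edge_sign_def)
    also have "(\<Prod>e\<in>R - {e0}. edge_sign (flip E) e) = (\<Prod>e\<in>R - {e0}. edge_sign E e)"
      by (intro prod.cong refl) (auto simp: flip_def edge_sign_def)
    also have "- edge_sign E e0 * (\<Prod>e\<in>R - {e0}. edge_sign E e) = - (\<Prod>e\<in>R. edge_sign E e)"
      using prod.remove[OF finR e0, of "edge_sign E"] by simp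
    finally show ?thesis .
  qed
  ultimately have "(\<Sum>E\<in>graphs n. \<Prod>e\<in>R. edge_sign E e) = - (\<Sum>E\<in>graphs n. \<Prod>e\<in>R. edge_sign E e)"
    by (simp add: sum_negf)
  thus ?thesis using False by (simp add: mean_def)
qed

lemma odd_edges_nsets:
  assumes "walk w ss" "verts ss \<subseteq> {1..n}"
  shows "odd_edges w ss \<subseteq> nsets {1..n} 2"
proof
  fix e assume "e \<in> odd_edges w ss"
  then obtain t where t: "t < length w" "e = edge_at w ss t" using odd_edges_subset by blast
  have m: "ss ! t \<in> set ss" "ss ! Suc t \<in> set ss" using walk_nth_mem[OF assms(1) t(1)] by auto
  have step: "walk_step (w ! t) (ss ! t) (ss ! Suc t)" using assms(1) t(1) by (simp add: walk_def)
  have "fst (ss ! t) \<noteq> snd (ss ! t)" using assms(1) m by (auto simp: walk_def)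
  hence "card e = 2 \<and> finite e" unfolding t(2) edge_at_def using step by (cases "w ! t") auto
  moreover have "ends s \<subseteq> {1..n}" if "s \<in> set ss" for s using that assms(2)
      by (auto simp: verts_def)
  hence "e \<subseteq> {1..n}" unfolding t(2) edge_at_def using walk_edge_subset[OF step] m by blast
  ultimately show "e \<in> nsets {1..n} 2" by (simp add: nsets_def)
qed

lemma mean_walk_sign:
  assumes "walk w ss" "verts ss \<subseteq> {1..n}"
  shows "mean n (\<lambda>E. walk_sign E w ss) = (if odd_edges w ss = {} then 1 else 0)"
  unfolding walk_sign_eq by (rule mean_edge_signs[OF odd_edges_nsets[OF assms]])

lemma mean_walk_sign_prod:
  assumes "walk w ss" "verts ss \<subseteq> {1..n}" "walk w ss'" "verts ss' \<subseteq> {1..n}"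
  shows "mean n (\<lambda>E. walk_sign E w ss * walk_sign E w ss') = (if odd_edges w ss =
      odd_edges w ss' then 1 else 0)"
proof -
  let ?A = "odd_edges w ss" and ?B = "odd_edges w ss'"
  have fin: "finite ?A" "finite ?B" using odd_edges_subset
      by (meson finite_imageI finite_lessThan finite_subset)+
  have prod_eq: "walk_sign E w ss * walk_sign E w ss' = (\<Prod>e\<in>(?A - ?B) \<union> (?B - ?A). edge_sign E e)"
      for E
  proof -
    have sq: "(\<Prod>e\<in>?A \<inter> ?B. edge_sign E e) * (\<Prod>e\<in>?A \<inter> ?B. edge_sign E e) = 1"
      unfolding prod.distrib[symmetric] by (rule prod.neutral) (simp add: edge_sign_def)
    have "walk_sign E w ss = (\<Prod>e\<in>?A \<inter> ?B. edge_sign E e) * (\<Prod>e\<in>?A - ?B. edge_sign E e)"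
      unfolding walk_sign_eq by (rule prod.Int_Diff[OF fin(1)])
    moreover have "walk_sign E w ss' = (\<Prod>e\<in>?A \<inter> ?B. edge_sign E e) * (\<Prod>e\<in>?B - ?A. edge_sign E e)"
      unfolding walk_sign_eq Int_commute[of ?A] by (rule prod.Int_Diff[OF fin(2)])
    moreover have "(\<Prod>e\<in>(?A - ?B) \<union> (?B - ?A). edge_sign E e) =
        (\<Prod>e\<in>?A - ?B. edge_sign E e) * (\<Prod>e\<in>?B - ?A. edge_sign E e)"
      by (rule prod.union_disjoint) (use fin in auto)
    ultimately show ?thesis using sq by (simp add: mult_ac)
  qed
  have "(?A - ?B) \<union> (?B - ?A) \<subseteq> nsets {1..n} 2" using odd_edges_nsets assms by blast
  hence "mean n (\<lambda>E. walk_sign E w ss * walk_sign E w ss') = (if (?A - ?B) \<union> (?B - ?A) =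
      {} then 1 else 0)"
    unfolding prod_eq by (rule mean_edge_signs)
  also have "(?A - ?B) \<union> (?B - ?A) = {} \<longleftrightarrow> ?A = ?B" by blast
  finally show ?thesis .
qed

lemma mean_sum: "mean n (\<lambda>E. \<Sum>i\<in>I. f i E) = (\<Sum>i\<in>I. mean n (f i))"
proof -
  have "(\<Sum>E\<in>graphs n. \<Sum>i\<in>I. f i E) = (\<Sum>i\<in>I. \<Sum>E\<in>graphs n. f i E)" by (rule sum.swap)
  thus ?thesis by (simp add: mean_def sum_divide_distrib)
qed

lemma mean_diff: "mean n (\<lambda>E. f E - g E) = mean n f - mean n g"
  and mean_cmult: "mean n (\<lambda>E. c * f E) = c * mean n f"
  by (simp_all add: mean_def sum_subtractf sum_distrib_left diff_divide_distrib)

lemma mean_const: "mean n (\<lambda>E. c) = c"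
  by (simp add: mean_def)

lemma even_walk_iff_odd_edges: "even_walk w ss \<longleftrightarrow> closed_walk w ss \<and> odd_edges w ss = {}"
  by (auto simp: even_walk_def odd_edges_def)

text \<open>Pairs of walks contribute only if their odd edge sets agree,
    and the pairs in which both sets are empty cancel against the square
of the mean.\<close>

lemma variance_walk_sum:
  fixes C :: "nat state list set"
  assumes C: "finite C" "\<And>ss. ss \<in> C \<Longrightarrow> closed_walk w ss \<and> verts ss \<subseteq> {1..n}"
  defines "T \<equiv> \<lambda>E. \<Sum>ss\<in>C. walk_sign E w ss"
  shows "mean n (\<lambda>E. (T E - mean n T)\<^sup>2) \<le>
    card {(ss, ss'). ss \<in> C \<and> ss' \<in> C \<and> odd_edges w ss = odd_edges w ss' \<and> odd_edges w ss \<noteq> {}}"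
proof -
  let ?m = "\<lambda>ss. if odd_edges w ss = {} then 1 else 0 :: real"
  let ?D = "{(ss, ss'). ss \<in> C \<and> ss' \<in> C \<and> odd_edges w ss = odd_edges w ss' \<and> odd_edges w ss \<noteq> {}}"
  have wk: "walk w ss" "verts ss \<subseteq> {1..n}" if "ss \<in> C" for ss using C(2)[OF that]
      by (auto simp: closed_walk_def)
  have mT: "mean n T = (\<Sum>ss\<in>C. ?m ss)"
    unfolding T_def mean_sum by (intro sum.cong refl mean_walk_sign wk)
  have "mean n (\<lambda>E. (T E - mean n T)\<^sup>2) = mean n (\<lambda>E. T E * T E - (2 * mean n T) * T E) +
      mean n T * mean n T"
  proof -
    have "(\<lambda>E. (T E - mean n T)\<^sup>2) = (\<lambda>E. (T E * T E - (2 * mean n T) * T E) - (- (mean n T * mean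
        n T)))"
      by (simp add: fun_eq_iff power2_eq_square algebra_simps)
    thus ?thesis by (simp only: mean_diff mean_const)
  qed
  also have "\<dots> = mean n (\<lambda>E. T E * T E) - mean n T * mean n T"
    unfolding mean_diff mean_cmult by simp
  also have "mean n (\<lambda>E. T E * T E) = (\<Sum>ss\<in>C. \<Sum>ss'\<in>C.
      if odd_edges w ss = odd_edges w ss' then 1 else 0)"
    unfolding T_def sum_product mean_sum by (intro sum.cong refl mean_walk_sign_prod wk)
  also have "mean n T * mean n T = (\<Sum>ss\<in>C. \<Sum>ss'\<in>C. ?m ss * ?m ss')"
    unfolding mT sum_product ..
  also have "(\<Sum>ss\<in>C. \<Sum>ss'\<in>C. if odd_edges w ss =
      odd_edges w ss' then 1 else 0) - (\<Sum>ss\<in>C. \<Sum>ss'\<in>C. ?m ss * ?m ss')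
      = (\<Sum>ss\<in>C. \<Sum>ss'\<in>C. if odd_edges w ss = odd_edges w ss' \<and> odd_edges w ss \<noteq> {} then 1 else 0)"
    unfolding sum_subtractf[symmetric] by (intro sum.cong refl) auto
  also have "\<dots> = (\<Sum>p\<in>C \<times> C. if odd_edges w (fst p) = odd_edges w (snd p) \<and>
      odd_edges w (fst p) \<noteq> {} then 1 else 0)"
    by (simp add: sum.cartesian_product case_prod_unfold)
  also have "\<dots> = real (card {p \<in> C \<times> C. odd_edges w (fst p) = odd_edges w (snd p) \<and>
      odd_edges w (fst p) \<noteq> {}})"
    using C(1) by (simp add: sum.inter_filter[symmetric])
  also have "{p \<in> C \<times> C. odd_edges w (fst p) = odd_edges w (snd p) \<and> odd_edges w (fst p) \<noteq> {}} =
      ?D" by auto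
  finally show ?thesis by simp
qed

text \<open>By \<open>two_walks_card_le\<close> such a pair has at most \<open>moves w + 2\<close> vertices.\<close>

lemma card_matching_pairs:
  fixes C :: "nat state list set"
  assumes C: "\<And>ss. ss \<in> C \<Longrightarrow> closed_walk w ss \<and> verts ss \<subseteq> {1..n}"
  shows "card {(ss, ss'). ss \<in> C \<and> ss' \<in> C \<and> odd_edges w ss = odd_edges w ss' \<and>
      odd_edges w ss \<noteq> {}} * n
    \<le> (moves w + 6) ^ (4 * Suc (length w)) * n ^ (moves w + 3)"
proof -
  let ?D = "{(ss, ss'). ss \<in> C \<and> ss' \<in> C \<and> odd_edges w ss = odd_edges w ss' \<and> odd_edges w ss \<noteq> {}}"
  let ?X = "{ss :: nat state list. length ss = 2 * Suc (length w) \<and> verts ss \<subseteq> {1..n} \<and>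
      card (verts ss - set []) < moves w + 3}"
  have len: "length ss = Suc (length w)" if "ss \<in> C" for ss
    using C[OF that] by (auto simp: closed_walk_def walk_length)
  have "inj_on (\<lambda>(ss, ss'). ss @ ss') ?D" using len by (auto simp: inj_on_def)
  moreover have "(\<lambda>(ss, ss'). ss @ ss') ` ?D \<subseteq> ?X"
  proof
    fix xs assume "xs \<in> (\<lambda>(ss, ss'). ss @ ss') ` ?D"
    then obtain ss ss' where s: "xs = ss @ ss'" "ss \<in> C" "ss' \<in> C" "odd_edges w ss =
        odd_edges w ss'" "odd_edges w ss \<noteq> {}"
      by auto
    then obtain e where e: "odd (edge_mult w ss e)" by (auto simp: odd_edges_def)
    have "even (edge_mult w ss f + edge_mult w ss' f)" for f
      using s(4) by (auto simp: odd_edges_def set_eq_iff)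
    hence "2 * card (verts ss \<union> verts ss') \<le> 4 + moves w + moves w"
      using C[OF s(2)] C[OF s(3)] e by (intro two_walks_card_le) auto
    thus "xs \<in> ?X" using s len C[OF s(2)] C[OF s(3)] by simp
  qed
  moreover have "finite ?X" by (rule finite_subset[OF _ finite_bounded_walks[of "2 * Suc (length
      w)" n]]) auto
  ultimately have "card ?D \<le> card ?X" by (rule card_inj_on_le)
  hence "card ?D * n \<le> card ?X * n" by (rule mult_right_mono) simp
  also have "\<dots> \<le> (moves w + 3 + 3) ^ (2 * (2 * Suc (length w))) * n ^ (moves w + 3)"
    by (rule card_few_vertices) simp
  finally have "card ?D * n \<le> (moves w + 3 + 3) ^ (2 * (2 * Suc (length w))) * n ^ (moves w + 3)" .
  moreover have "moves w + 3 + 3 = moves w + 6" "2 * (2 * Suc (length w)) = 4 * Suc (length w)"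
      by simp_all
  ultimately show ?thesis by (simp only:)
qed

section \<open>Traces of powers of the Gram matrix\<close>

definition trace_mat :: "'a :: comm_monoid_add Matrix.mat \<Rightarrow> 'a" where
  "trace_mat A = (\<Sum>i<dim_row A. A $$ (i, i))"

definition pairs :: "nat \<Rightarrow> nat state set" where
  "pairs n = set (distinct_pairs n)"

lemma mem_pairs: "b \<in> pairs n \<longleftrightarrow> fst b \<in> {1..n} \<and> snd b \<in> {1..n} \<and> fst b \<noteq> snd b"
  by (auto simp: pairs_def set_distinct_pairs)

lemma finite_pairs [simp]: "finite (pairs n)"
  by (simp add: pairs_def)

lemma card_pairs: "card (pairs n) = n * (n - 1)"
  unfolding pairs_def using distinct_card[OF distinct_distinct_pairs] length_distinct_pairs by metis

lemma sum_distinct_pairs: "(\<Sum>l<n * (n - 1). f (distinct_pairs n ! l)) = (\<Sum>a\<in>pairs n. f a)"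
proof -
  have "bij_betw ((!) (distinct_pairs n)) {..<n * (n - 1)} (pairs n)"
    unfolding pairs_def by (rule bij_betw_nth)
        (simp_all add: distinct_distinct_pairs length_distinct_pairs)
  thus ?thesis by (rule sum.reindex_bij_betw)
qed

text \<open>The entries of the powers of the Gram matrix, with rows and columns indexed
    by pairs instead of numbers.\<close>

fun gram_kernel :: "nat set set \<Rightarrow> nat \<Rightarrow> nat \<Rightarrow> nat state \<Rightarrow> nat state \<Rightarrow> real" where
  "gram_kernel E n 0 b c = (if b = c then 1 else 0)"
| "gram_kernel E n (Suc k) b c =
    (\<Sum>d\<in>pairs n. (\<Sum>a\<in>pairs n. Z_entry E a b * Z_entry E a d) * gram_kernel E n k d c)"

lemma pow_mat_Suc_left:
  assumes "A \<in> carrier_mat N N"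
  shows "A ^\<^sub>m Suc k = A * A ^\<^sub>m k"
proof (induction k)
  case 0
  thus ?case using assms by simp
next
  case (Suc k)
  have "A ^\<^sub>m Suc (Suc k) = (A * A ^\<^sub>m k) * A" using Suc by simp
  also have "\<dots> = A * (A ^\<^sub>m k * A)" using assms by (intro assoc_mult_mat[of _ N N _ N _ N]) simp_all
  finally show ?case by simp
qed

lemma pow_gram_entry:
  fixes E n
  defines "M \<equiv> Z_matrix n E"
  assumes ij: "i < n * (n - 1)" "j < n * (n - 1)"
  shows "((transpose_mat M * M) ^\<^sub>m k) $$ (i, j) =
      gram_kernel E n k (distinct_pairs n ! i) (distinct_pairs n ! j)"
  using ij
proof (induction k arbitrary: i)
  case 0
  thus ?case
    by (simp add: M_def Z_matrix_def nth_eq_iff_index_eq[OF distinct_distinct_pairs]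
        length_distinct_pairs)
next
  case (Suc k)
  let ?N = "n * (n - 1)" and ?p = "\<lambda>l. distinct_pairs n ! l"
  let ?A = "transpose_mat M * M"
  have M: "M \<in> carrier_mat ?N ?N" by (simp add: M_def Z_matrix_def)
  hence A: "?A \<in> carrier_mat ?N ?N" by simp
  hence Ak: "?A ^\<^sub>m k \<in> carrier_mat ?N ?N" by simp
  have entry: "?A $$ (i, l) = (\<Sum>a\<in>pairs n. Z_entry E a (?p i) * Z_entry E a (?p l))" if "l < ?N"
      for l
  proof -
    have "?A $$ (i, l) = (\<Sum>r<?N. M $$ (r, i) * M $$ (r, l))"
      using M that Suc.prems by (simp add: scalar_prod_def atLeast0LessThan)
    also have "\<dots> = (\<Sum>r<?N. Z_entry E (?p r) (?p i) * Z_entry E (?p r) (?p l))"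
      using that Suc.prems by (intro sum.cong refl) (simp add: M_def Z_matrix_def)
    finally show ?thesis using sum_distinct_pairs[of "\<lambda>a. Z_entry E a (?p i) * Z_entry E a (?p l)"
        n] by simp
  qed
  have "(?A ^\<^sub>m Suc k) $$ (i, j) = (\<Sum>l<?N. ?A $$ (i, l) * (?A ^\<^sub>m k) $$ (l, j))"
    unfolding pow_mat_Suc_left[OF A] using A Ak Suc.prems
    by (subst index_mult_mat) (auto simp: scalar_prod_def atLeast0LessThan intro!: sum.cong)
  also have "\<dots> = (\<Sum>l<?N. (\<Sum>a\<in>pairs n. Z_entry E a (?p i) * Z_entry E a (?p l)) * gram_kernel E n k
      (?p l) (?p j))"
    using Suc by (intro sum.cong refl) (simp add: entry)
  also have "\<dots> = gram_kernel E n (Suc k) (?p i) (?p j)"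
    using sum_distinct_pairs[of "\<lambda>d. (\<Sum>a\<in>pairs n. Z_entry E a (?p i) * Z_entry E a d) *
        gram_kernel E n k d (?p j)" n]
    by simp
  finally show ?case .
qed

lemma trace_pow_gram:
  "trace_mat ((transpose_mat (Z_matrix n E) * Z_matrix n E) ^\<^sub>m k) =
      (\<Sum>b\<in>pairs n. gram_kernel E n k b b)"
proof -
  have "trace_mat ((transpose_mat (Z_matrix n E) * Z_matrix n E) ^\<^sub>m k) =
      (\<Sum>i<n * (n - 1). gram_kernel E n k (distinct_pairs n ! i) (distinct_pairs n ! i))"
    unfolding trace_mat_def by (intro sum.cong)
        (simp_all add: pow_gram_entry, simp add: Z_matrix_def)
  thus ?thesis using sum_distinct_pairs[of "\<lambda>b. gram_kernel E n k b b" n] by simp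
qed

definition gram_word :: "nat \<Rightarrow> letter list" where
  "gram_word k = power_word [Second, Cross, First, First, Cross, Second] k"

lemma gram_word_simps [simp]:
  "gram_word 0 = []"
  "gram_word (Suc k) = Second # Cross # First # First # Cross # Second # gram_word k"
  by (simp_all add: gram_word_def)

definition disjoint_states :: "nat state \<Rightarrow> nat state \<Rightarrow> bool" where
  "disjoint_states a b \<longleftrightarrow> ends a \<inter> ends b = {}"

text \<open>The states of the walkers between a column \<open>b\<close>
    and the next column \<open>d\<close>, passing through the row \<open>a\<close>: the second walker
moves from \<open>b\<close> to \<open>a\<close>, the first one from \<open>b\<close> via \<open>a\<close> to \<open>d\<close>, and then the second one to \<open>d\<close>.\<close>

definition gram_block :: "nat state \<Rightarrow> nat state \<Rightarrow> nat state \<Rightarrow> nat state list" where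
  "gram_block b a d = [b, (fst b, snd a), (fst b, snd a), a, (fst d, snd a), (fst d, snd a)]"

fun gram_walks :: "nat \<Rightarrow> nat \<Rightarrow> nat state \<Rightarrow> nat state \<Rightarrow> nat state list set" where
  "gram_walks n 0 b c = (if b = c then {[b]} else {})"
| "gram_walks n (Suc k) b c = (\<Union>d\<in>pairs n. \<Union>a\<in>{a \<in> pairs n. disjoint_states a b \<and>
    disjoint_states a d}.
     (\<lambda>ss. gram_block b a d @ ss) ` gram_walks n k d c)"

lemma finite_gram_walks [simp]: "finite (gram_walks n k b c)"
  by (induction k arbitrary: b) auto

lemma hd_gram_walks: "ss \<in> gram_walks n k b c \<Longrightarrow> ss \<noteq> [] \<and> hd ss = b"
  by (cases k) (auto simp: gram_block_def split: if_splits)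

lemma walk_sign_Nil [simp]: "walk_sign E [] ss = 1"
  by (simp add: walk_sign_def)

lemma walk_sign_Cons:
  "ss \<noteq> [] \<Longrightarrow> walk_sign E (l # w) (s # ss) = edge_sign E (walk_edge l s (hd ss)) * walk_sign E w ss"
  unfolding walk_sign_def by (simp add: prod.lessThan_Suc_shift edge_at_def hd_conv_nth del:
      prod.lessThan_Suc)

lemma Z_entry_eq: "Z_entry E a b =
    (if disjoint_states a b then edge_sign E {fst a, fst b} * edge_sign E {snd a, fst b} *
        edge_sign E {snd a, snd b} else 0)"
  by (cases a; cases b) (simp only: Z_entry_def disjoint_states_def ends_def prod.case fst_conv
      snd_conv)

lemma walk_sign_gram_block:
  assumes "ss \<noteq> []" "hd ss = d" "disjoint_states a b" "disjoint_states a d"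
  shows "walk_sign E (gram_word (Suc k)) (gram_block b a d @ ss) =
    Z_entry E a b * Z_entry E a d * walk_sign E (gram_word k) ss"
  using assms by (simp add: gram_block_def walk_sign_Cons insert_commute mult_ac Z_entry_eq)

lemma kernel_eq_walk_sum: "gram_kernel E n k b c =
    (\<Sum>ss\<in>gram_walks n k b c. walk_sign E (gram_word k) ss)"
proof (induction k arbitrary: b)
  case 0
  show ?case by simp
next
  case (Suc k)
  let ?A = "\<lambda>d. {a \<in> pairs n. disjoint_states a b \<and> disjoint_states a d}"
  have Z0: "Z_entry E a x = 0" if "\<not> disjoint_states a x" for a x
    using that by (simp add: Z_entry_eq)
  have blk: "(\<Sum>ss\<in>(\<lambda>ss. gram_block b a d @ ss) ` gram_walks n k d c. walk_sign E (gram_word (Suc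
      k)) ss)
      = Z_entry E a b * Z_entry E a d * gram_kernel E n k d c" if "a \<in> ?A d" for a d
  proof -
    have "(\<Sum>ss\<in>(\<lambda>ss. gram_block b a d @ ss) ` gram_walks n k d c. walk_sign E (gram_word (Suc k))
        ss)
      = (\<Sum>ss\<in>gram_walks n k d c. walk_sign E (gram_word (Suc k)) (gram_block b a d @ ss))"
      by (subst sum.reindex) (auto simp: inj_on_def)
    also have "\<dots> = (\<Sum>ss\<in>gram_walks n k d c. Z_entry E a b * Z_entry E a d * walk_sign E (gram_word
        k) ss)"
      using that hd_gram_walks[of _ n k d c] by (intro sum.cong refl walk_sign_gram_block) auto
    finally show ?thesis by (simp add: Suc.IH sum_distrib_left)
  qed
  have inner: "(\<Sum>ss\<in>(\<Union>a\<in>?A d. (\<lambda>ss. gram_block b a d @ ss) ` gram_walks n k d c). walk_sign E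
      (gram_word (Suc k)) ss)
      = (\<Sum>a\<in>?A d. Z_entry E a b * Z_entry E a d * gram_kernel E n k d c)" for d
  proof -
    have "(\<Sum>ss\<in>(\<Union>a\<in>?A d. (\<lambda>ss. gram_block b a d @ ss) ` gram_walks n k d c). walk_sign E
        (gram_word (Suc k)) ss)
      = (\<Sum>a\<in>?A d. \<Sum>ss\<in>(\<lambda>ss. gram_block b a d @ ss) ` gram_walks n k d c. walk_sign E (gram_word
          (Suc k)) ss)"
      by (rule sum.UNION_disjoint) (auto simp: gram_block_def)
    also have "\<dots> = (\<Sum>a\<in>?A d. Z_entry E a b * Z_entry E a d * gram_kernel E n k d c)"
      by (rule sum.cong[OF refl], rule blk)
    finally show ?thesis .
  qed
  have "(\<Sum>ss\<in>gram_walks n (Suc k) b c. walk_sign E (gram_word (Suc k)) ss) =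
      (\<Sum>d\<in>pairs n. \<Sum>a\<in>?A d. Z_entry E a b * Z_entry E a d * gram_kernel E n k d c)"
  proof -
    have "\<forall>i\<in>pairs n. \<forall>j\<in>pairs n. i \<noteq> j \<longrightarrow>
        (\<Union>a\<in>?A i. (\<lambda>ss. gram_block b a i @ ss) ` gram_walks n k i c) \<inter>
        (\<Union>a\<in>?A j. (\<lambda>ss. gram_block b a j @ ss) ` gram_walks n k j c) = {}"
    proof (intro ballI impI equals0I)
      fix i j x assume "i \<noteq> j" "x \<in> (\<Union>a\<in>?A i. (\<lambda>ss. gram_block b a i @ ss) ` gram_walks n k i c) \<inter>
        (\<Union>a\<in>?A j. (\<lambda>ss. gram_block b a j @ ss) ` gram_walks n k j c)"
      then obtain a a' ss ss' where "x = gram_block b a i @ ss" "ss \<in> gram_walks n k i c"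
        "x = gram_block b a' j @ ss'" "ss' \<in> gram_walks n k j c" by blast
      thus False using \<open>i \<noteq> j\<close> hd_gram_walks[of ss n k i c] hd_gram_walks[of ss' n k j c]
        by (auto simp: gram_block_def)
    qed
    hence "(\<Sum>ss\<in>gram_walks n (Suc k) b c. walk_sign E (gram_word (Suc k)) ss) =
      (\<Sum>d\<in>pairs n. \<Sum>ss\<in>(\<Union>a\<in>?A d. (\<lambda>ss. gram_block b a d @ ss) ` gram_walks n k d c). walk_sign E
          (gram_word (Suc k)) ss)"
      unfolding gram_walks.simps by (intro sum.UNION_disjoint) auto
    thus ?thesis by (simp only: inner)
  qed
  also have "\<dots> = (\<Sum>d\<in>pairs n. \<Sum>a\<in>pairs n. Z_entry E a b * Z_entry E a d * gram_kernel E n k d c)"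
  proof (rule sum.cong[OF refl], rule sum.mono_neutral_left)
    fix d
    show "\<forall>a\<in>pairs n - ?A d. Z_entry E a b * Z_entry E a d * gram_kernel E n k d c = 0"
    proof
      fix a assume "a \<in> pairs n - ?A d"
      hence "\<not> disjoint_states a b \<or> \<not> disjoint_states a d" by blast
      thus "Z_entry E a b * Z_entry E a d * gram_kernel E n k d c = 0" using Z0
          by (elim disjE) simp_all
    qed
  qed auto
  also have "\<dots> = gram_kernel E n (Suc k) b c" by (simp add: sum_distrib_right)
  finally show ?case ..
qed

lemma gram_walks_walk:
  assumes "ss \<in> gram_walks n k b c" "b \<in> pairs n"
  shows "walk (gram_word k) ss \<and> hd ss = b \<and> last ss = c \<and> verts ss \<subseteq> {1..n}"
  using assms
proof (induction k arbitrary: b ss)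
  case 0
  thus ?case by (auto simp: walk_def mem_pairs verts_def ends_def split: if_splits)
next
  case (Suc k)
  then obtain d a ss' where s: "d \<in> pairs n" "a \<in> pairs n" "disjoint_states a b"
      "disjoint_states a d"
    "ss = gram_block b a d @ ss'" "ss' \<in> gram_walks n k d c" by auto
  have IH: "walk (gram_word k) ss'" "hd ss' = d" "last ss' = c" "verts ss' \<subseteq> {1..n}"
    using Suc.IH[OF s(6,1)] by auto
  have ne: "ss' \<noteq> []" using IH(1) by (rule walk_nonempty)
  have "walk (gram_word (Suc k)) ss"
    using s IH ne Suc.prems(2) by (auto simp: gram_block_def walk_Cons mem_pairs
        disjoint_states_def ends_def)
  moreover have "verts ss \<subseteq> {1..n}"
    using s IH Suc.prems(2) by (auto simp: gram_block_def mem_pairs ends_def)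
  ultimately show ?case using s IH ne by (simp add: gram_block_def)
qed

text \<open>The additional disjointness required by the entries of the matrix holds
    if the walkers visit disjoint
sets of vertices; hence it is automatic for tight walks.\<close>

lemma walk_in_gram_walks:
  assumes "walk (gram_word k) ss" "verts ss \<subseteq> {1..n}"
    and "\<And>s s'. s \<in> set ss \<Longrightarrow> s' \<in> set ss \<Longrightarrow> fst s \<noteq> snd s'"
  shows "ss \<in> gram_walks n k (hd ss) (last ss)"
  using assms
proof (induction k arbitrary: ss)
  case 0
  thus ?case by (auto simp: walk_Nil)
next
  case (Suc k)
  from walk_length[OF Suc.prems(1)] obtain s0 s1 s2 s3 s4 s5 ss' where
    ss: "ss = s0 # s1 # s2 # s3 # s4 # s5 # ss'" and "ss' \<noteq> []"
    by (auto simp: length_Suc_conv)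
  note ne = \<open>ss' \<noteq> []\<close>
  define d where "d = hd ss'"
  have dm: "d \<in> set ss'" using ne by (simp add: d_def)
  have w: "walk_step Second s0 s1" "s2 = s1" "walk_step First s2 s3" "walk_step First s3 s4" "s5 =
      s4"
    "walk_step Second s5 d" "walk (gram_word k) ss'"
    using Suc.prems(1) ne by (auto simp: ss walk_Cons d_def)
  have IH: "ss' \<in> gram_walks n k d (last ss')"
    unfolding d_def using Suc.prems(2,3) by (intro Suc.IH w(7)) (auto simp: ss)
  have eqs: "s1 = (fst s0, snd s3)" "s4 = (fst d, snd s3)" using w by (auto simp: prod_eq_iff)
  have block: "ss = gram_block s0 s3 d @ ss'"
    using w eqs by (simp add: ss gram_block_def)
  have sub: "ends d \<subseteq> {1..n}" using Suc.prems(2) dm by (auto simp: ss verts_def)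
  have dp: "d \<in> pairs n" and sp: "s3 \<in> pairs n"
    using Suc.prems(2) Suc.prems(3)[of d d] Suc.prems(3)[of s3 s3] dm sub
        by (auto simp: ss mem_pairs ends_def)
  have dis: "disjoint_states s3 s0" "disjoint_states s3 d"
    using w Suc.prems(3)[of s3 s0] Suc.prems(3)[of s0 s3] Suc.prems(3)[of s3 d] Suc.prems(3)[of d
        s3] dm
    by (auto simp: ss disjoint_states_def ends_def)
  have im: "ss \<in> (\<lambda>ss. gram_block s0 s3 d @ ss) ` gram_walks n k d (last ss')"
    using IH block by blast
  have hl: "hd ss = s0" "last ss = last ss'" using ne by (simp_all add: ss)
  show ?case unfolding gram_walks.simps hl
    by (rule UN_I[OF dp], rule UN_I[of s3]) (intro CollectI conjI sp dis, rule im)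
qed

definition closed_gram_walks :: "nat \<Rightarrow> nat \<Rightarrow> nat state list set" where
  "closed_gram_walks n k = (\<Union>b\<in>pairs n. gram_walks n k b b)"

definition gram_trace :: "nat \<Rightarrow> nat \<Rightarrow> nat set set \<Rightarrow> real" where
  "gram_trace n k E = trace_mat ((transpose_mat (Z_matrix n E) * Z_matrix n E) ^\<^sub>m k)"

lemma gram_trace_eq: "gram_trace n k E = (\<Sum>ss\<in>closed_gram_walks n k. walk_sign E (gram_word k) ss)"
proof -
  have "(\<Sum>ss\<in>closed_gram_walks n k. walk_sign E (gram_word k) ss) =
      (\<Sum>b\<in>pairs n. \<Sum>ss\<in>gram_walks n k b b. walk_sign E (gram_word k) ss)"
    unfolding closed_gram_walks_def
  proof (rule sum.UNION_disjoint)
    show "\<forall>i\<in>pairs n. \<forall>j\<in>pairs n. i \<noteq> j \<longrightarrow> gram_walks n k i i \<inter> gram_walks n k j j = {}"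
    proof (intro ballI impI equals0I)
      fix i j x assume "i \<noteq> j" "x \<in> gram_walks n k i i \<inter> gram_walks n k j j"
      thus False using hd_gram_walks[of x n k i i] hd_gram_walks[of x n k j j] by simp
    qed
  qed simp_all
  thus ?thesis by (simp add: gram_trace_def trace_pow_gram kernel_eq_walk_sum)
qed

lemma closed_gram_walksD:
  assumes "ss \<in> closed_gram_walks n k"
  shows "closed_walk (gram_word k) ss" "verts ss \<subseteq> {1..n}" "hd ss \<in> pairs n"
proof -
  obtain b where b: "b \<in> pairs n" "ss \<in> gram_walks n k b b" using assms
      by (auto simp: closed_gram_walks_def)
  from gram_walks_walk[OF b(2,1)] b(1) show "closed_walk (gram_word k) ss" "verts ss \<subseteq> {1..n}"
      "hd ss \<in> pairs n"
    by (simp_all add: closed_walk_altdef)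
qed

lemma finite_closed_gram_walks [simp]: "finite (closed_gram_walks n k)"
  by (simp add: closed_gram_walks_def)

lemma moves_gram_word: "moves (gram_word k) = 4 * k"
  by (induction k) simp_all

lemma walk_limit_gram_word: "walk_limit (gram_word k) (fuss_catalan k)"
proof -
  have "gram_word k = map swap_letter (P_word k)"
    by (simp add: gram_word_def P_word_def map_concat)
  thus ?thesis using walk_limit_swap walk_limits by metis
qed

lemma mean_gram_trace: "mean n (gram_trace n k) =
    card {ss \<in> closed_gram_walks n k. odd_edges (gram_word k) ss = {}}"
proof -
  have "mean n (gram_trace n k) = (\<Sum>ss\<in>closed_gram_walks n k.
      if odd_edges (gram_word k) ss = {} then 1 else 0)"
    unfolding gram_trace_eq[abs_def] mean_sum
    using closed_gram_walksD by (intro sum.cong refl mean_walk_sign) (auto simp: closed_walk_def)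
  thus ?thesis by (simp add: sum.inter_filter[symmetric])
qed

text \<open>Because of this additional disjointness the mean counts only some of the even walks, but among
them all the tight ones.\<close>

lemma mean_gram_trace_bounds:
  fixes n k :: nat
  assumes n: "2 \<le> n"
  defines "w \<equiv> gram_word k"
  shows "mean n (gram_trace n k) \<le> real (n * (n - 1)) * card (even_walks n w 1 2)"
    and "real (n * (n - 1)) * card (even_walks n w 1 2) - real (\<Sum>b\<in>pairs n. card {ss \<in> even_walks
        n w (fst b) (snd b). \<not> tight_walk w ss})
      \<le> mean n (gram_trace n k)"
proof -
  let ?C = "{ss \<in> closed_gram_walks n k. odd_edges w ss = {}}"
  let ?E = "\<Union>b\<in>pairs n. even_walks n w (fst b) (snd b)"
  let ?N = "\<Union>b\<in>pairs n. {ss \<in> even_walks n w (fst b) (snd b). \<not> tight_walk w ss}"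
  have m: "mean n (gram_trace n k) = card ?C" unfolding w_def by (rule mean_gram_trace)
  have cE: "card ?E = n * (n - 1) * card (even_walks n w 1 2)"
  proof -
    have "card ?E = (\<Sum>b\<in>pairs n. card (even_walks n w (fst b) (snd b)))"
    proof (rule card_UN_disjoint)
      show "\<forall>i\<in>pairs n. \<forall>j\<in>pairs n. i \<noteq> j \<longrightarrow>
          even_walks n w (fst i) (snd i) \<inter> even_walks n w (fst j) (snd j) = {}"
        by (auto simp: even_walks_def)
    qed simp_all
    also have "\<dots> = (\<Sum>b\<in>pairs n. card (even_walks n w 1 2))"
      by (intro sum.cong refl card_even_walks_start) (auto simp: mem_pairs)
    finally show ?thesis by (simp add: card_pairs)
  qed
  have "?C \<subseteq> ?E"
  proof
    fix ss assume ss: "ss \<in> ?C"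
    hence "even_walk w ss" using closed_gram_walksD[of ss n k]
        by (simp add: w_def even_walk_iff_odd_edges)
    thus "ss \<in> ?E" using ss closed_gram_walksD[of ss n k] by (auto simp: even_walks_def)
  qed
  hence "card ?C \<le> card ?E" by (intro card_mono) auto
  thus "mean n (gram_trace n k) \<le> real (n * (n - 1)) * card (even_walks n w 1 2)"
    unfolding m cE of_nat_mult[symmetric] of_nat_le_iff .
  have "?E \<subseteq> ?C \<union> ?N"
  proof
    fix ss assume "ss \<in> ?E"
    then obtain b where b: "b \<in> pairs n" "ss \<in> even_walks n w (fst b) (snd b)" by blast
    hence ss: "even_walk w ss" "hd ss = b" "verts ss \<subseteq> {1..n}" by (auto simp: even_walks_def)
    show "ss \<in> ?C \<union> ?N"
    proof (cases "tight_walk w ss")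
      case True
      have wk: "walk w ss" "last ss = hd ss" using ss(1) by (auto simp: even_walk_altdef)
      have ap: "fst s \<noteq> snd s'" if "s \<in> set ss" "s' \<in> set ss" for s s'
        using tight_apart[OF True] that walk_length[OF wk(1)]
            by (auto simp: in_set_conv_nth less_Suc_eq_le)
      have "ss \<in> gram_walks n k (hd ss) (last ss)"
        by (rule walk_in_gram_walks) (use wk ss ap in \<open>auto simp: w_def\<close>)
      hence "ss \<in> closed_gram_walks n k" using wk b ss by (auto simp: closed_gram_walks_def)
      thus ?thesis using ss(1) by (simp add: even_walk_iff_odd_edges)
    qed (use b in blast)
  qed
  hence "card ?E \<le> card (?C \<union> ?N)" by (intro card_mono) auto
  also have "\<dots> \<le> card ?C + card ?N" by (rule card_Un_le)
  also have "card ?N \<le> (\<Sum>b\<in>pairs n. card {ss \<in> even_walks n w (fst b) (snd b). \<not> tight_walk w ss})"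
    by (rule card_UN_le) simp
  finally have "real (card ?E) \<le> real (card ?C +
      (\<Sum>b\<in>pairs n. card {ss \<in> even_walks n w (fst b) (snd b). \<not> tight_walk w ss}))"
    by (simp only: of_nat_le_iff)
  thus "real (n * (n - 1)) * card (even_walks n w 1 2) - real (\<Sum>b\<in>pairs n. card {ss \<in> even_walks n
      w (fst b) (snd b). \<not> tight_walk w ss})
      \<le> mean n (gram_trace n k)"
    unfolding m cE by simp
qed

text \<open>The even moment of order \<open>2 * k\<close> of the singular value distribution of \<open>1/n\<close> times the
    matrix; see
\<open>sv_distribution_Z\<close>.\<close>

definition gram_moment :: "nat \<Rightarrow> nat \<Rightarrow> nat set set \<Rightarrow> real" where
  "gram_moment n k E = gram_trace n k E / (real (n * (n - 1)) * real n ^ (2 * k))"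

text \<open>The walks that are not tight do not affect the limit, so both bounds of
    \<open>mean_gram_trace_bounds\<close> give
\<open>walk_limit_gram_word\<close>.\<close>

theorem mean_gram_moment: "(\<lambda>n. mean n (gram_moment n k)) \<longlonglongrightarrow> fuss_catalan k"
proof -
  define w where "w = gram_word k"
  define K where "K = (moves w div 2 + 3) ^ (2 * Suc (length w))"
  let ?a = "\<lambda>n. real (card (even_walks n w 1 2)) / real n ^ (2 * k)"
  have m2: "moves w div 2 = 2 * k" by (simp add: w_def moves_gram_word)
  have lim: "?a \<longlonglongrightarrow> fuss_catalan k"
    using walk_limit_gram_word[of k] unfolding walk_limit_def w_def[symmetric] m2 .
  have mm: "mean n (gram_moment n k) = mean n (gram_trace n k) / (real (n * (n - 1)) * real n ^ (2
      * k))" for n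
    by (simp add: gram_moment_def[abs_def] mean_def sum_divide_distrib mult_ac)
  have up: "mean n (gram_moment n k) \<le> ?a n" if n: "2 \<le> n" for n
  proof -
    have gen: "m / (p * q) \<le> x / q" if "m \<le> p * x" "0 < p" "0 < q" for m p q x :: real
      using that by (simp add: field_simps)
    show ?thesis unfolding mm
      by (rule gen[OF mean_gram_trace_bounds(1)[OF n, of k, folded w_def]]) (use n in simp_all)
  qed
  have lo: "?a n - real K / real n \<le> mean n (gram_moment n k)" if n: "2 \<le> n" for n
  proof -
    let ?B = "\<lambda>b. card {ss \<in> even_walks n w (fst b) (snd b). \<not> tight_walk w ss}"
    have P: "0 < real (n * (n - 1))" using n by simp
    have "real (?B b) \<le> real K / real n * real n ^ (2 * k)" for b
    proof -
      have "?B b * n \<le> K * n ^ (2 * k)"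
        using card_not_tight[of w n "fst b" "snd b"] unfolding K_def m2
            by (simp add: w_def moves_gram_word)
      from real_le_div_of_mult_le[OF this] show ?thesis using n by (simp add: divide_simps)
    qed
    hence "(\<Sum>b\<in>pairs n. real (?B b)) \<le> (\<Sum>b\<in>pairs n. real K / real n * real n ^ (2 * k))"
        by (intro sum_mono)
    also have "\<dots> = real (n * (n - 1)) * (real K / real n * real n ^ (2 * k))"
        by (simp add: card_pairs)
    finally have "real (n * (n - 1)) * card (even_walks n w 1 2) - real (n * (n - 1)) * (real K /
        real n * real n ^ (2 * k)) \<le> mean n (gram_trace n k)"
      using mean_gram_trace_bounds(2)[OF n, of k, folded w_def] by simp
    hence "(real (n * (n - 1)) * card (even_walks n w 1 2) - real (n * (n - 1)) * (real K / real n
        * real n ^ (2 * k))) / (real (n * (n - 1)) * real n ^ (2 * k)) \<le> mean n (gram_moment n k)"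
      unfolding mm using n by (intro divide_right_mono) simp_all
    also have "(real (n * (n - 1)) * card (even_walks n w 1 2) - real (n * (n - 1)) * (real K /
        real n * real n ^ (2 * k))) / (real (n * (n - 1)) * real n ^ (2 * k)) =
        ?a n - real K / real n"
    proof -
      have gen: "(p * x - p * (y * q)) / (p * q) = x / q - y" if "p \<noteq> 0" "q \<noteq> 0" for p q x y :: real
        using that by (simp add: field_simps)
      show ?thesis by (rule gen) (use P n in auto)
    qed
    finally show ?thesis .
  qed
  show ?thesis
  proof (rule real_tendsto_sandwich)
    show "\<forall>\<^sub>F n in sequentially. ?a n - real K / real n \<le> mean n (gram_moment n k)"
      using eventually_ge_at_top[of 2] by eventually_elim (rule lo)
    show "\<forall>\<^sub>F n in sequentially. mean n (gram_moment n k) \<le> ?a n"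
      using eventually_ge_at_top[of 2] by eventually_elim (rule up)
    have "(\<lambda>n. real K / real n) \<longlonglongrightarrow> 0" by real_asymp
    from tendsto_diff[OF lim this] show "(\<lambda>n. ?a n - real K / real n) \<longlonglongrightarrow> real (fuss_catalan k)"
        by simp
  qed (rule lim)
qed

text \<open>The variance of the trace is of order \<open>n^(4k+2)\<close>, whereas the square of the normalization is
    of
order \<open>n^(4k+4)\<close>.\<close>

theorem variance_gram_moment:
  obtains K where "\<And>n. 2 \<le> n \<Longrightarrow> mean n (\<lambda>E. (gram_moment n k E - mean n (gram_moment n k))\<^sup>2) \<le>
      K / (real n)\<^sup>2"
proof
  define w where "w = gram_word k"
  define K where "K = real ((moves w + 6) ^ (4 * Suc (length w)))"
  fix n :: nat assume n: "2 \<le> n"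
  define c where "c = real (n * (n - 1)) * real n ^ (2 * k)"
  let ?D = "{(ss, ss'). ss \<in> closed_gram_walks n k \<and> ss' \<in> closed_gram_walks n k \<and>
      odd_edges w ss = odd_edges w ss' \<and> odd_edges w ss \<noteq> {}}"
  have c: "c > 0" using n by (simp add: c_def)
  have "gram_moment n k E - mean n (gram_moment n k) =
      (gram_trace n k E - mean n (gram_trace n k)) / c" for E
    by (simp add: gram_moment_def[abs_def] mean_def sum_divide_distrib c_def diff_divide_distrib
        mult_ac)
  hence "mean n (\<lambda>E. (gram_moment n k E - mean n (gram_moment n k))\<^sup>2) =
      mean n (\<lambda>E. (gram_trace n k E - mean n (gram_trace n k))\<^sup>2) / c\<^sup>2"
    by (simp add: power_divide mean_def sum_divide_distrib mult_ac)
  also have "mean n (\<lambda>E. (gram_trace n k E - mean n (gram_trace n k))\<^sup>2) \<le> real (card ?D)"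
    unfolding gram_trace_eq[abs_def] w_def
    using closed_gram_walksD by (intro variance_walk_sum) auto
  also have "real (card ?D) \<le> K * real n ^ (4 * k + 2)"
  proof -
    have "card ?D * n \<le> (moves w + 6) ^ (4 * Suc (length w)) * n ^ (moves w + 3)"
      unfolding w_def using closed_gram_walksD by (intro card_matching_pairs) auto
    hence "real (card ?D * n) \<le> real ((moves w + 6) ^ (4 * Suc (length w)) * n ^ (4 * k + 3))"
      by (simp only: of_nat_le_iff w_def moves_gram_word)
    hence "real (card ?D) * real n \<le> (K * real n ^ (4 * k + 2)) * real n"
      by (simp add: K_def numeral_3_eq_3 mult_ac)
    thus ?thesis using n by (simp add: mult_ac)
  qed
  finally have "mean n (\<lambda>E. (gram_moment n k E - mean n (gram_moment n k))\<^sup>2) \<le>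
      K * real n ^ (4 * k + 2) / c\<^sup>2"
    using c by (simp add: divide_right_mono)
  also have "\<dots> \<le> (4 * K) / (real n)\<^sup>2"
  proof -
    have h: "real n / 2 \<le> real (n - 1)" using n by (simp add: of_nat_diff)
    have "real n ^ (4 * k + 2) * (real n)\<^sup>2 = 4 * (real n * (real n / 2) * real n ^ (2 * k))\<^sup>2"
    proof -
      have "real n ^ (4 * k + 2) = real n ^ (2 * k) * real n ^ (2 * k) * (real n)\<^sup>2"
        by (simp flip: power_add)
      thus ?thesis by (simp add: power2_eq_square mult_ac)
    qed
    also have "\<dots> \<le> 4 * c\<^sup>2" unfolding c_def of_nat_mult
      using h by (intro mult_left_mono power_mono mult_mono mult_right_mono) auto
    finally have "real n ^ (4 * k + 2) * (real n)\<^sup>2 \<le> 4 * c\<^sup>2" .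
    moreover have "0 \<le> K" by (simp add: K_def)
    ultimately have "K * (real n ^ (4 * k + 2) * (real n)\<^sup>2) \<le> K * (4 * c\<^sup>2)"
        by (rule mult_left_mono)
    thus ?thesis using c n by (simp add: divide_simps mult_ac)
  qed
  finally show "mean n (\<lambda>E. (gram_moment n k E - mean n (gram_moment n k))\<^sup>2) \<le>
      (4 * real ((moves (gram_word k) + 6) ^ (4 * Suc (length (gram_word k))))) / (real n)\<^sup>2"
    unfolding K_def w_def .
qed

section \<open>Singular values and traces\<close>

lemma mult_mat_entry:
  assumes "X \<in> carrier_mat n n" "Y \<in> carrier_mat n n" "i < n" "j < n"
  shows "(X * Y) $$ (i, j) = (\<Sum>l<n. X $$ (i, l) * Y $$ (l, j))"
  using assms by (simp add: scalar_prod_def atLeast0LessThan)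

lemma trace_mat_comm:
  fixes X Y :: "'a :: comm_semiring_0 Matrix.mat"
  assumes "X \<in> carrier_mat n n" "Y \<in> carrier_mat n n"
  shows "trace_mat (X * Y) = trace_mat (Y * X)"
proof -
  have "trace_mat (X * Y) = (\<Sum>i<n. \<Sum>l<n. X $$ (i, l) * Y $$ (l, i))"
    using assms by (auto simp: trace_mat_def scalar_prod_def atLeast0LessThan intro!: sum.cong)
  also have "\<dots> = (\<Sum>l<n. \<Sum>i<n. Y $$ (l, i) * X $$ (i, l))"
    by (subst sum.swap) (simp add: mult.commute)
  also have "\<dots> = trace_mat (Y * X)"
    using assms by (auto simp: trace_mat_def scalar_prod_def atLeast0LessThan intro!: sum.cong)
  finally show ?thesis .
qed

lemma pow_upper_triangular:
  fixes B :: "real Matrix.mat"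
  assumes B: "B \<in> carrier_mat n n" "upper_triangular B"
  shows "upper_triangular (B ^\<^sub>m k) \<and> (\<forall>i<n. (B ^\<^sub>m k) $$ (i, i) = (B $$ (i, i)) ^ k)"
proof (induction k)
  case 0
  thus ?case using B by (auto simp: upper_triangular_def)
next
  case (Suc k)
  let ?C = "B ^\<^sub>m k"
  have C: "?C \<in> carrier_mat n n" using B by simp
  have C0: "?C $$ (i, j) = 0" if "i < n" "j < i" for i j
    using Suc that C unfolding upper_triangular_def by auto
  have B0: "B $$ (i, j) = 0" if "i < n" "j < i" for i j
    using B that unfolding upper_triangular_def by auto
  have "(?C * B) $$ (i, j) = 0" if "i < n" "j < i" for i j
  proof -
    have "(?C * B) $$ (i, j) = (\<Sum>l<n. ?C $$ (i, l) * B $$ (l, j))"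
      using that by (intro mult_mat_entry[OF C B(1)]) auto
    also have "\<dots> = 0"
    proof (rule sum.neutral, rule ballI)
      fix l assume "l \<in> {..<n}"
      thus "?C $$ (i, l) * B $$ (l, j) = 0" using C0[of i l] B0[of l j] that by (cases "l < i") auto
    qed
    finally show ?thesis .
  qed
  moreover have "(?C * B) $$ (i, i) = B $$ (i, i) ^ Suc k" if "i < n" for i
  proof -
    have "(?C * B) $$ (i, i) = (\<Sum>l<n. ?C $$ (i, l) * B $$ (l, i))"
      using that by (intro mult_mat_entry[OF C B(1)]) auto
    also have "\<dots> = (\<Sum>l\<in>{i}. ?C $$ (i, l) * B $$ (l, i))"
    proof (rule sum.mono_neutral_right)
      show "\<forall>l\<in>{..<n} - {i}. ?C $$ (i, l) * B $$ (l, i) = 0"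
      proof
        fix l assume "l \<in> {..<n} - {i}"
        thus "?C $$ (i, l) * B $$ (l, i) = 0" using C0[of i l] B0[of l i] that
            by (cases "l < i") auto
      qed
    qed (use that in auto)
    finally show ?thesis using Suc that by (simp add: mult.commute)
  qed
  ultimately show ?case using B C by (simp add: upper_triangular_def)
qed

text \<open>The powers of the triangular matrix in a Schur decomposition have the powers of the
    eigenvalues on the
diagonal.\<close>

theorem trace_pow_eq_sum_eigenvalues:
  fixes A :: "real Matrix.mat"
  assumes A: "A \<in> carrier_mat n n" and cp: "char_poly A = (\<Prod>e\<leftarrow>es. [:- e, 1:])"
  shows "trace_mat (A ^\<^sub>m k) = (\<Sum>e\<leftarrow>es. e ^ k)"
proof -
  obtain B P Q where d: "schur_decomposition A es = (B, P, Q)"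
      by (cases "schur_decomposition A es") auto
  from schur_decomposition[OF A cp d] have wit: "similar_mat_wit A B P Q" "upper_triangular B"
      "diag_mat B = es" by auto
  from similar_mat_witD2[OF A wit(1)] have c: "B \<in> carrier_mat n n" "P \<in> carrier_mat n n"
      "Q \<in> carrier_mat n n" "Q * P = 1\<^sub>m n"
    by auto
  have Bk: "B ^\<^sub>m k \<in> carrier_mat n n" using c by simp
  have "trace_mat (A ^\<^sub>m k) = trace_mat ((P * B ^\<^sub>m k) * Q)"
      using similar_mat_wit_pow_id[OF wit(1)] by simp
  also have "\<dots> = trace_mat (Q * (P * B ^\<^sub>m k))" using c Bk by (intro trace_mat_comm[of _ n]) auto
  also have "Q * (P * B ^\<^sub>m k) = (Q * P) * B ^\<^sub>m k" using c Bk
      by (intro assoc_mult_mat[symmetric, of _ n n _ n _ n]) auto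
  also have "\<dots> = B ^\<^sub>m k" using c Bk by simp
  also have "trace_mat (B ^\<^sub>m k) = (\<Sum>i<n. (B $$ (i, i)) ^ k)"
    using pow_upper_triangular[OF c(1) wit(2), of k] c by (simp add: trace_mat_def)
  also have "\<dots> = (\<Sum>e\<leftarrow>diag_mat B. e ^ k)"
    using c by (simp add: diag_mat_def comp_def sum_list_sum_nth atLeast0LessThan)
  finally show ?thesis using wit(3) by simp
qed

text \<open>For an eigenvector \<open>v\<close> the eigenvalue is the quotient of the squared norms of \<open>M v\<close> and \<open>v\<close>.\<close>

lemma gram_eigenvalue_nonneg:
  fixes M :: "real Matrix.mat"
  assumes M: "M \<in> carrier_mat n n"
    and ev: "eigenvalue (map_mat complex_of_real (transpose_mat M * M)) a"
  shows "a = complex_of_real (Re a) \<and> 0 \<le> Re a"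
proof -
  let ?A = "transpose_mat M * M"
  let ?C = "map_mat complex_of_real ?A"
  have A: "?A \<in> carrier_mat n n" using M by simp
  obtain v where "eigenvector ?C v a" using ev by (auto simp: eigenvalue_def)
  hence v: "v \<in> carrier_vec n" "v \<noteq> 0\<^sub>v n" "?C *\<^sub>v v = a \<cdot>\<^sub>v v" using A M
      by (auto simp: eigenvector_def)
  have row: "(\<Sum>j<n. complex_of_real (?A $$ (i, j)) * v $ j) = a * v $ i" if "i < n" for i
  proof -
    have "(?C *\<^sub>v v) $ i = (\<Sum>j<n. complex_of_real (?A $$ (i, j)) * v $ j)"
      using that A v(1) M by (simp add: scalar_prod_def atLeast0LessThan)
    thus ?thesis using v that by simp
  qed
  define y where "y l = (\<Sum>j<n. complex_of_real (M $$ (l, j)) * v $ j)" for l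
  define q where "q = (\<Sum>i<n. (cmod (v $ i))\<^sup>2)"
  have entry: "?A $$ (i, j) = (\<Sum>l<n. M $$ (l, i) * M $$ (l, j))" if "i < n" "j < n" for i j
    using that M by (simp add: scalar_prod_def atLeast0LessThan)
  have "a * complex_of_real q = (\<Sum>i<n. cnj (v $ i) * (a * v $ i))"
    unfolding q_def of_real_sum complex_norm_square sum_distrib_left by (simp only: mult_ac)
  also have "\<dots> = (\<Sum>i<n. cnj (v $ i) * (\<Sum>j<n. complex_of_real (?A $$ (i, j)) * v $ j))"
    using row by simp
  also have "\<dots> = (\<Sum>i<n. cnj (v $ i) * (\<Sum>j<n. (\<Sum>l<n. complex_of_real (M $$ (l, i)) *
      complex_of_real (M $$ (l, j))) * v $ j))"
    using entry by simp
  also have "\<dots> = (\<Sum>i<n. \<Sum>j<n. \<Sum>l<n. (complex_of_real (M $$ (l, i)) * cnj (v $ i)) *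
      (complex_of_real (M $$ (l, j)) * v $ j))"
    by (simp add: sum_distrib_left sum_distrib_right mult_ac)
  also have "\<dots> = (\<Sum>i<n. \<Sum>l<n. \<Sum>j<n. (complex_of_real (M $$ (l, i)) * cnj (v $ i)) *
      (complex_of_real (M $$ (l, j)) * v $ j))"
    by (rule sum.cong[OF refl], rule sum.swap)
  also have "\<dots> = (\<Sum>l<n. \<Sum>i<n. \<Sum>j<n. (complex_of_real (M $$ (l, i)) * cnj (v $ i)) *
      (complex_of_real (M $$ (l, j)) * v $ j))"
    by (rule sum.swap)
  also have "\<dots> = (\<Sum>l<n. cnj (y l) * y l)"
    unfolding y_def cnj_sum sum_product by simp
  also have "\<dots> = complex_of_real (\<Sum>l<n. (cmod (y l))\<^sup>2)"
    unfolding of_real_sum complex_norm_square by (simp only: mult.commute)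
  finally have eq: "a * complex_of_real q = complex_of_real (\<Sum>l<n. (cmod (y l))\<^sup>2)" .
  have "q \<noteq> 0"
  proof
    assume "q = 0"
    hence "\<forall>i<n. v $ i = 0" unfolding q_def by (subst (asm) sum_nonneg_eq_0_iff) auto
    hence "v = 0\<^sub>v n" using v(1) by (intro eq_vecI) auto
    thus False using v(2) by simp
  qed
  hence "0 < q" by (simp add: q_def sum_nonneg less_le)
  have "a = complex_of_real ((\<Sum>l<n. (cmod (y l))\<^sup>2) / q)"
    using eq \<open>q \<noteq> 0\<close> by (simp add: field_simps)
  moreover have "0 \<le> (\<Sum>l<n. (cmod (y l))\<^sup>2) / q" using \<open>0 < q\<close> by (simp add: sum_nonneg)
  ultimately show ?thesis by (metis Re_complex_of_real)
qed

lemma map_poly_of_real_linear_factors: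
  "map_poly complex_of_real (\<Prod>e\<leftarrow>es. [:- e, 1:]) = (\<Prod>e\<leftarrow>es. [:- complex_of_real e, 1:])"
proof (induction es)
  case (Cons e es)
  interpret map_poly_comm_ring_hom complex_of_real ..
  have "map_poly complex_of_real ([:- e, 1:] * (\<Prod>e\<leftarrow>es. [:- e, 1:])) =
      map_poly complex_of_real [:- e, 1:] * map_poly complex_of_real (\<Prod>e\<leftarrow>es. [:- e, 1:])"
    by (rule hom_mult)
  thus ?case using Cons by (simp del: mult_pCons_left)
qed simp

text \<open>The characteristic polynomial splits over the complex numbers, with real roots.\<close>

theorem char_poly_gram:
  fixes M :: "real Matrix.mat"
  assumes M: "M \<in> carrier_mat n n"
  obtains es where "char_poly (transpose_mat M * M) = (\<Prod>e\<leftarrow>es. [:- e, 1:])" "length es = n"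
      "\<forall>e\<in>set es. 0 \<le> e"
proof -
  let ?A = "transpose_mat M * M"
  let ?C = "map_mat complex_of_real ?A"
  have A: "?A \<in> carrier_mat n n" and C: "?C \<in> carrier_mat n n" using M by auto
  obtain as where as: "char_poly ?C = (\<Prod>a\<leftarrow>as. [:- a, 1:])" "length as = n"
      using char_poly_factorized[OF C] by blast
  have nn: "a = complex_of_real (Re a) \<and> 0 \<le> Re a" if "a \<in> set as" for a
  proof (rule gram_eigenvalue_nonneg[OF M])
    have "poly (char_poly ?C) a = 0" unfolding as(1) using that by (induction as) auto
    thus "eigenvalue ?C a" using eigenvalue_root_char_poly[OF C] by simp
  qed
  define es where "es = map Re as"
  have as': "map complex_of_real es = as" unfolding es_def using nn by (simp add: map_idI)
  have "(\<Prod>e\<leftarrow>es. [:- complex_of_real e, 1:]) = (\<Prod>a\<leftarrow>map complex_of_real es. [:- a, 1:])"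
    by (simp add: comp_def)
  hence "map_poly complex_of_real (char_poly ?A) = map_poly complex_of_real (\<Prod>e\<leftarrow>es. [:- e, 1:])"
    unfolding map_poly_of_real_linear_factors of_real_hom.char_poly_hom[OF A, symmetric] as(1) as'
    by (rule sym)
  hence "char_poly ?A = (\<Prod>e\<leftarrow>es. [:- e, 1:])"
    by (simp add: poly_eq_iff coeff_map_poly)
  thus ?thesis using that[of es] as(2) nn by (auto simp: es_def)
qed

lemma proots_linear_factors: "proots (\<Prod>e\<leftarrow>es. [:- e, 1:]) = mset (es :: real list)"
proof (induction es)
  case (Cons e es)
  have "(\<Prod>e\<leftarrow>es. [:- e, 1:]) \<noteq> (0 :: real poly)" by (induction es) (auto simp del: mult_pCons_left)
  thus ?case using Cons by (simp add: proots_mult del: mult_pCons_left)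
qed simp

theorem singular_values_props:
  assumes M: "M \<in> carrier_mat n n"
  shows "size (singular_values M) = n" "\<forall>x\<in>#singular_values M. 0 \<le> x"
    "(\<Sum>x\<in>#singular_values M. x ^ (2 * k)) = trace_mat ((transpose_mat M * M) ^\<^sub>m k)"
proof -
  obtain es where es: "char_poly (transpose_mat M * M) = (\<Prod>e\<leftarrow>es. [:- e, 1:])" "length es = n"
      "\<forall>e\<in>set es. 0 \<le> e"
    by (rule char_poly_gram[OF M])
  have sv: "singular_values M = mset (map sqrt es)"
    by (simp add: singular_values_def es(1) proots_linear_factors)
  show "size (singular_values M) = n" "\<forall>x\<in>#singular_values M. 0 \<le> x" using es by (auto simp: sv)
  have "(\<Sum>x\<in>#singular_values M. x ^ (2 * k)) = (\<Sum>e\<leftarrow>es. sqrt e ^ (2 * k))"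
    unfolding sv by (simp only: mset_map[symmetric] sum_mset_sum_list map_map comp_def)
  also have "\<dots> = (\<Sum>e\<leftarrow>es. e ^ k)"
    using es(3) by (intro arg_cong[of _ _ sum_list] map_cong refl) (simp add: power_mult)
  also have "\<dots> = trace_mat ((transpose_mat M * M) ^\<^sub>m k)"
    using trace_pow_eq_sum_eigenvalues[OF _ es(1), of n k] M by simp
  finally show "(\<Sum>x\<in>#singular_values M. x ^ (2 * k)) = trace_mat ((transpose_mat M * M) ^\<^sub>m k)" .
qed

lemma pow_smult_mat:
  fixes A :: "real Matrix.mat"
  assumes "A \<in> carrier_mat n n"
  shows "(c \<cdot>\<^sub>m A) ^\<^sub>m k = c ^ k \<cdot>\<^sub>m (A ^\<^sub>m k)"
proof (induction k)
  case 0
  show ?case by (rule eq_matI) (use assms in auto)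
next
  case (Suc k)
  have "(c \<cdot>\<^sub>m A) ^\<^sub>m Suc k = (c ^ k \<cdot>\<^sub>m (A ^\<^sub>m k)) * (c \<cdot>\<^sub>m A)" using Suc by simp
  also have "\<dots> = c ^ Suc k \<cdot>\<^sub>m (A ^\<^sub>m k * A)"
    by (rule eq_matI) (use assms in \<open>auto simp: scalar_prod_def sum_distrib_left mult_ac\<close>)
  finally show ?case by simp
qed

lemma trace_gram_scaled:
  fixes M :: "real Matrix.mat"
  assumes "M \<in> carrier_mat n n"
  shows "trace_mat ((transpose_mat (c \<cdot>\<^sub>m M) * (c \<cdot>\<^sub>m M)) ^\<^sub>m k) =
      c ^ (2 * k) * trace_mat ((transpose_mat M * M) ^\<^sub>m k)"
proof -
  have "transpose_mat (c \<cdot>\<^sub>m M) * (c \<cdot>\<^sub>m M) = c\<^sup>2 \<cdot>\<^sub>m (transpose_mat M * M)"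
    by (rule eq_matI) (use assms in \<open>auto simp: scalar_prod_def sum_distrib_left power2_eq_square
        mult_ac\<close>)
  moreover have "transpose_mat M * M \<in> carrier_mat n n" using assms by simp
  ultimately show ?thesis using assms
    by (simp add: pow_smult_mat[of _ n] trace_mat_def sum_distrib_left power_mult)
qed

section \<open>The limit density and its moments\<close>

text \<open>With \<open>x = spectral_edge * sin t\<close> the auxiliary functions become elementary: \<open>arc_height\<close> is
    \<open>cos t\<close>, \<open>arc_log\<close> is
\<open>2 ln (cot (t/2))\<close>, and \<open>arc_param\<close> below is \<open>tan (t/2)\<close> to the power 2/3.\<close>

definition spectral_edge :: real where "spectral_edge = 3 * sqrt 3 / 2"

definition arc_height :: "real \<Rightarrow> real" where "arc_height x = sqrt (1 - 4 * x\<^sup>2 / 27)"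

definition arc_log :: "real \<Rightarrow> real" where "arc_log x = ln ((1 + arc_height x) / (1 - arc_height x))"

definition Z_density :: "real \<Rightarrow> real" where
  "Z_density x = (if 0 < x \<and> x < spectral_edge then 2 / pi * sinh (arc_log x / 6) else 0)"

lemma spectral_edge: "0 < spectral_edge" "spectral_edge\<^sup>2 = 27 / 4"
  by (simp_all add: spectral_edge_def power2_eq_square)

lemma below_spectral_edge:
  assumes "0 < x" "x < spectral_edge"
  shows "0 < 1 - 4 * x\<^sup>2 / 27"
proof -
  have "x\<^sup>2 < spectral_edge\<^sup>2" using assms by (intro power_strict_mono) auto
  thus ?thesis by (simp add: spectral_edge)
qed

lemma arc_height_bounds:
  assumes "0 < x" "x < spectral_edge"
  shows "0 < arc_height x" "arc_height x < 1" "(arc_height x)\<^sup>2 = 1 - 4 * x\<^sup>2 / 27"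
  using below_spectral_edge[OF assms] assms by (auto simp: arc_height_def)

lemma arc_log_pos:
  assumes "0 < x" "x < spectral_edge"
  shows "0 < arc_log x"
  using arc_height_bounds[OF assms] by (simp add: arc_log_def)

text \<open>The argument of the arc tangent is \<open>-\<i> / arc_height x\<close>, hence purely imaginary of modulus
    greater than 1, and the
arc tangent is \<open>-\<pi>/2 - \<i> arc_log x / 2\<close>. The combination of sine
    and cosine is \<open>2 cos (\<theta> - \<pi>/3)\<close>; the shift by
\<open>\<pi>/3\<close> completes the real part \<open>-\<pi>/6\<close> of \<open>\<theta>\<close> to \<open>-\<pi>/2\<close> and leaves a hyperbolic sine.\<close>

theorem g_Z_eq: "g_Z x = complex_of_real (Z_density x)"
proof (cases "0 < x \<and> x < spectral_edge")
  case True
  hence x: "0 < x" "x < spectral_edge" by auto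
  note q = arc_height_bounds[OF x]
  define s where "s = 1 / arc_height x"
  define y where "y = arc_log x / 6"
  have "csqrt (complex_of_real (4 * x\<^sup>2 / 3 - 9)) =
      csqrt (complex_of_real (- (9 * (1 - 4 * x\<^sup>2 / 27))))"
    by (simp add: algebra_simps)
  also have "\<dots> = \<i> * complex_of_real (sqrt (9 * (1 - 4 * x\<^sup>2 / 27)))"
    by (rule csqrt_neg) (use below_spectral_edge[OF x] in simp)
  also have "sqrt (9 * (1 - 4 * x\<^sup>2 / 27)) = 3 * arc_height x"
    unfolding arc_height_def real_sqrt_mult by simp
  finally have "3 / csqrt (complex_of_real (4 * x\<^sup>2 / 3 - 9)) =
      3 / (\<i> * complex_of_real (3 * arc_height x))" by simp
  also have "\<dots> = \<i> * complex_of_real (- s)"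
    using q by (simp add: s_def field_simps)
  finally have "Arctan (3 / csqrt (complex_of_real (4 * x\<^sup>2 / 3 - 9))) =
      \<i> / 2 * Ln (complex_of_real ((1 + (- s)) / (1 - (- s))))"
    by (simp only: Arctan_i_times)
  also have "(1 + (- s)) / (1 - (- s)) = - ((1 - arc_height x) / (1 + arc_height x))"
    using q(1) by (simp add: s_def divide_simps)
  also have "Ln (complex_of_real (- ((1 - arc_height x) / (1 + arc_height x)))) = pi * \<i> +
      Ln (complex_of_real ((1 - arc_height x) / (1 + arc_height x)))"
    by (rule Ln_neg) (use q in simp)
  also have "Ln (complex_of_real ((1 - arc_height x) / (1 + arc_height x))) =
      complex_of_real (ln ((1 - arc_height x) / (1 + arc_height x)))"
    by (rule Ln_of_real) (use q in simp)
  also have "ln ((1 - arc_height x) / (1 + arc_height x)) = - arc_log x"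
    using q by (simp add: arc_log_def ln_div)
  also have "\<i> / 2 * (pi * \<i> + complex_of_real (- arc_log x)) =
      - (pi / 2) - 3 * (\<i> * complex_of_real y)"
    by (simp add: y_def algebra_simps)
  finally have th: "1 / 3 * Arctan (3 / csqrt (complex_of_real (4 * x\<^sup>2 / 3 - 9))) =
      complex_of_real (- (pi / 6)) - \<i> * complex_of_real y"
    by simp
  define \<theta> where "\<theta> = complex_of_real (- (pi / 6)) - \<i> * complex_of_real y"
  have "complex_of_real (sqrt 3) * sin \<theta> + cos \<theta> = 2 * (cos \<theta> * cos (complex_of_real (pi / 3)) +
      sin \<theta> * sin (complex_of_real (pi / 3)))"
    unfolding cos_of_real sin_of_real cos_60 sin_60 by (simp add: algebra_simps)
  also have "\<dots> = 2 * cos (\<theta> - complex_of_real (pi / 3))" by (simp only: cos_diff)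
  also have "\<theta> - complex_of_real (pi / 3) = - (complex_of_real (pi / 2) + \<i> * complex_of_real y)"
    by (simp add: \<theta>_def algebra_simps)
  also have "cos \<dots> = - sin (\<i> * complex_of_real y)"
    unfolding cos_minus cos_add cos_of_real sin_of_real by simp
  also have "sin (\<i> * complex_of_real y) = \<i> * complex_of_real (sinh y)"
    by (simp add: sin_i_times sinh_field_def exp_of_real exp_minus field_simps)
  finally have "\<i> / complex_of_real pi * (complex_of_real (sqrt 3) * sin \<theta> + cos \<theta>) =
      complex_of_real (2 / pi * sinh y)"
    by (simp add: mult.left_commute)
  moreover have "g_Z x = \<i> / complex_of_real pi * (complex_of_real (sqrt 3) * sin \<theta> + cos \<theta>)"
    using x unfolding g_Z_def Let_def th \<theta>_def[symmetric] spectral_edge_def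
        by (simp only: if_True conj_absorb simp_thms)
  moreover have "Z_density x = 2 / pi * sinh y" using x by (simp add: Z_density_def y_def)
  ultimately show ?thesis by (simp only:)
qed (auto simp: g_Z_def Z_density_def spectral_edge_def)

lemma Z_density_nonneg: "0 \<le> Z_density x"
proof (cases "0 < x \<and> x < spectral_edge")
  case True
  hence "0 < sinh (arc_log x / 6)" using arc_log_pos[of x] by simp
  thus ?thesis using True by (simp add: Z_density_def)
qed (auto simp: Z_density_def)

theorem real_nonneg_g_Z: "real_nonneg g_Z"
  by (simp add: real_nonneg_def g_Z_eq Z_density_nonneg)

text \<open>Up to a factor this is the derivative of the density with respect to \<open>arc_log\<close>; the two
    functions are each other's
derivatives up to explicit factors.\<close>

definition Z_codensity :: "real \<Rightarrow> real" where "Z_codensity x =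
    - (2 / (3 * pi)) * cosh (arc_log x / 6)"

lemma arc_height_deriv:
  assumes "0 < x" "x < spectral_edge"
  shows "(arc_height has_real_derivative - (4 * x / (27 * arc_height x))) (at x)"
  unfolding arc_height_def[abs_def] using below_spectral_edge[OF assms]
  by (auto intro!: derivative_eq_intros simp: field_simps)

lemma arc_log_deriv:
  assumes "0 < x" "x < spectral_edge"
  shows "(arc_log has_real_derivative - (2 / (x * arc_height x))) (at x)"
proof -
  note q = arc_height_bounds[OF assms]
  have "(arc_log has_real_derivative
      (- (4 * x / (27 * arc_height x)) * (1 - arc_height x) + (1 +
          arc_height x) * (- (4 * x / (27 * arc_height x)))) / ((1 - arc_height x) * (1 -
          arc_height x)) / ((1 + arc_height x) / (1 - arc_height x))) (at x)"
    unfolding arc_log_def[abs_def] using q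
    by (auto intro!: derivative_eq_intros arc_height_deriv[OF assms] simp: field_simps)
  also have "(- (4 * x / (27 * arc_height x)) * (1 - arc_height x) + (1 +
      arc_height x) * (- (4 * x / (27 * arc_height x)))) / ((1 - arc_height x) * (1 - arc_height
      x)) / ((1 + arc_height x) / (1 - arc_height x))
     = - (8 * x / (27 * arc_height x)) / ((1 - arc_height x) * (1 + arc_height x))"
    using q by (simp add: divide_simps) (simp add: algebra_simps)
  also have "(1 - arc_height x) * (1 + arc_height x) = 4 * x\<^sup>2 / 27" using q(3)
      by (simp add: algebra_simps power2_eq_square)
  also have "- (8 * x / (27 * arc_height x)) / (4 * x\<^sup>2 / 27) = - (2 / (x * arc_height x))"
    using assms q by (simp add: field_simps power2_eq_square)
  finally show ?thesis .
qed

lemma Z_density_deriv: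
  assumes "0 < x" "x < spectral_edge"
  shows "(Z_density has_real_derivative Z_codensity x / (x * arc_height x)) (at x)"
proof (rule has_field_derivative_transform_within_open[of "\<lambda>x. 2 / pi * sinh (arc_log x / 6)"
    _ _ "{0<..<spectral_edge}"])
  show "((\<lambda>x. 2 / pi * sinh (arc_log x / 6)) has_real_derivative Z_codensity x / (x * arc_height
      x)) (at x)"
    by (auto intro!: derivative_eq_intros arc_log_deriv[OF assms] simp: Z_codensity_def field_simps)
qed (use assms in \<open>auto simp: Z_density_def\<close>)

lemma Z_codensity_deriv:
  assumes "0 < x" "x < spectral_edge"
  shows "(Z_codensity has_real_derivative Z_density x / (9 * x * arc_height x)) (at x)"
  unfolding Z_codensity_def[abs_def] using assms
  by (auto intro!: derivative_eq_intros arc_log_deriv[OF assms] simp: Z_density_def field_simps)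

text \<open>A parameter that is continuous up to the end points, in which the products of \<open>x\<close> with the
    density and the
codensity are rational functions.\<close>

definition arc_param :: "real \<Rightarrow> real" where "arc_param x = root 3 ((1 - arc_height x) / (1 +
    arc_height x))"

lemma one_plus_power_pos: "0 < s \<Longrightarrow> 0 < 1 + s ^ n" for s :: real
  by (simp add: add_pos_pos)

lemma arc_param_eqs:
  assumes "0 < x" "x < spectral_edge"
  defines "s \<equiv> exp (- arc_log x / 6)"
  shows "arc_param x = s\<^sup>2" "x = spectral_edge * (2 * s ^ 3 / (1 + s ^ 6))" "arc_height x =
      (1 - s ^ 6) / (1 + s ^ 6)"
    "Z_density x = (1 / s - s) / pi" "Z_codensity x = - (1 / s + s) / (3 * pi)" "0 < s"
proof -
  note q = arc_height_bounds[OF assms(1,2)]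
  show s: "0 < s" by (simp add: s_def)
  have "s ^ 6 = exp (- arc_log x)" by (simp add: s_def flip: exp_of_nat_mult)
  also have "\<dots> = (1 - arc_height x) / (1 + arc_height x)" using q
      by (simp add: arc_log_def exp_minus)
  finally have s6: "s ^ 6 = (1 - arc_height x) / (1 + arc_height x)" .
  have p: "1 + s ^ 6 \<noteq> 0" using one_plus_power_pos[OF s, of 6] by simp
  have "s ^ 6 * (1 + arc_height x) = 1 - arc_height x" using s6 q by simp
  hence "arc_height x * (1 + s ^ 6) = 1 - s ^ 6" by (simp add: algebra_simps)
  thus arc_height: "arc_height x = (1 - s ^ 6) / (1 + s ^ 6)" using p by (simp add: eq_divide_eq)
  have "arc_param x = root 3 ((s\<^sup>2) ^ 3)" by (simp add: arc_param_def s6[symmetric] flip: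
      power_mult)
  also have "\<dots> = s\<^sup>2" by (rule odd_real_root_power_cancel) simp
  finally show "arc_param x = s\<^sup>2" .
  have "x\<^sup>2 = 27 / 4 * (1 - (arc_height x)\<^sup>2)" using q(3) by (simp add: field_simps)
  also have "1 - (arc_height x)\<^sup>2 = (2 * s ^ 3 / (1 + s ^ 6))\<^sup>2"
    unfolding arc_height using p by (simp add: power_divide divide_simps)
        (simp add: power2_eq_square algebra_simps flip: power_add)
  finally have "x\<^sup>2 = (spectral_edge * (2 * s ^ 3 / (1 + s ^ 6)))\<^sup>2"
    by (simp only: power_mult_distrib[of spectral_edge] spectral_edge)
  moreover have "0 \<le> spectral_edge * (2 * s ^ 3 / (1 + s ^ 6))" using s spectral_edge by simp
  ultimately show "x = spectral_edge * (2 * s ^ 3 / (1 + s ^ 6))" using assms(1)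
      by (metis less_imp_le power2_eq_imp_eq)
  have e: "exp (arc_log x / 6) = 1 / s" "exp (- (arc_log x / 6)) = s"
      by (simp_all add: s_def exp_minus field_simps)
  show "Z_density x = (1 / s - s) / pi" "Z_codensity x = - (1 / s + s) / (3 * pi)"
    using assms(1,2) e s by (simp_all add: Z_density_def Z_codensity_def sinh_field_def
        cosh_field_def field_simps)
qed

lemma Z_density_arc_param:
  assumes "0 < x" "x < spectral_edge"
  shows "x * Z_density x = 2 * spectral_edge / pi * (arc_param x * (1 - arc_param x) / (1 +
      arc_param x ^ 3))"
    and "x * Z_codensity x = - (2 * spectral_edge / (3 * pi)) * (arc_param x * (1 +
        arc_param x) / (1 + arc_param x ^ 3))"
proof -
  define s where "s = exp (- arc_log x / 6)"
  note e = arc_param_eqs[OF assms, folded s_def]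
  have 6: "(s\<^sup>2) ^ 3 = s ^ 6" by (simp flip: power_mult)
  have p: "1 + s ^ 6 \<noteq> 0" using one_plus_power_pos[OF e(6), of 6] by simp
  have s3: "s ^ 3 * (1 / s - s) = s\<^sup>2 * (1 - s\<^sup>2)" "s ^ 3 * (1 / s + s) = s\<^sup>2 * (1 + s\<^sup>2)"
    using e(6) by (simp_all add: field_simps power2_eq_square power3_eq_cube)
  have "x * Z_density x = 2 * spectral_edge / pi * (s ^ 3 * (1 / s - s) / (1 + s ^ 6))"
    unfolding e(4) by (subst e(2)) (simp add: mult_ac)
  thus "x * Z_density x = 2 * spectral_edge / pi * (arc_param x * (1 - arc_param x) / (1 +
      arc_param x ^ 3))"
    unfolding e(1) 6 s3 .
  have "x * Z_codensity x = - (2 * spectral_edge / (3 * pi)) * (s ^ 3 * (1 / s + s) / (1 + s ^ 6))"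
  proof -
    define w where "w = 1 / s + s"
    have "Z_codensity x = - (w / (3 * pi))" unfolding w_def minus_divide_left by (rule e(5))
    thus ?thesis unfolding w_def[symmetric] by (subst e(2)) (simp add: mult_ac)
  qed
  thus "x * Z_codensity x = - (2 * spectral_edge / (3 * pi)) * (arc_param x * (1 +
      arc_param x) / (1 + arc_param x ^ 3))"
    unfolding e(1) 6 s3 .
qed

lemma arc_height_range:
  assumes "0 \<le> x" "x \<le> spectral_edge"
  shows "0 \<le> arc_height x" "arc_height x \<le> 1"
proof -
  have "x\<^sup>2 \<le> spectral_edge\<^sup>2" using assms by (intro power_mono) auto
  thus "0 \<le> arc_height x" by (simp add: arc_height_def spectral_edge)
  show "arc_height x \<le> 1" by (simp add: arc_height_def)
qed

lemma arc_height_ends: "arc_height 0 = 1" "arc_height spectral_edge = 0"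
  by (simp_all add: arc_height_def spectral_edge)

lemma arc_param_ends: "arc_param 0 = 0" "arc_param spectral_edge = 1"
  by (simp_all add: arc_param_def arc_height_ends)

lemma arc_param_nonneg: "0 \<le> x \<Longrightarrow> x \<le> spectral_edge \<Longrightarrow> 0 \<le> arc_param x"
  using arc_height_range[of x] by (simp add: arc_param_def)

lemma continuous_on_arc_height: "continuous_on A arc_height"
  unfolding arc_height_def[abs_def] by (intro continuous_intros) auto

lemma continuous_on_arc_param: "continuous_on {0..spectral_edge} arc_param"
  unfolding arc_param_def[abs_def]
  by (intro continuous_intros continuous_on_arc_height ballI) (use arc_height_range in fastforce)

lemma continuous_on_arc_param_quotient: "continuous_on {0..spectral_edge} (\<lambda>x. f (arc_param x) /
    (1 + arc_param x ^ 3))" if "continuous_on UNIV f"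
proof (intro continuous_intros continuous_on_arc_param ballI)
  show "continuous_on {0..spectral_edge} (\<lambda>x. f (arc_param x))"
    by (rule continuous_on_compose2[OF that continuous_on_arc_param]) simp
  fix x assume "x \<in> {0..spectral_edge}"
  hence "0 \<le> arc_param x ^ 3" using arc_param_nonneg[of x] by simp
  thus "1 + arc_param x ^ 3 \<noteq> 0" by linarith
qed

text \<open>In the parameter \<open>v = arc_param x\<close> the density becomes the rational differential
\<open>(1 - v) (1 - v\<^sup>3) / (1 + v\<^sup>3)\<^sup>2\<close>, up to the factor \<open>3 * spectral_edge / \<pi>\<close>. Partial fractions
    give the antiderivative \<open>H\<close>; its rational
part vanishes at both end points and its arc tangent increases by \<open>\<pi>/3\<close>.\<close>

lemma Z_density_integral: "(Z_density has_integral 1) {0..spectral_edge}"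
proof -
  define H where "H v = 2 / 3 * (v * (1 - v) / (1 + v ^ 3)) +
      2 / (3 * sqrt 3) * arctan ((2 * v - 1) / sqrt 3)" for v :: real
  define F where "F x = 3 * spectral_edge / pi * H (arc_param x)" for x
  have "(Z_density has_integral F spectral_edge - F 0) {0..spectral_edge}"
  proof (rule fundamental_theorem_of_calculus_interior)
    show "0 \<le> spectral_edge" using spectral_edge by simp
    define R where "R x = arc_param x * (1 - arc_param x) / (1 + arc_param x ^ 3)" for x
    have "continuous_on {0..spectral_edge} R" unfolding R_def[abs_def]
      by (rule continuous_on_arc_param_quotient[where f =
          "\<lambda>v. v * (1 - v)"]) (intro continuous_intros)
    moreover have "F = (\<lambda>x. 3 * spectral_edge / pi * (2 / 3 * R x +
        2 / (3 * sqrt 3) * arctan ((2 * arc_param x - 1) / sqrt 3)))"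
      by (simp add: F_def H_def R_def fun_eq_iff)
    ultimately show "continuous_on {0..spectral_edge} F"
      by (simp only:) (intro continuous_on_add continuous_on_mult_left continuous_on_arctan
          continuous_on_divide continuous_on_diff continuous_on_const continuous_on_arc_param,
          simp_all)
    fix x assume "x \<in> {0<..<spectral_edge}"
    hence x: "0 < x" "x < spectral_edge" by auto
    define s where "s = exp (- arc_log x / 6)"
    note e = arc_param_eqs[OF x, folded s_def]
    have v0: "0 < arc_param x" using e by simp
    have v3: "1 + arc_param x ^ 3 \<noteq> 0" using one_plus_power_pos[OF v0, of 3] by simp
    have dv: "(arc_param has_real_derivative 2 * arc_param x / (3 * x * arc_height x)) (at x)"
    proof (rule has_field_derivative_transform_within_open[of "\<lambda>x. exp (- arc_log x / 3)"
        _ _ "{0<..<spectral_edge}"])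
      have ev: "exp (- arc_log y / 3) = arc_param y" if "y \<in> {0<..<spectral_edge}" for y
        using arc_param_eqs(1)[of y] that by (simp flip: exp_of_nat_mult)
      show "((\<lambda>x. exp (- arc_log x / 3)) has_real_derivative 2 * arc_param x / (3 * x * arc_height
          x)) (at x)"
        using ev[of x] x by (auto intro!: derivative_eq_intros arc_log_deriv[OF x] simp:
            field_simps)
    qed (use x arc_param_eqs(1) in \<open>auto simp flip: exp_of_nat_mult\<close>)
    have dH: "(H has_real_derivative (1 - v) * (1 - v ^ 3) / (1 + v ^ 3)\<^sup>2) (at v)" if "0 < v" for v
    proof -
      have nz: "1 + v ^ 3 \<noteq> 0" using one_plus_power_pos[OF that, of 3] by simp
      have "0 \<le> (v - 1 / 2)\<^sup>2" by simp
      hence nz2: "1 - v + v\<^sup>2 \<noteq> 0" by (simp add: power2_eq_square algebra_simps)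
      note nz = nz nz2
      have s33: "sqrt 3 * (sqrt 3 * z) = 3 * z" for z :: real by (simp flip: mult.assoc)
      have "(H has_real_derivative 2 / 3 * (((1 - 2 * v) * (1 +
          v ^ 3) - v * (1 - v) * (3 * v\<^sup>2)) / (1 + v ^ 3)\<^sup>2)
          + 2 / (3 * sqrt 3) * (inverse (1 + ((2 * v - 1) / sqrt 3)\<^sup>2) * (2 / sqrt 3))) (at v)"
      proof -
        have "((\<lambda>v. v * (1 - v) / (1 + v ^ 3)) has_real_derivative
            ((1 - 2 * v) * (1 + v ^ 3) - v * (1 - v) * (3 * v\<^sup>2)) / (1 + v ^ 3)\<^sup>2) (at v)"
          using nz(1) by (auto intro!: derivative_eq_intros simp: power2_eq_square algebra_simps)
        moreover have "((\<lambda>v. (2 * v - 1) / sqrt 3) has_real_derivative 2 / sqrt 3) (at v)"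
          by (intro DERIV_cdivide) (auto intro!: derivative_eq_intros)
        hence "((\<lambda>v. arctan ((2 * v - 1) / sqrt 3)) has_real_derivative
            inverse (1 + ((2 * v - 1) / sqrt 3)\<^sup>2) * (2 / sqrt 3)) (at v)"
          by (rule DERIV_chain2[OF DERIV_arctan])
        ultimately show ?thesis unfolding H_def[abs_def] by (intro DERIV_add DERIV_cmult)
      qed
      also have "2 / (3 * sqrt 3) * (inverse (1 + ((2 * v - 1) / sqrt 3)\<^sup>2) * (2 / sqrt 3)) =
          1 / 3 * (1 / (1 - v + v\<^sup>2))"
        using nz(2) by (simp add: power_divide divide_simps)
            (simp add: power2_eq_square algebra_simps s33)
      also have "1 / (1 - v + v\<^sup>2) = (1 + v) * (1 + v ^ 3) / (1 + v ^ 3)\<^sup>2"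
        using nz that by (simp add: divide_simps)
            (simp add: power2_eq_square power3_eq_cube algebra_simps)
      also have "2 / 3 * (((1 - 2 * v) * (1 + v ^ 3) - v * (1 - v) * (3 * v\<^sup>2)) / (1 + v ^ 3)\<^sup>2) +
          1 / 3 * ((1 + v) * (1 + v ^ 3) / (1 + v ^ 3)\<^sup>2)
        = (1 - v) * (1 - v ^ 3) / (1 + v ^ 3)\<^sup>2"
        using nz by (simp add: divide_simps) (simp add: power2_eq_square power3_eq_cube
            algebra_simps)
      finally show ?thesis .
    qed
    have "(F has_real_derivative 3 * spectral_edge / pi * ((1 - arc_param x) * (1 - arc_param x ^
        3) / (1 + arc_param x ^ 3)\<^sup>2 * (2 * arc_param x / (3 * x * arc_height x)))) (at x)"
      unfolding F_def[abs_def] by (intro DERIV_cmult DERIV_chain2[OF dH[OF v0] dv])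
    also have "3 * spectral_edge / pi * ((1 - arc_param x) * (1 - arc_param x ^ 3) / (1 +
        arc_param x ^ 3)\<^sup>2 * (2 * arc_param x / (3 * x * arc_height x))) = Z_density x"
    proof -
      have 6: "(s\<^sup>2) ^ 3 = s ^ 6" by (simp flip: power_mult)
      have p: "1 + s ^ 6 \<noteq> 0" using v3 e(1) 6 by simp
      have m: "1 - s ^ 6 \<noteq> 0" using arc_height_bounds(1)[OF x] e(3) by auto
      have xq: "x * arc_height x = spectral_edge * (2 * s ^ 3 * (1 - s ^ 6) / (1 + s ^ 6)\<^sup>2)"
        using e(2,3) by (simp add: power2_eq_square)
      have gen: "3 * spectral_edge / pi * ((1 - s\<^sup>2) * N / P\<^sup>2 * (2 * s\<^sup>2 / (3 * (spectral_edge *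
          (2 * s ^ 3 * N / P\<^sup>2))))) = (1 / s - s) / pi"
        if "N \<noteq> 0" "P \<noteq> 0" for N P
        using that e(6) spectral_edge(1) by (simp add: divide_simps)
            (simp add: power2_eq_square power3_eq_cube)
      from gen[OF m p] show ?thesis unfolding e(1) 6 e(4) by (simp add: mult.assoc xq)
    qed
    finally show "(F has_vector_derivative Z_density x) (at x)"
      by (simp add: has_real_derivative_iff_has_vector_derivative)
  qed
  moreover have "F spectral_edge - F 0 = 1"
  proof -
    have "arctan (1 / sqrt 3) = pi / 6" using tan_30 arctan_unique[of "pi / 6" "1 / sqrt 3"] by simp
    hence "F spectral_edge - F 0 = 3 * spectral_edge / pi * (2 / (3 * sqrt 3) * (pi / 3))"
      unfolding F_def H_def arc_param_ends by (simp add: arctan_minus algebra_simps)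
    thus ?thesis by (simp add: spectral_edge_def)
  qed
  ultimately show ?thesis by simp
qed

text \<open>The integrand is the derivative of \<open>27/4 (x^(2k+1) q h - (2k+1) x^(2k+1) g) +
    (2k+2) x^(2k+3) g\<close>, where \<open>g\<close>, \<open>h\<close> and \<open>q\<close> are
the density, the codensity and \<open>arc_height\<close>. The coefficients are chosen such that the
terms with \<open>h\<close> cancel in the derivative. This function vanishes at both end points.\<close>

lemma Z_density_moment_step:
  "((\<lambda>x. real ((2 * k + 2) * (2 * k + 3)) * (x ^ (2 * k + 2) * Z_density x) - real (3 * (3 * k +
      1) * (3 * k + 2)) * (x ^ (2 * k) * Z_density x))
    has_integral 0) {0..spectral_edge}"
proof -
  let ?K = "real (2 * k)"
  define B where "B x = 2 * spectral_edge / pi * (arc_param x * (1 - arc_param x) / (1 +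
      arc_param x ^ 3))" for x
  define A where "A x = - (2 * spectral_edge / (3 * pi)) * (arc_param x * (1 + arc_param x) / (1 +
      arc_param x ^ 3))" for x
  define F where "F x = 27 / 4 * x ^ (2 * k) * (arc_height x * A x - (?K + 1) * B x) + (?K +
      2) * x ^ (2 * k + 2) * B x" for x
  let ?f = "\<lambda>x. real ((2 * k + 2) * (2 * k + 3)) * (x ^ (2 * k +
      2) * Z_density x) - real (3 * (3 * k + 1) * (3 * k + 2)) * (x ^ (2 * k) * Z_density x)"
  have "(?f has_integral F spectral_edge - F 0) {0..spectral_edge}"
  proof (rule fundamental_theorem_of_calculus_interior)
    show "0 \<le> spectral_edge" using spectral_edge by simp
    have "continuous_on {0..spectral_edge} A" unfolding A_def[abs_def]
      by (rule continuous_on_mult_left, rule continuous_on_arc_param_quotient[where f =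
          "\<lambda>v. v * (1 + v)"]) (intro continuous_intros)
    moreover have "continuous_on {0..spectral_edge} B" unfolding B_def[abs_def]
      by (rule continuous_on_mult_left, rule continuous_on_arc_param_quotient[where f =
          "\<lambda>v. v * (1 - v)"]) (intro continuous_intros)
    ultimately show "continuous_on {0..spectral_edge} F" unfolding F_def[abs_def]
      by (intro continuous_on_add continuous_on_mult continuous_on_diff continuous_on_const
          continuous_on_power continuous_on_id continuous_on_arc_height)
    fix x assume "x \<in> {0<..<spectral_edge}"
    hence x: "0 < x" "x < spectral_edge" by auto
    note q = arc_height_bounds[OF x]
    define F' where "F' x = 27 / 4 * x ^ (2 * k) * (arc_height x * (x * Z_codensity x) - (?K +
        1) * (x * Z_density x)) + (?K + 2) * x ^ (2 * k + 2) * (x * Z_density x)" for x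
    have "(F' has_real_derivative
       27 / 4 * (x ^ (2 * k) * ((- (4 * x / (27 * arc_height x)) * (x * Z_codensity x) +
           (Z_codensity x + x * (Z_density x / (9 * x * arc_height x))) * arc_height x) - (?K +
           1) * (Z_density x + x * (Z_codensity x / (x * arc_height x))))
        + ?K * x ^ (2 * k) / x * (arc_height x * (x * Z_codensity x) - (?K +
            1) * (x * Z_density x)))
       + (?K + 2) * (x ^ (2 * k + 2) * (Z_density x + x * (Z_codensity x / (x * arc_height x))) +
           (?K + 2) * x ^ (2 * k + 1) * (x * Z_density x))) (at x)"
    proof -
      have px: "((\<lambda>x. x ^ (2 * k)) has_real_derivative ?K * x ^ (2 * k) / x) (at x)"
      proof -
        have "?K * x ^ (2 * k - Suc 0) = ?K * x ^ (2 * k) / x"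
        proof (cases k)
          case (Suc n)
          hence "2 * k = Suc (2 * k - Suc 0)" by simp
          hence "x ^ (2 * k) = x * x ^ (2 * k - Suc 0)" by (metis power_Suc)
          hence "x ^ (2 * k) / x = x ^ (2 * k - Suc 0)" using x
              by (metis less_irrefl nonzero_mult_div_cancel_left)
          thus ?thesis by (simp only: times_divide_eq_right[symmetric])
        qed simp
        moreover have "((\<lambda>x. x ^ (2 * k)) has_real_derivative ?K * x ^ (2 * k - Suc 0)) (at x)"
          by (rule DERIV_pow)
        ultimately show ?thesis by (simp only:)
      qed
      have px2: "((\<lambda>x. x ^ (2 * k + 2)) has_real_derivative (?K + 2) * x ^ (2 * k + 1)) (at x)"
      proof -
        have e: "?K + 2 = real (2 * k + 2)" "2 * k + 1 = 2 * k + 2 - Suc 0" by simp_all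
        show ?thesis unfolding e by (rule DERIV_pow)
      qed
      show ?thesis unfolding F'_def[abs_def]
        by (rule px px2 arc_height_deriv[OF x] Z_density_deriv[OF x] Z_codensity_deriv[OF x]
            derivative_eq_intros refl)+ (use x q(1) in \<open>simp add: field_simps\<close>)
    qed
    also have "27 / 4 * (x ^ (2 * k) * ((- (4 * x / (27 * arc_height x)) * (x * Z_codensity x) +
        (Z_codensity x + x * (Z_density x / (9 * x * arc_height x))) * arc_height x) - (?K +
        1) * (Z_density x + x * (Z_codensity x / (x * arc_height x))))
        + ?K * x ^ (2 * k) / x * (arc_height x * (x * Z_codensity x) - (?K +
            1) * (x * Z_density x)))
       + (?K + 2) * (x ^ (2 * k + 2) * (Z_density x + x * (Z_codensity x / (x * arc_height x))) +
           (?K + 2) * x ^ (2 * k + 1) * (x * Z_density x))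
      = x ^ (2 * k) * (27 / 4 * ((- (4 * x\<^sup>2 / 27) + (arc_height x)\<^sup>2 * (?K + 1) - (?K +
          1)) * (Z_codensity x / arc_height x) + (1 / 9 - (?K + 1)\<^sup>2) * Z_density x)
         + (?K + 2) * x\<^sup>2 * ((Z_codensity x / arc_height x) + (?K + 3) * Z_density x))"
      using x q(1) by (simp add: divide_simps) (simp add: algebra_simps power2_eq_square power_add)
    also have "\<dots> = ?f x"
      unfolding q(3) using x q(1) by (simp add: divide_simps)
          (simp add: algebra_simps power2_eq_square power_add)
    finally have "(F' has_real_derivative ?f x) (at x)" .
    hence "(F has_real_derivative ?f x) (at x)"
      by (rule has_field_derivative_transform_within_open[of _ _ _ "{0<..<spectral_edge}"])
         (use x in \<open>auto simp: F_def F'_def A_def B_def Z_density_arc_param\<close>)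
    thus "(F has_vector_derivative ?f x) (at x)"
      by (simp add: has_real_derivative_iff_has_vector_derivative)
  qed
  moreover have "F spectral_edge = 0" by (simp add: F_def A_def B_def arc_param_ends
      arc_height_ends)
  moreover have "F 0 = 0" by (simp add: F_def A_def B_def arc_param_ends arc_height_ends)
  ultimately show ?thesis by simp
qed

theorem Z_density_moments: "((\<lambda>x. x ^ (2 * k) * Z_density x) has_integral real (fuss_catalan k))
    {0..spectral_edge}"
proof (induction k)
  case 0
  thus ?case using Z_density_integral by simp
next
  case (Suc k)
  let ?c = "real ((2 * k + 2) * (2 * k + 3))" and ?d = "real (3 * (3 * k + 1) * (3 * k + 2))"
  have "((\<lambda>x. (?c * (x ^ (2 * k + 2) * Z_density x) - ?d * (x ^ (2 * k) * Z_density x)) +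
      ?d * (x ^ (2 * k) * Z_density x))
      has_integral 0 + ?d * real (fuss_catalan k)) {0..spectral_edge}"
    by (intro has_integral_add Z_density_moment_step has_integral_mult_right Suc.IH)
  hence "((\<lambda>x. ?c * (x ^ (2 * k + 2) * Z_density x)) has_integral ?c * real (fuss_catalan (Suc
      k))) {0..spectral_edge}"
    using fuss_catalan_ratio[of k] by simp
  from has_integral_mult_right[OF this, of "1 / ?c"] show ?case
    by (simp del: of_nat_mult of_nat_add fuss_catalan.simps)
qed

section \<open>The method of moments\<close>

text \<open>A bounded continuous function is approximated on \<open>[0, a + 1]\<close>
    by a polynomial in \<open>x\<^sup>2\<close>. Beyond \<open>a + 1\<close> the error is at
most \<open>C x^(2d)\<close>, and its integral is bounded by a moment of order \<open>2 (d + l)\<close> divided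
    by \<open>(a + 1)^(2l)\<close>, which is small for
large \<open>l\<close> because the moments of the limit grow at most like powers of \<open>a\<close>. The assumptions on \<open>\<mu>
    n\<close> are made
for large \<open>n\<close> only, as the singular value distribution of an empty matrix is arbitrary.\<close>

theorem moments_imp_weak_conv:
  fixes \<mu> :: "nat \<Rightarrow> real measure"
  assumes rd: "\<And>n. real_distribution (\<mu> n)" "real_distribution M"
    and supp: "\<And>n. N \<le> n \<Longrightarrow> AE x in \<mu> n. 0 \<le> x" "AE x in M. 0 \<le> x \<and> x \<le> a" "0 \<le> a"
    and int: "\<And>n k. N \<le> n \<Longrightarrow> integrable (\<mu> n) (\<lambda>x. x ^ (2 * k))" "\<And>k. integrable M (\<lambda>x. x ^ (2 * k))"
    and lim: "\<And>k. (\<lambda>n. \<integral>x. x ^ (2 * k) \<partial>\<mu> n) \<longlonglongrightarrow> (\<integral>x. x ^ (2 * k) \<partial>M)"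
  shows "weak_conv_m \<mu> M"
proof (rule integral_bdd_continuous_conv_imp_weak_conv[OF rd])
  fix f :: "real \<Rightarrow> real"
  assume f: "\<And>x. isCont f x" "\<And>x. \<bar>f x\<bar> \<le> 1"
  have fc: "continuous_on UNIV f" using f(1) by (simp add: continuous_at_imp_continuous_on)
  have fm: "f \<in> borel_measurable borel" using fc by (rule borel_measurable_continuous_onI)
  have fi: "integrable D f" if D: "real_distribution D" for D
  proof -
    interpret real_distribution D by (rule D)
    show ?thesis by (rule integrable_const_bound[of _ 1]) (use f fm in auto)
  qed
  show "(\<lambda>n. integral\<^sup>L (\<mu> n) f) \<longlonglongrightarrow> integral\<^sup>L M f"
  proof (rule LIMSEQ_I)
    fix r :: real assume "0 < r"
    define e where "e = r / 4"
    have e: "0 < e" using \<open>0 < r\<close> by (simp add: e_def)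
    (* Any bound larger than a and at least 1 works: the ratio a / R must be smaller than 1. *)
    define R where "R = a + 1"
    have R: "1 \<le> R" "a < R" using supp(3) by (auto simp: R_def)
    have "continuous_on {0..R\<^sup>2} (\<lambda>y. f (sqrt y))"
      by (rule continuous_on_compose2[OF fc]) (auto intro!: continuous_intros)
    then obtain g where g: "real_polynomial_function g" "\<And>y. y \<in> {0..R\<^sup>2} \<Longrightarrow> \<bar>f (sqrt y) - g y\<bar> < e"
      using Stone_Weierstrass_real_polynomial_function[of "{0..R\<^sup>2}" "\<lambda>y. f (sqrt y)" e] e by auto
    obtain c d where cd: "\<And>y. g y = (\<Sum>i\<le>d. c i * y ^ i)"
      using g(1) unfolding real_polynomial_function_iff_sum by auto
    define Q where "Q x = (\<Sum>i\<le>d. c i * x ^ (2 * i))" for x :: real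
    have Qg: "Q x = g (x\<^sup>2)" for x by (simp add: Q_def cd power_mult)
    define C where "C = 1 + (\<Sum>i\<le>d. \<bar>c i\<bar>)"
    have C: "0 \<le> C" unfolding C_def by (intro add_nonneg_nonneg sum_nonneg) auto
    have near: "\<bar>f x - Q x\<bar> \<le> e" if "0 \<le> x" "x \<le> R" for x
    proof -
      have "x\<^sup>2 \<in> {0..R\<^sup>2}" using that by (auto intro: power_mono)
      from g(2)[OF this] show ?thesis using that by (simp add: Qg)
    qed
    have far: "\<bar>f x - Q x\<bar> \<le> C * x ^ (2 * d)" if "1 \<le> x" for x
    proof -
      have "\<bar>Q x\<bar> \<le> (\<Sum>i\<le>d. \<bar>c i * x ^ (2 * i)\<bar>)" unfolding Q_def by (rule sum_abs)
      also have "\<dots> \<le> (\<Sum>i\<le>d. \<bar>c i\<bar> * x ^ (2 * d))"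
        using that by (intro sum_mono) (auto simp: abs_mult intro!: mult_left_mono power_increasing)
      also have "\<dots> = (\<Sum>i\<le>d. \<bar>c i\<bar>) * x ^ (2 * d)" by (simp add: sum_distrib_right)
      finally have "\<bar>Q x\<bar> \<le> (\<Sum>i\<le>d. \<bar>c i\<bar>) * x ^ (2 * d)" .
      moreover have "1 \<le> x ^ (2 * d)" using that by (rule one_le_power)
      ultimately have "\<bar>f x\<bar> + \<bar>Q x\<bar> \<le> x ^ (2 * d) + (\<Sum>i\<le>d. \<bar>c i\<bar>) * x ^ (2 * d)"
        using f(2)[of x] by linarith
      thus ?thesis by (simp add: C_def algebra_simps)
    qed
    have both: "\<bar>f x - Q x\<bar> \<le> e + C / R ^ (2 * l) * x ^ (2 * (d + l))" if "0 \<le> x" for x l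
    proof (cases "x \<le> R")
      case True
      have "0 \<le> C / R ^ (2 * l) * x ^ (2 * (d + l))" using C R that by simp
      thus ?thesis using near[OF that True] by linarith
    next
      case False
      hence x: "1 \<le> x" "R \<le> x" using R by auto
      have "C * x ^ (2 * d) * 1 \<le> C * x ^ (2 * d) * (x ^ (2 * l) / R ^ (2 * l))"
        using C R x that by (intro mult_left_mono) (auto simp: le_divide_eq power_mono)
      also have "\<dots> = C / R ^ (2 * l) * x ^ (2 * (d + l))" by (simp add: power_add algebra_simps)
      finally show ?thesis using far[OF x(1)] e by simp
    qed
    have "(\<lambda>l. C * a ^ (2 * d) * ((a / R)\<^sup>2) ^ l) \<longlonglongrightarrow> C * a ^ (2 * d) * 0"
      using R supp(3) by (intro tendsto_mult tendsto_const LIMSEQ_power_zero) (auto simp: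
          power_less_one_iff)
    hence "\<forall>\<^sub>F l in sequentially. C * a ^ (2 * d) * ((a / R)\<^sup>2) ^ l < e"
      using e by (intro order_tendstoD(2)) auto
    then obtain l where l: "C * a ^ (2 * d) * ((a / R)\<^sup>2) ^ l < e"
      by (auto simp: eventually_sequentially)
    define m where "m n = (\<integral>x. x ^ (2 * (d + l)) \<partial>\<mu> n)" for n
    interpret MM: real_distribution M by (rule rd(2))
    have "AE x in M. x ^ (2 * (d + l)) \<le> a ^ (2 * (d + l))"
      using supp(2) by (rule eventually_mono) (blast intro: power_mono)
    hence "(\<integral>x. x ^ (2 * (d + l)) \<partial>M) \<le> (\<integral>x. a ^ (2 * (d + l)) \<partial>M)"
      by (intro integral_mono_AE int(2)) simp_all
    hence "(\<integral>x. x ^ (2 * (d + l)) \<partial>M) \<le> a ^ (2 * (d + l))" using MM.prob_space by simp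
    hence "C / R ^ (2 * l) * (\<integral>x. x ^ (2 * (d + l)) \<partial>M) \<le> C / R ^ (2 * l) * a ^ (2 * (d + l))"
      using C R by (intro mult_left_mono) auto
    also have "\<dots> = C * a ^ (2 * d) * ((a / R)\<^sup>2) ^ l"
      by (simp add: power_add power_divide algebra_simps flip: power_mult)
    finally have lM: "C / R ^ (2 * l) * (\<integral>x. x ^ (2 * (d + l)) \<partial>M) < e" using l by simp
    have "(\<lambda>n. C / R ^ (2 * l) * m n) \<longlonglongrightarrow> C / R ^ (2 * l) * (\<integral>x. x ^ (2 * (d + l)) \<partial>M)"
      unfolding m_def by (intro tendsto_intros lim)
    hence ev1: "\<forall>\<^sub>F n in sequentially. C / R ^ (2 * l) * m n < e" using lM
        by (rule order_tendstoD(2))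
    have QM: "integrable M Q" and IQM: "(\<integral>x. Q x \<partial>M) = (\<Sum>i\<le>d. c i * (\<integral>x. x ^ (2 * i) \<partial>M))"
      unfolding Q_def using int(2) by (auto simp: integral_sum)
    have Qn: "integrable (\<mu> n) Q" and IQn: "(\<integral>x. Q x \<partial>\<mu> n) = (\<Sum>i\<le>d. c i * (\<integral>x. x ^ (2 * i) \<partial>\<mu> n))"
        if "N \<le> n" for n
      unfolding Q_def using int(1)[OF that] by (auto simp: integral_sum)
    have "(\<lambda>n. \<Sum>i\<le>d. c i * (\<integral>x. x ^ (2 * i) \<partial>\<mu> n)) \<longlonglongrightarrow> (\<Sum>i\<le>d. c i * (\<integral>x. x ^ (2 * i) \<partial>M))"
      by (intro tendsto_intros lim)
    hence ev2: "\<forall>\<^sub>F n in sequentially. \<bar>(\<Sum>i\<le>d. c i * (\<integral>x. x ^ (2 * i) \<partial>\<mu> n)) - (\<Sum>i\<le>d. c i * (\<integral>x. x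
        ^ (2 * i) \<partial>M))\<bar> < e"
      using e by (auto simp: tendsto_iff dist_real_def)
    have dM: "\<bar>(\<integral>x. f x \<partial>M) - (\<integral>x. Q x \<partial>M)\<bar> \<le> e"
    proof -
      have "\<bar>(\<integral>x. f x \<partial>M) - (\<integral>x. Q x \<partial>M)\<bar> = \<bar>\<integral>x. f x - Q x \<partial>M\<bar>"
        using fi[OF rd(2)] QM by simp
      also have "\<dots> \<le> (\<integral>x. \<bar>f x - Q x\<bar> \<partial>M)" by (rule integral_abs_bound)
      also have "AE x in M. \<bar>f x - Q x\<bar> \<le> e"
        using supp(2) by (rule eventually_mono) (use near R in force)
      hence "(\<integral>x. \<bar>f x - Q x\<bar> \<partial>M) \<le> (\<integral>x. e \<partial>M)"
        using fi[OF rd(2)] QM by (intro integral_mono_AE) simp_all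
      finally show ?thesis using MM.prob_space by simp
    qed
    have dn: "\<bar>(\<integral>x. f x \<partial>\<mu> n) - (\<integral>x. Q x \<partial>\<mu> n)\<bar> \<le> e + C / R ^ (2 * l) * m n" if n: "N \<le> n" for n
    proof -
      interpret D: real_distribution "\<mu> n" by (rule rd(1))
      have "\<bar>(\<integral>x. f x \<partial>\<mu> n) - (\<integral>x. Q x \<partial>\<mu> n)\<bar> = \<bar>\<integral>x. f x - Q x \<partial>\<mu> n\<bar>"
        using fi[OF rd(1)] Qn[OF n] by simp
      also have "\<dots> \<le> (\<integral>x. \<bar>f x - Q x\<bar> \<partial>\<mu> n)" by (rule integral_abs_bound)
      also have "\<dots> \<le> (\<integral>x. e + C / R ^ (2 * l) * x ^ (2 * (d + l)) \<partial>\<mu> n)"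
      proof (rule integral_mono_AE)
        show "AE x in \<mu> n. \<bar>f x - Q x\<bar> \<le> e + C / R ^ (2 * l) * x ^ (2 * (d + l))"
          using supp(1)[OF n] by (rule eventually_mono) (rule both)
      qed (use fi[OF rd(1)] Qn[OF n] int(1)[OF n, of "d + l"] in simp_all)
      also have "\<dots> = e + C / R ^ (2 * l) * m n"
        using int(1)[OF n, of "d + l"] D.prob_space by (simp add: m_def)
      finally show ?thesis .
    qed
    have "\<forall>\<^sub>F n in sequentially. norm (integral\<^sup>L (\<mu> n) f - integral\<^sup>L M f) < r"
      using ev1 ev2 eventually_ge_at_top[of N]
    proof eventually_elim
      case (elim n)
      have chain: "\<bar>A - B\<bar> < 4 * e" if "\<bar>A - A'\<bar> \<le> e + t" "t < e" "\<bar>A' - B'\<bar> < e" "\<bar>B - B'\<bar> \<le> e"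
          for A A' B B' t :: real
        using that by linarith
      have "\<bar>integral\<^sup>L (\<mu> n) f - integral\<^sup>L M f\<bar> < 4 * e"
        using dn[OF elim(3)] elim(1,2) dM unfolding IQn[OF elim(3)] IQM by (rule chain)
      thus ?case by (simp add: e_def)
    qed
    thus "\<exists>no. \<forall>n\<ge>no. norm (integral\<^sup>L (\<mu> n) f - integral\<^sup>L M f) < r"
      by (auto simp: eventually_sequentially)
  qed
qed

lemma sum_count_eq_sum_mset:
  fixes f :: "'a \<Rightarrow> real"
  assumes "finite A" "set_mset S \<subseteq> A"
  shows "(\<Sum>x\<in>A. f x * real (count S x)) = (\<Sum>x\<in>#S. f x)"
  using assms(2)
proof (induction S)
  case (add a S)
  have "(\<Sum>x\<in>A. f x * real (count (add_mset a S) x)) = (\<Sum>x\<in>A. f x * real (count S x) + (if x =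
      a then f a else 0))"
    by (intro sum.cong refl) (auto simp: algebra_simps)
  also have "\<dots> = (\<Sum>x\<in>A. f x * real (count S x)) + f a"
    using assms(1) add.prems by (simp add: sum.distrib)
  finally show ?case using add by simp
qed simp

lemma integral_pmf_of_multiset:
  fixes f :: "'a \<Rightarrow> real"
  assumes "S \<noteq> {#}"
  shows "(\<integral>x. f x \<partial>measure_pmf (pmf_of_multiset S)) = (\<Sum>x\<in>#S. f x) / size S"
proof -
  have "(\<integral>x. f x \<partial>measure_pmf (pmf_of_multiset S)) =
      (\<Sum>x\<in>set_mset S. f x * pmf (pmf_of_multiset S) x)"
    by (rule integral_measure_pmf_real) (use assms in auto)
  also have "\<dots> = (\<Sum>x\<in>set_mset S. f x * real (count S x)) / size S"
    using assms by (simp add: sum_divide_distrib)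
  finally show ?thesis by (simp add: sum_count_eq_sum_mset)
qed

section \<open>Almost sure convergence\<close>

lemma Z_density_borel [measurable]: "Z_density \<in> borel_measurable borel"
  unfolding Z_density_def[abs_def] arc_log_def arc_height_def sinh_field_def by measurable

lemma Z_density_nn_integral: "(\<integral>\<^sup>+x. ennreal (x ^ (2 * k) * Z_density x) \<partial>lborel) =
    ennreal (fuss_catalan k)"
proof (rule nn_integral_has_integral_lborel)
  show "((\<lambda>x. x ^ (2 * k) * Z_density x) has_integral real (fuss_catalan k)) UNIV"
    by (rule has_integral_on_superset[OF Z_density_moments]) (auto simp: Z_density_def)
qed (simp_all add: Z_density_nonneg)

lemma Z_limit_eq: "Z_limit = density lborel (\<lambda>x. ennreal (Z_density x))"
  by (simp add: Z_limit_def g_Z_eq)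

lemma real_distribution_Z_limit: "real_distribution Z_limit"
proof -
  have "emeasure Z_limit (space Z_limit) = 1"
    using Z_density_nn_integral[of 0] by (simp add: Z_limit_eq emeasure_density)
  thus ?thesis
    by (simp add: real_distribution_def real_distribution_axioms_def prob_spaceI)
        (simp add: Z_limit_eq)
qed

lemma Z_limit_moments:
  "integrable Z_limit (\<lambda>x. x ^ (2 * k))" "(\<integral>x. x ^ (2 * k) \<partial>Z_limit) = fuss_catalan k"
proof -
  have "has_bochner_integral lborel (\<lambda>x. x ^ (2 * k) * Z_density x) (real (fuss_catalan k))"
    by (rule has_bochner_integral_nn_integral)
        (simp_all add: Z_density_nn_integral Z_density_nonneg)
  hence "integrable lborel (\<lambda>x. Z_density x * x ^ (2 * k))"
      "(\<integral>x. Z_density x * x ^ (2 * k) \<partial>lborel) = real (fuss_catalan k)"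
    by (simp_all add: has_bochner_integral_iff mult.commute)
  thus "integrable Z_limit (\<lambda>x. x ^ (2 * k))" "(\<integral>x. x ^ (2 * k) \<partial>Z_limit) = fuss_catalan k"
    by (simp_all add: Z_limit_eq integrable_density integral_density Z_density_nonneg)
qed

lemma Z_limit_support: "AE x in Z_limit. 0 \<le> x \<and> x \<le> spectral_edge"
proof -
  have "(\<lambda>x. ennreal (Z_density x)) \<in> borel_measurable lborel" by simp
  moreover have "AE x in lborel. 0 < ennreal (Z_density x) \<longrightarrow> 0 \<le> x \<and> x \<le> spectral_edge"
      by (auto simp: Z_density_def)
  ultimately show ?thesis unfolding Z_limit_eq by (subst AE_density)
qed

lemma sv_distribution_real: "real_distribution (sv_distribution M)"
  unfolding sv_distribution_def real_distribution_def real_distribution_axioms_def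
  by (simp add: measure_pmf.prob_space_distr)

lemma sv_distribution_Z:
  fixes n :: nat and E :: "nat set set"
  assumes n: "2 \<le> n"
  defines "D \<equiv> sv_distribution ((1 / real n) \<cdot>\<^sub>m Z_matrix n E)"
  shows "AE x in D. 0 \<le> x" "integrable D (\<lambda>x. x ^ (2 * k))" "(\<integral>x. x ^ (2 * k) \<partial>D) =
      gram_moment n k E"
proof -
  let ?N = "n * (n - 1)" and ?M = "(1 / real n) \<cdot>\<^sub>m Z_matrix n E"
  have Z: "Z_matrix n E \<in> carrier_mat ?N ?N" by (simp add: Z_matrix_def)
  hence M: "?M \<in> carrier_mat ?N ?N" by simp
  have N: "0 < ?N" using n by simp
  note sv = singular_values_props[OF M]
  have ne: "singular_values ?M \<noteq> {#}" using sv(1) N by auto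
  let ?p = "pmf_of_multiset (singular_values ?M)"
  have set: "set_pmf ?p = set_mset (singular_values ?M)" using ne by simp
  show "AE x in D. 0 \<le> x"
    unfolding D_def sv_distribution_def using sv(2) set
        by (simp add: AE_distr_iff AE_measure_pmf_iff)
  have "integrable (measure_pmf ?p) (\<lambda>x. x ^ (2 * k))"
    by (rule integrable_measure_pmf_finite) (simp add: set)
  thus "integrable D (\<lambda>x. x ^ (2 * k))"
    unfolding D_def sv_distribution_def by (simp add: integrable_distr_eq)
  have "(\<integral>x. x ^ (2 * k) \<partial>D) = (\<integral>x. x ^ (2 * k) \<partial>measure_pmf ?p)"
    unfolding D_def sv_distribution_def by (simp add: integral_distr)
  also have "\<dots> = (\<Sum>x\<in>#singular_values ?M. x ^ (2 * k)) / real ?N"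
    unfolding integral_pmf_of_multiset[OF ne] sv(1) ..
  also have "(\<Sum>x\<in>#singular_values ?M. x ^ (2 * k)) = (1 / real n) ^ (2 * k) * gram_trace n k E"
    unfolding sv(3) trace_gram_scaled[OF Z] gram_trace_def ..
  finally show "(\<integral>x. x ^ (2 * k) \<partial>D) = gram_moment n k E"
    by (simp add: gram_moment_def power_one_over field_simps)
qed

lemma nn_integral_random_graph:
  assumes "has_law_G_half P n X" and f: "\<And>E. 0 \<le> f E"
  shows "(\<integral>\<^sup>+\<omega>. ennreal (f (X \<omega>)) \<partial>P) = ennreal (mean n f)"
proof -
  have X: "X \<in> measurable P (count_space (graphs n))"
    and d: "distr P (count_space (graphs n)) X = uniform_count_measure (graphs n)"
    using assms(1) by (auto simp: has_law_G_half_def)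
  have "(\<integral>\<^sup>+\<omega>. ennreal (f (X \<omega>)) \<partial>P) = (\<integral>\<^sup>+E. ennreal (f E) \<partial>distr P (count_space (graphs n)) X)"
    by (rule nn_integral_distr[symmetric, OF X]) simp
  also have "\<dots> = (\<Sum>E\<in>graphs n. ennreal (1 / card (graphs n)) * ennreal (f E))"
    unfolding d uniform_count_measure_def by (rule nn_integral_point_measure_finite) simp
  also have "\<dots> = (\<Sum>E\<in>graphs n. ennreal (f E / card (graphs n)))"
    by (intro sum.cong refl) (simp add: ennreal_mult[symmetric] f)
  also have "\<dots> = ennreal (mean n f)"
    by (simp add: mean_def sum_divide_distrib f)
  finally show ?thesis .
qed

text \<open>The variances are summable, so the sum of the squared deviations from the means is almost
    surely finite.\<close>

theorem AE_gram_moment: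
  fixes P :: "'w measure" and G :: "nat \<Rightarrow> 'w \<Rightarrow> nat set set"
  assumes G: "\<And>n. has_law_G_half P n (G n)"
  shows "AE \<omega> in P. (\<lambda>n. gram_moment n k (G n \<omega>)) \<longlonglongrightarrow> fuss_catalan k"
proof -
  obtain K where K: "\<And>n. 2 \<le> n \<Longrightarrow> mean n (\<lambda>E. (gram_moment n k E - mean n (gram_moment n k))\<^sup>2) \<le>
      K / (real n)\<^sup>2"
    using variance_gram_moment by blast
  define Y where "Y n \<omega> = (gram_moment (n + 2) k (G (n + 2) \<omega>) - mean (n + 2) (gram_moment (n +
      2) k))\<^sup>2" for n \<omega>
  have meas: "G n \<in> measurable P (count_space (graphs n))" for n using G
      by (simp add: has_law_G_half_def)
  have Ym [measurable]: "(\<lambda>\<omega>. ennreal (Y n \<omega>)) \<in> borel_measurable P" for n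
    unfolding Y_def by (rule measurable_compose[OF meas]) simp
  have "(\<integral>\<^sup>+\<omega>. (\<Sum>n. ennreal (Y n \<omega>)) \<partial>P) = (\<Sum>n. \<integral>\<^sup>+\<omega>. ennreal (Y n \<omega>) \<partial>P)"
    by (rule nn_integral_suminf) simp
  also have "\<dots> \<le> (\<Sum>n. ennreal (\<bar>K\<bar> * (1 / (real (n + 2))\<^sup>2)))"
  proof (rule suminf_le)
    fix n
    have "(\<integral>\<^sup>+\<omega>. ennreal (Y n \<omega>) \<partial>P) = ennreal (mean (n + 2) (\<lambda>E. (gram_moment (n +
        2) k E - mean (n + 2) (gram_moment (n + 2) k))\<^sup>2))"
      unfolding Y_def
      by (rule nn_integral_random_graph[OF G, of "\<lambda>E. (gram_moment (n + 2) k E - mean (n +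
          2) (gram_moment (n + 2) k))\<^sup>2" "n + 2"]) simp
    also have "\<dots> \<le> ennreal (\<bar>K\<bar> * (1 / (real (n + 2))\<^sup>2))"
    proof (rule ennreal_leI)
      have "K / (real (n + 2))\<^sup>2 \<le> \<bar>K\<bar> / (real (n + 2))\<^sup>2" by (intro divide_right_mono) auto
      thus "mean (n + 2) (\<lambda>E. (gram_moment (n + 2) k E - mean (n + 2) (gram_moment (n +
          2) k))\<^sup>2) \<le> \<bar>K\<bar> * (1 / (real (n + 2))\<^sup>2)"
        using K[of "n + 2"] by simp
    qed
    finally show "(\<integral>\<^sup>+\<omega>. ennreal (Y n \<omega>) \<partial>P) \<le> ennreal (\<bar>K\<bar> * (1 / (real (n + 2))\<^sup>2))" .
  qed auto
  also have "\<dots> < \<infinity>"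
  proof -
    have "summable (\<lambda>n. inverse ((real n) ^ 2))" by (rule inverse_power_summable) simp
    hence "summable (\<lambda>n. inverse ((real (n + 2)) ^ 2))" by (rule summable_ignore_initial_segment)
    hence "summable (\<lambda>n. \<bar>K\<bar> * (1 / (real (n + 2))\<^sup>2))"
        by (intro summable_mult) (simp add: inverse_eq_divide)
    thus ?thesis by (simp add: suminf_ennreal2 less_top[symmetric])
  qed
  finally have "(\<integral>\<^sup>+\<omega>. (\<Sum>n. ennreal (Y n \<omega>)) \<partial>P) \<noteq> \<infinity>" by simp
  hence "AE \<omega> in P. (\<Sum>n. ennreal (Y n \<omega>)) \<noteq> \<infinity>" by (intro nn_integral_PInf_AE) simp_all
  thus ?thesis
  proof (rule eventually_mono)
    fix \<omega> assume "(\<Sum>n. ennreal (Y n \<omega>)) \<noteq> \<infinity>"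
    hence "summable (\<lambda>n. Y n \<omega>)" by (intro summable_suminf_not_top) (simp_all add: Y_def)
    hence "(\<lambda>n. Y n \<omega>) \<longlonglongrightarrow> 0" by (rule summable_LIMSEQ_zero)
    hence "(\<lambda>n. sqrt (Y n \<omega>)) \<longlonglongrightarrow> sqrt 0" by (rule tendsto_real_sqrt)
    hence "(\<lambda>n. gram_moment (n + 2) k (G (n + 2) \<omega>) - mean (n + 2) (gram_moment (n + 2) k)) \<longlonglongrightarrow> 0"
      by (simp add: Y_def tendsto_rabs_zero_iff)
    moreover have "(\<lambda>n. mean (n + 2) (gram_moment (n + 2) k)) \<longlonglongrightarrow> fuss_catalan k"
      by (rule LIMSEQ_ignore_initial_segment[OF mean_gram_moment])
    ultimately have "(\<lambda>n. gram_moment (n + 2) k (G (n + 2) \<omega>)) \<longlonglongrightarrow> fuss_catalan k"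
      using tendsto_add by fastforce
    thus "(\<lambda>n. gram_moment n k (G n \<omega>)) \<longlonglongrightarrow> fuss_catalan k" by (rule LIMSEQ_offset)
  qed
qed

theorem theorem1p17:
  fixes P :: "'w measure" and G :: "nat \<Rightarrow> 'w \<Rightarrow> nat set set"
  assumes "prob_space P"
    and "\<And>n. has_law_G_half P n (G n)"
  shows "real_nonneg g_Z \<and> real_distribution Z_limit \<and>
    (AE \<omega> in P. weak_conv_m
       (\<lambda>n. sv_distribution ((1 / real n) \<cdot>\<^sub>m Z_matrix n (G n \<omega>))) Z_limit)"
proof (intro conjI real_nonneg_g_Z real_distribution_Z_limit)
  have "AE \<omega> in P. \<forall>k. (\<lambda>n. gram_moment n k (G n \<omega>)) \<longlonglongrightarrow> fuss_catalan k"
    unfolding AE_all_countable by (intro allI AE_gram_moment assms)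
  thus "AE \<omega> in P. weak_conv_m (\<lambda>n. sv_distribution ((1 / real n) \<cdot>\<^sub>m Z_matrix n (G n \<omega>))) Z_limit"
  proof (rule eventually_mono)
    fix \<omega> assume lim: "\<forall>k. (\<lambda>n. gram_moment n k (G n \<omega>)) \<longlonglongrightarrow> fuss_catalan k"
    show "weak_conv_m (\<lambda>n. sv_distribution ((1 / real n) \<cdot>\<^sub>m Z_matrix n (G n \<omega>))) Z_limit"
    proof (rule moments_imp_weak_conv[where N = 2 and a = spectral_edge])
      fix k
      let ?D = "\<lambda>n. sv_distribution ((1 / real n) \<cdot>\<^sub>m Z_matrix n (G n \<omega>))"
      have "\<forall>\<^sub>F n in sequentially. gram_moment n k (G n \<omega>) = (\<integral>x. x ^ (2 * k) \<partial>?D n)"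
        using eventually_ge_at_top[of 2] by eventually_elim (simp only: sv_distribution_Z(3))
      thus "(\<lambda>n. \<integral>x. x ^ (2 * k) \<partial>?D n) \<longlonglongrightarrow> (\<integral>x. x ^ (2 * k) \<partial>Z_limit)"
        unfolding Z_limit_moments(2) using lim by (blast intro: Lim_transform_eventually)
    qed (use sv_distribution_real real_distribution_Z_limit sv_distribution_Z Z_limit_support
        Z_limit_moments(1) spectral_edge in auto)
  qed
qed

end
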